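(* Let $n\ge 2$ and let $\mathbb{V}$ and $\mathbb{W}$ be $n$-tuples of commuting shifts of finite multiplicity. If $\mathbb{V}$ and $\mathbb{W}$ are virtually quasi-similar, then $\mathbb{V}\approx\mathbb{W}$.
   Context: All Hilbert spaces are complex and separable; subspaces are closed. An isometry $V$ on a Hilbert space $\mathfrak{H}$ is a shift of multiplicity $k$ ($k$ a positive integer) if it is unitarily equivalent to the unilateral shift on $\ell^2(\mathbb{N})\otimes\mathbb{C}^k$; it is a shift of finite multiplicity if this holds for some positive integer $k$ (the entries of a tuple may have different multiplicities). Let $\mathbb{V}$ act on $\mathfrak{H}$ and $\mathbb{W}$ act on $\mathfrak{K}$. They are virtually quasi-similar if there are injective bounded linear operators $X:\mathfrak{H}\to\mathfrak{K}$ and $Y:\mathfrak{K}\to\mathfrak{H}$ such that $\dim(\mathrm{ran}\,X)^\perp<\infty$, $\dim(\mathrm{ran}\,Y)^\perp<\infty$, and $XV_i=W_iX$, $YW_i=V_iY$ for $i=1,\dots,n$. Write $\mathbb{V}\lesssim\mathbb{W}$ if there is a subspace $\mathfrak{K}'\subseteq\mathfrak{K}$ of finite codimension, invariant under every $W_i$, and a boundedly invertible operator $S:\mathfrak{H}\to\mathfrak{K}'$ with $SV_i=W_iS$ for $i=1,\dots,n$. Write $\mathbb{V}\approx\mathbb{W}$ if $\mathbb{V}\lesssim\mathbb{W}$ and $\mathbb{W}\lesssim\mathbb{V}$. *)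

theory Defs
  imports "HOL-Analysis.Analysis"
begin

section \<open>Complex Hilbert spaces\<close>

text \<open>
  The inner product \<open>cinner\<close> is linear in its first argument. The real inner product
  of \<^class>\<open>real_inner\<close> is required to be its real part, so that norm, metric and topology are the
  usual ones: \<open>norm x = sqrt (Re (cinner x x))\<close>.
  Positivity and definiteness of \<open>cinner\<close> follow from those of the real inner product.
\<close>

class complex_hilbert_space = real_inner + complete_space +
  fixes scaleC :: "complex \<Rightarrow> 'a \<Rightarrow> 'a" (infixr "*\<^sub>C" 75)
    and cinner :: "'a \<Rightarrow> 'a \<Rightarrow> complex"
  assumes scaleC_add_right: "c *\<^sub>C (x + y) = c *\<^sub>C x + c *\<^sub>C y"
    and scaleC_add_left: "(c + d) *\<^sub>C x = c *\<^sub>C x + d *\<^sub>C x"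
    and scaleC_scaleC: "c *\<^sub>C d *\<^sub>C x = (c * d) *\<^sub>C x"
    and scaleR_scaleC: "r *\<^sub>R x = complex_of_real r *\<^sub>C x"
    and cinner_commute: "cinner x y = cnj (cinner y x)"
    and cinner_add_left: "cinner (x + y) z = cinner x z + cinner y z"
    and cinner_scaleC_left: "cinner (c *\<^sub>C x) y = c * cinner x y"
    and inner_eq_Re_cinner: "x \<bullet> y = Re (cinner x y)"

global_interpretation cvec:
  vector_space "scaleC :: complex \<Rightarrow> 'a \<Rightarrow> 'a::complex_hilbert_space"
proof
  fix x :: 'a
  show "1 *\<^sub>C x = x"
    using scaleR_scaleC [of 1 x] by simp
qed (simp_all add: scaleC_add_right scaleC_add_left scaleC_scaleC)

definition bounded_clinear ::
    "('a::complex_hilbert_space \<Rightarrow> 'b::complex_hilbert_space) \<Rightarrow> bool" where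
  "bounded_clinear T \<longleftrightarrow> bounded_linear T \<and> (\<forall>c x. T (c *\<^sub>C x) = c *\<^sub>C T x)"

definition orth_compl :: "'a::complex_hilbert_space set \<Rightarrow> 'a set" where
  "orth_compl M = {y. \<forall>x\<in>M. cinner x y = 0}"

text \<open>For a linear subspace \<open>M\<close>: finiteness of its complex dimension.\<close>

definition finite_cdim :: "'a::complex_hilbert_space set \<Rightarrow> bool" where
  "finite_cdim M \<longleftrightarrow> (\<exists>B. finite B \<and> M = cvec.span B)"

definition closed_csubspace :: "'a::complex_hilbert_space set \<Rightarrow> bool" where
  "closed_csubspace M \<longleftrightarrow> cvec.subspace M \<and> closed M"


section \<open>Shifts of finite multiplicity\<close>

text \<open>
  The Hilbert space \<open>\<ell>\<^sup>2(\<nat>) \<otimes> \<complex>\<^sup>k\<close>, as square-summable sequences of vectors in \<open>\<complex>\<^sup>k\<close>: the entry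
  \<open>f m j\<close> is the coefficient of the basis vector \<open>e\<^sub>m \<otimes> e\<^sub>j\<close>, with \<open>j < k\<close>. Entries with \<open>j \<ge> k\<close> are
  forced to be zero, so that distinct functions are distinct vectors.
\<close>

definition ell2_tensor :: "nat \<Rightarrow> (nat \<Rightarrow> nat \<Rightarrow> complex) set" where
  "ell2_tensor k =
     {f. (\<forall>m. \<forall>j\<ge>k. f m j = 0) \<and> summable (\<lambda>m. \<Sum>j<k. (cmod (f m j))\<^sup>2)}"

definition ell2_inner ::
    "nat \<Rightarrow> (nat \<Rightarrow> nat \<Rightarrow> complex) \<Rightarrow> (nat \<Rightarrow> nat \<Rightarrow> complex) \<Rightarrow> complex" where
  "ell2_inner k f g = (\<Sum>m. \<Sum>j<k. f m j * cnj (g m j))"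

definition unilateral_shift :: "(nat \<Rightarrow> nat \<Rightarrow> complex) \<Rightarrow> nat \<Rightarrow> nat \<Rightarrow> complex" where
  "unilateral_shift f = (\<lambda>m j. if m = 0 then 0 else f (m - 1) j)"

definition isometry :: "('a::complex_hilbert_space \<Rightarrow> 'a) \<Rightarrow> bool" where
  "isometry V \<longleftrightarrow> bounded_clinear V \<and> (\<forall>x. norm (V x) = norm x)"

definition unitary_onto_ell2_tensor ::
    "nat \<Rightarrow> ('a::complex_hilbert_space \<Rightarrow> nat \<Rightarrow> nat \<Rightarrow> complex) \<Rightarrow> bool" where
  "unitary_onto_ell2_tensor k U \<longleftrightarrow>
     bij_betw U UNIV (ell2_tensor k) \<and>
     (\<forall>x y. U (x + y) = (\<lambda>m j. U x m j + U y m j)) \<and>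
     (\<forall>c x. U (c *\<^sub>C x) = (\<lambda>m j. c * U x m j)) \<and>
     (\<forall>x y. ell2_inner k (U x) (U y) = cinner x y)"

definition shift_of_multiplicity :: "nat \<Rightarrow> ('a::complex_hilbert_space \<Rightarrow> 'a) \<Rightarrow> bool" where
  "shift_of_multiplicity k V \<longleftrightarrow>
     k > 0 \<and> isometry V \<and>
     (\<exists>U. unitary_onto_ell2_tensor k U \<and> (\<forall>x. U (V x) = unilateral_shift (U x)))"

definition shift_of_finite_multiplicity :: "('a::complex_hilbert_space \<Rightarrow> 'a) \<Rightarrow> bool" where
  "shift_of_finite_multiplicity V \<longleftrightarrow> (\<exists>k. shift_of_multiplicity k V)"


section \<open>Tuples of operators\<close>

text \<open>An \<open>n\<close>-tuple is a family \<open>V 1, \<dots>, V n\<close>; the values of \<open>V\<close> at other indices are never used.\<close>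

definition commuting_finite_shifts ::
    "nat \<Rightarrow> (nat \<Rightarrow> 'a::complex_hilbert_space \<Rightarrow> 'a) \<Rightarrow> bool" where
  "commuting_finite_shifts n V \<longleftrightarrow>
     (\<forall>i\<in>{1..n}. shift_of_finite_multiplicity (V i)) \<and>
     (\<forall>i\<in>{1..n}. \<forall>j\<in>{1..n}. V i \<circ> V j = V j \<circ> V i)"

definition intertwines ::
    "nat \<Rightarrow> ('a \<Rightarrow> 'b) \<Rightarrow> (nat \<Rightarrow> 'a \<Rightarrow> 'a) \<Rightarrow> (nat \<Rightarrow> 'b \<Rightarrow> 'b) \<Rightarrow> bool" where
  "intertwines n X V W \<longleftrightarrow> (\<forall>i\<in>{1..n}. X \<circ> V i = W i \<circ> X)"

definition virtually_quasi_similar ::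
    "nat \<Rightarrow> (nat \<Rightarrow> 'a::complex_hilbert_space \<Rightarrow> 'a) \<Rightarrow>
     (nat \<Rightarrow> 'b::complex_hilbert_space \<Rightarrow> 'b) \<Rightarrow> bool" where
  "virtually_quasi_similar n V W \<longleftrightarrow>
     (\<exists>(X :: 'a \<Rightarrow> 'b) (Y :: 'b \<Rightarrow> 'a).
        bounded_clinear X \<and> inj X \<and> finite_cdim (orth_compl (range X)) \<and> intertwines n X V W \<and>
        bounded_clinear Y \<and> inj Y \<and> finite_cdim (orth_compl (range Y)) \<and> intertwines n Y W V)"

text \<open>The codimension of a closed subspace is the dimension of its orthogonal complement.\<close>

definition virtually_embeds ::
    "nat \<Rightarrow> (nat \<Rightarrow> 'a::complex_hilbert_space \<Rightarrow> 'a) \<Rightarrow>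
     (nat \<Rightarrow> 'b::complex_hilbert_space \<Rightarrow> 'b) \<Rightarrow> bool" where
  "virtually_embeds n V W \<longleftrightarrow>
     (\<exists>(K' :: 'b set) (S :: 'a \<Rightarrow> 'b).
        closed_csubspace K' \<and> finite_cdim (orth_compl K') \<and> (\<forall>i\<in>{1..n}. W i ` K' \<subseteq> K') \<and>
        bounded_clinear S \<and> bij_betw S UNIV K' \<and> (\<exists>C. \<forall>y\<in>K'. norm (inv S y) \<le> C * norm y) \<and>
        intertwines n S V W)"

definition virtually_similar ::
    "nat \<Rightarrow> (nat \<Rightarrow> 'a::complex_hilbert_space \<Rightarrow> 'a) \<Rightarrow>
     (nat \<Rightarrow> 'b::complex_hilbert_space \<Rightarrow> 'b) \<Rightarrow> bool" where
  "virtually_similar n V W \<longleftrightarrow> virtually_embeds n V W \<and> virtually_embeds n W V"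

end

theory Submission
  imports Defs "Jordan_Normal_Form.Determinant"
    "HOL-Computational_Algebra.Fundamental_Theorem_Algebra"
begin

text \<open>
  The first entries \<open>V\<^sub>1\<close> and \<open>W\<^sub>1\<close> become multiplication by \<open>z\<close> on vector-valued Hardy spaces, and every
  operator intertwining them becomes a matrix of power series. Since \<open>V\<^sub>i\<close> has a finite-dimensional
  cokernel, there is a polynomial \<open>q \<noteq> 0\<close> with \<open>q(V\<^sub>1)\<close> mapping into the range of \<open>V\<^sub>i\<close>. The quotient
  \<open>V\<^sub>i\<^sup>*q(V\<^sub>1)\<close> is a matrix with polynomial entries. So the intertwiners are the solutions of a linear
  system over the polynomials. Injectivity of \<open>X\<close> and \<open>Y\<close> makes both multiplicities equal and the matrix
  of \<open>X\<close> nonsingular. Hence there is also a polynomial solution \<open>\<Phi>\<close> with \<open>det \<Phi> \<noteq> 0\<close>. If \<open>det \<Phi>\<close> has no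
  zero on the unit circle, then \<open>\<Phi>\<close> acts as an injective operator with closed range of finite
  codimension.

  A zero \<open>\<zeta>\<close> of \<open>det \<Phi>\<close> on the circle is removed as follows. The values on the circle of the matrices of
  \<open>V\<^sub>i\<close> and \<open>W\<^sub>i\<close> are unitary, so \<open>A = \<Phi>\<^sup>*\<Phi>\<close> commutes with \<open>V\<^sub>i\<close> there. Choose a real polynomial \<open>p\<close> with
  \<open>p(0) \<noteq> 0\<close> and \<open>A(\<zeta>) p(A(\<zeta>)) = 0\<close>. Then \<open>E = p(A)\<close> takes values at \<open>\<zeta>\<close> in the kernel of \<open>\<Phi>(\<zeta>)\<close>, so
  \<open>\<Phi>' = \<Phi> (1 + i\<zeta> E\<^sup>2 / (z - \<zeta>))\<close> has no pole at \<open>\<zeta>\<close>. The second factor is invertible on the rest of the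
  circle, because \<open>E\<close> is Hermitian there, and its determinant has a pole at \<open>\<zeta>\<close>. So \<open>det \<Phi>'\<close> has fewer zeros
  on the circle than \<open>det \<Phi>\<close>. Powers of \<open>z\<close> clear the remaining denominators.
\<close>

section \<open>Linear systems over subrings of integral domains\<close>

definition is_subring :: "'a::comm_ring_1 set \<Rightarrow> bool" where
  "is_subring M \<longleftrightarrow> 1 \<in> M \<and> (\<forall>x\<in>M. \<forall>y\<in>M. x - y \<in> M \<and> x * y \<in> M)"

context
  fixes M :: "'a::comm_ring_1 set"
  assumes M: "is_subring M"
begin

lemma subring_1: "1 \<in> M"
  and subring_diff: "x \<in> M \<Longrightarrow> y \<in> M \<Longrightarrow> x - y \<in> M"
  and subring_mult: "x \<in> M \<Longrightarrow> y \<in> M \<Longrightarrow> x * y \<in> M"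
  using M by (auto simp: is_subring_def)

lemma subring_0: "0 \<in> M"
  using subring_diff [OF subring_1 subring_1] by simp

lemma subring_uminus: "x \<in> M \<Longrightarrow> - x \<in> M"
  using subring_diff [OF subring_0] by fastforce

lemma subring_add: "x \<in> M \<Longrightarrow> y \<in> M \<Longrightarrow> x + y \<in> M"
  using subring_diff [OF _ subring_uminus] by fastforce

lemma subring_sum: "(\<And>j. j \<in> J \<Longrightarrow> f j \<in> M) \<Longrightarrow> sum f J \<in> M"
  by (induction J rule: infinite_finite_induct) (auto simp: subring_0 subring_add)

end

text \<open>Fraction-free Gaussian elimination, by induction on the equations: \<open>T\<close>
  collects the free unknowns, \<open>s t\<close> is the solution attached to the free unknown
  \<open>t\<close>, and \<open>q\<close> is the product of the pivots, a common denominator. The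
  coefficients \<open>f\<close> range over the whole domain, so even solutions outside
  \<open>M\<close> are covered by solutions with entries in \<open>M\<close>.\<close>

lemma linear_system_solutions:
  fixes a :: "'i \<Rightarrow> 'j \<Rightarrow> 'a::idom"
  assumes "finite I" "finite J" "is_subring M" "\<forall>i\<in>I. \<forall>j\<in>J. a i j \<in> M"
  shows "\<exists>q T s. q \<in> M \<and> q \<noteq> 0 \<and> T \<subseteq> J \<and> card J \<le> card T + card I \<and>
    (\<forall>t\<in>T. s t t \<noteq> 0 \<and> (\<forall>j\<in>J. s t j \<in> M) \<and> (\<forall>i\<in>I. (\<Sum>j\<in>J. a i j * s t j) = 0)) \<and>
    (\<forall>v. (\<forall>i\<in>I. (\<Sum>j\<in>J. a i j * v j) = 0) \<longrightarrow>
      (\<exists>f. \<forall>j\<in>J. q * v j = (\<Sum>t\<in>T. f t * s t j)))"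
  using assms
proof (induction I arbitrary: a J rule: finite_induct)
  case empty
  have "\<exists>f. \<forall>j\<in>J. 1 * v j = (\<Sum>t\<in>J. f t * of_bool (t = j))" for v :: "'j \<Rightarrow> 'a"
    by (rule exI [of _ v]) (auto simp: empty.prems)
  then show ?case
    using subring_1 [OF \<open>is_subring M\<close>] subring_0 [OF \<open>is_subring M\<close>]
    by (intro exI [of _ 1] exI [of _ J] exI [of _ "\<lambda>t j. of_bool (t = j)"]) auto
next
  case (insert m I)
  note sub = subring_mult [OF \<open>is_subring M\<close>] subring_diff [OF \<open>is_subring M\<close>]
    subring_uminus [OF \<open>is_subring M\<close>] subring_sum [OF \<open>is_subring M\<close>]
  show ?case
  proof (cases "\<forall>j\<in>J. a m j = 0")
    case True
    have zero: "(\<Sum>j\<in>J. a m j * v j) = 0" for v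
      using True by simp
    from insert.IH [OF insert.prems(1,2), of a] insert.prems(3)
    obtain q T s where IH: "q \<in> M" "q \<noteq> 0" "T \<subseteq> J" "card J \<le> card T + card I"
      "\<forall>t\<in>T. s t t \<noteq> 0 \<and> (\<forall>j\<in>J. s t j \<in> M) \<and> (\<forall>i\<in>I. (\<Sum>j\<in>J. a i j * s t j) = 0)"
      "\<forall>v. (\<forall>i\<in>I. (\<Sum>j\<in>J. a i j * v j) = 0) \<longrightarrow>
        (\<exists>f. \<forall>j\<in>J. q * v j = (\<Sum>t\<in>T. f t * s t j))"
      by (auto simp del: mult_cancel_left)
    show ?thesis
      by (rule exI [of _ q], rule exI [of _ T], rule exI [of _ s])
        (use IH insert.hyps zero in auto)
  next
    case False
    then obtain p where p: "p \<in> J" "a m p \<noteq> 0" by blast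
    define J' where "J' = J - {p}"
    have J': "finite J'" "p \<notin> J'" "J = insert p J'"
      using insert.prems p by (auto simp: J'_def)
    \<comment> \<open>Row \<open>m\<close> eliminates the unknown \<open>p\<close> by
      cross-multiplication; without division the new coefficients stay in \<open>M\<close>.\<close>
    define b where "b i j = a m p * a i j - a i p * a m j" for i j
    have split: "(\<Sum>j\<in>J. g j) = g p + (\<Sum>j\<in>J'. g j)" for g :: "'j \<Rightarrow> 'a"
      using J' by simp
    have "\<forall>i\<in>I. \<forall>j\<in>J'. b i j \<in> M"
      using insert.prems(3) p J' unfolding b_def by (auto intro!: sub)
    from insert.IH [OF J'(1) insert.prems(2) this]
    obtain q T s where IH: "q \<in> M" "q \<noteq> 0" "T \<subseteq> J'" "card J' \<le> card T + card I"
      and IH_s: "\<forall>t\<in>T. s t t \<noteq> 0 \<and> (\<forall>j\<in>J'. s t j \<in> M) \<and>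
        (\<forall>i\<in>I. (\<Sum>j\<in>J'. b i j * s t j) = 0)"
      and IH_gen: "\<forall>v. (\<forall>i\<in>I. (\<Sum>j\<in>J'. b i j * v j) = 0) \<longrightarrow>
        (\<exists>f. \<forall>j\<in>J'. q * v j = (\<Sum>t\<in>T. f t * s t j))"
      by (elim exE conjE) (rule that)
    \<comment> \<open>The old solution is scaled by the pivot because row \<open>m\<close>
      determines the value at \<open>p\<close> only after multiplication by
      \<open>a m p\<close>.\<close>
    define s' where "s' t j = (if j = p then - (\<Sum>l\<in>J'. a m l * s t l) else a m p * s t j)" for t j
    have s'_J': "s' t j = a m p * s t j" if "j \<in> J'" for t j
      using that J' by (auto simp: s'_def)
    have sum_b: "(\<Sum>j\<in>J'. b i j * v j) =
        a m p * (\<Sum>j\<in>J'. a i j * v j) - a i p * (\<Sum>j\<in>J'. a m j * v j)" for i v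
      by (simp add: b_def algebra_simps sum_subtractf sum_distrib_left)
    have s'_sum: "(\<Sum>j\<in>J. a i j * s' t j) =
        a m p * (\<Sum>j\<in>J'. a i j * s t j) - a i p * (\<Sum>j\<in>J'. a m j * s t j)" for i t
    proof -
      have "(\<Sum>j\<in>J'. a i j * s' t j) = a m p * (\<Sum>j\<in>J'. a i j * s t j)"
        by (simp add: s'_J' sum_distrib_left algebra_simps)
      then show ?thesis
        unfolding split [of "\<lambda>j. a i j * s' t j"] by (simp add: s'_def)
    qed
    have s'_M: "s' t j \<in> M" if "t \<in> T" "j \<in> J" for t j
      using that insert.prems(3) p J' IH_s unfolding s'_def by (auto intro!: sub)
    have gen: "\<exists>f. \<forall>j\<in>J. (a m p * q) * v j = (\<Sum>t\<in>T. f t * s' t j)"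
      if v: "\<forall>i\<in>insert m I. (\<Sum>j\<in>J. a i j * v j) = 0" for v
    proof -
      have vi: "a i p * v p + (\<Sum>j\<in>J'. a i j * v j) = 0" if "i \<in> insert m I" for i
        using bspec [OF v that] unfolding split [of "\<lambda>j. a i j * v j"] .
      have "(\<Sum>j\<in>J'. b i j * v j) = 0" if "i \<in> I" for i
      proof -
        have "(\<Sum>j\<in>J'. a i j * v j) = - (a i p * v p)" "(\<Sum>j\<in>J'. a m j * v j) = - (a m p * v p)"
          using vi [of i] vi [of m] that by (auto simp: eq_neg_iff_add_eq_0 add.commute)
        then show ?thesis unfolding sum_b by (simp add: algebra_simps)
      qed
      with IH_gen obtain f where f: "\<And>j. j \<in> J' \<Longrightarrow> q * v j = (\<Sum>t\<in>T. f t * s t j)" by blast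
      have "(a m p * q) * v p = q * (a m p * v p)" by simp
      also have "a m p * v p = - (\<Sum>j\<in>J'. a m j * v j)"
        using vi [of m] by (simp add: eq_neg_iff_add_eq_0)
      also have "q * \<dots> = - (\<Sum>j\<in>J'. a m j * (q * v j))"
        by (simp add: sum_distrib_left algebra_simps)
      also have "\<dots> = - (\<Sum>j\<in>J'. \<Sum>t\<in>T. a m j * (f t * s t j))"
        by (simp add: f sum_distrib_left)
      also have "\<dots> = - (\<Sum>t\<in>T. \<Sum>j\<in>J'. a m j * (f t * s t j))"
        by (subst sum.swap) simp
      also have "\<dots> = (\<Sum>t\<in>T. f t * s' t p)"
        by (simp add: s'_def sum_distrib_left sum_negf algebra_simps)
      finally have "(a m p * q) * v p = (\<Sum>t\<in>T. f t * s' t p)" .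
      moreover have "(a m p * q) * v j = (\<Sum>t\<in>T. f t * s' t j)" if "j \<in> J'" for j
        unfolding mult.assoc f [OF that] by (simp add: s'_J' that sum_distrib_left ac_simps)
      ultimately show ?thesis using J' by blast
    qed
    have "s' t t \<noteq> 0" if "t \<in> T" for t
      using that IH(3) IH_s p s'_J' by auto
    moreover have "(\<Sum>j\<in>J. a i j * s' t j) = 0" if "t \<in> T" "i \<in> insert m I" for t i
    proof (cases "i = m")
      case True
      then show ?thesis unfolding s'_sum by simp
    next
      case False
      then show ?thesis unfolding s'_sum sum_b [symmetric] using that IH_s by blast
    qed
    moreover have "card J \<le> card T + card (insert m I)"
      using IH(4) J' insert.hyps by simp
    moreover have "a m p * q \<in> M" "a m p * q \<noteq> 0" "T \<subseteq> J"
      using IH p J' insert.prems(3) by (auto intro!: sub)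
    ultimately show ?thesis
      using s'_M gen
      by (intro exI [of _ "a m p * q"] exI [of _ T] exI [of _ s']) auto
  qed
qed

text \<open>The count \<open>card J \<le> card T + card I\<close> leaves a free unknown, whose
  solution is nonzero in its own place.\<close>

corollary underdetermined_system:
  fixes a :: "'i \<Rightarrow> 'j \<Rightarrow> 'a::idom"
  assumes "finite I" "card I < card J" "is_subring M" "\<forall>i\<in>I. \<forall>j\<in>J. a i j \<in> M"
  obtains v where "\<And>j. j \<in> J \<Longrightarrow> v j \<in> M" "\<exists>j\<in>J. v j \<noteq> 0"
    "\<And>i. i \<in> I \<Longrightarrow> (\<Sum>j\<in>J. a i j * v j) = 0"
proof -
  have "finite J" using assms(2) by (metis card.infinite less_nat_zero_code)
  from linear_system_solutions [OF assms(1) this assms(3,4)]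
  obtain T s where Ts: "T \<subseteq> J" "card J \<le> card T + card I"
    "\<forall>t\<in>T. s t t \<noteq> 0 \<and> (\<forall>j\<in>J. s t j \<in> M) \<and> (\<forall>i\<in>I. (\<Sum>j\<in>J. a i j * s t j) = 0)"
    by (elim exE conjE)
  have "T \<noteq> {}" using Ts(2) assms(2) by auto
  then obtain t where "t \<in> T" by blast
  with Ts that [of "s t"] show thesis by blast
qed

text \<open>A nonzero solution \<open>w\<close> stays nonzero after multiplication by
  \<open>q\<close>, so \<open>T\<close> cannot be empty, and any \<open>s t\<close> is a nonzero
  solution inside the subring.\<close>

corollary singular_system_in_subring:
  fixes a :: "'i \<Rightarrow> 'j \<Rightarrow> 'a::idom"
  assumes "finite I" "finite J" "is_subring M" "\<forall>i\<in>I. \<forall>j\<in>J. a i j \<in> M"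
    and "\<exists>j\<in>J. w j \<noteq> 0" "\<forall>i\<in>I. (\<Sum>j\<in>J. a i j * w j) = 0"
  obtains v where "\<And>j. j \<in> J \<Longrightarrow> v j \<in> M" "\<exists>j\<in>J. v j \<noteq> 0"
    "\<And>i. i \<in> I \<Longrightarrow> (\<Sum>j\<in>J. a i j * v j) = 0"
proof -
  from linear_system_solutions [OF assms(1-4)]
  obtain q T s where "q \<noteq> 0" and T: "T \<subseteq> J"
    and s: "\<forall>t\<in>T. s t t \<noteq> 0 \<and> (\<forall>j\<in>J. s t j \<in> M) \<and> (\<forall>i\<in>I. (\<Sum>j\<in>J. a i j * s t j) = 0)"
    and gen: "\<forall>v. (\<forall>i\<in>I. (\<Sum>j\<in>J. a i j * v j) = 0) \<longrightarrow>
      (\<exists>f. \<forall>j\<in>J. q * v j = (\<Sum>t\<in>T. f t * s t j))"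
    by (elim exE conjE) (rule that)
  have "T \<noteq> {}"
    using gen [rule_format, of w] assms(5,6) \<open>q \<noteq> 0\<close> by auto
  then obtain t where "t \<in> T" by blast
  with T s that [of "s t"] show thesis by blast
qed

section \<open>Matrices as functions\<close>

text \<open>Sizes are explicit arguments and entries outside the intended block are arbitrary, so
  identities between matrices carry bounds on the indices.\<close>

definition mmul :: "nat \<Rightarrow> (nat \<Rightarrow> nat \<Rightarrow> 'r::comm_ring_1) \<Rightarrow> (nat \<Rightarrow> nat \<Rightarrow> 'r) \<Rightarrow> nat \<Rightarrow> nat \<Rightarrow> 'r" where
  "mmul k A B = (\<lambda>a b. \<Sum>c<k. A a c * B c b)"

definition mapply :: "nat \<Rightarrow> (nat \<Rightarrow> nat \<Rightarrow> 'r::comm_ring_1) \<Rightarrow> (nat \<Rightarrow> 'r) \<Rightarrow> nat \<Rightarrow> 'r" where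
  "mapply k A v = (\<lambda>a. \<Sum>c<k. A a c * v c)"

definition mdet :: "nat \<Rightarrow> (nat \<Rightarrow> nat \<Rightarrow> 'r::comm_ring_1) \<Rightarrow> 'r" where
  "mdet k A = Determinant.det (Matrix.mat k k (\<lambda>(a, b). A a b))"

definition mscalar :: "'r::comm_ring_1 \<Rightarrow> nat \<Rightarrow> nat \<Rightarrow> 'r" where
  "mscalar q = (\<lambda>a b. if a = b then q else 0)"

lemma mmul_assoc: "mmul k (mmul k A B) C = mmul k A (mmul k B C)"
  unfolding mmul_def
  by (intro ext, simp add: sum_distrib_left sum_distrib_right mult.assoc, subst sum.swap, rule refl)

lemma mapply_mmul: "mapply k (mmul l A B) v = mapply l A (mapply k B v)"
  unfolding mmul_def mapply_def
  by (intro ext, simp add: sum_distrib_left sum_distrib_right mult.assoc, subst sum.swap, rule refl)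

lemma mapply_scale: "mapply k A (\<lambda>b. c * v b) = (\<lambda>a. c * mapply k A v a)"
  by (simp add: mapply_def sum_distrib_left ac_simps)

lemma mapply_add: "mapply k A (\<lambda>b. v b + w b) = (\<lambda>a. mapply k A v a + mapply k A w a)"
  by (simp add: mapply_def sum.distrib distrib_left)

lemma mapply_cong: "(\<And>b. b < k \<Longrightarrow> v b = w b) \<Longrightarrow> mapply k A v = mapply k A w"
  by (simp add: mapply_def)

lemma mapply_mscalar: "a < k \<Longrightarrow> mapply k (mscalar q) v a = q * v a"
  by (simp add: mapply_def mscalar_def if_distrib [of "\<lambda>x. x * _"] cong: if_cong)

lemma mdet_cong: "(\<And>a b. a < k \<Longrightarrow> b < k \<Longrightarrow> A a b = B a b) \<Longrightarrow> mdet k A = mdet k B"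
  unfolding mdet_def by (intro arg_cong [where f = Determinant.det] eq_matI) auto

lemma mmul_eq_times:
  "Matrix.mat k k (\<lambda>(a, b). mmul k A B a b) =
    Matrix.mat k k (\<lambda>(a, b). A a b) * Matrix.mat k k (\<lambda>(a, b). B a b)"
  by (intro eq_matI) (auto simp: mmul_def scalar_prod_def atLeast0LessThan)

lemma mdet_mmul: "mdet k (mmul k A B) = mdet k A * mdet k B"
  unfolding mdet_def mmul_eq_times by (rule det_mult) auto

lemma mdet_mscalar: "mdet k (mscalar q) = q ^ k"
proof -
  have "Matrix.mat k k (\<lambda>(a, b). mscalar q a b) = q \<cdot>\<^sub>m 1\<^sub>m k"
    by (intro eq_matI) (auto simp: mscalar_def)
  then show ?thesis by (simp add: mdet_def)
qed

lemma mdet_eq_0_iff: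
  fixes A :: "nat \<Rightarrow> nat \<Rightarrow> 'r::idom"
  shows "mdet k A = 0 \<longleftrightarrow> (\<exists>v. (\<exists>a<k. v a \<noteq> 0) \<and> (\<forall>a<k. mapply k A v a = 0))"
proof -
  let ?A = "Matrix.mat k k (\<lambda>(a, b). A a b)"
  have app: "(?A *\<^sub>v v = 0\<^sub>v k) \<longleftrightarrow> (\<forall>a<k. mapply k A (vec_index v) a = 0)"
    if "v \<in> carrier_vec k" for v
    using that by (auto simp: Matrix.vec_eq_iff mapply_def scalar_prod_def atLeast0LessThan)
  have nz: "(v \<noteq> 0\<^sub>v k) \<longleftrightarrow> (\<exists>a<k. vec_index v a \<noteq> 0)" if "v \<in> carrier_vec k" for v :: "'r Matrix.vec"
    using that by (auto simp: Matrix.vec_eq_iff)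
  have "mdet k A = 0 \<longleftrightarrow> (\<exists>v. v \<in> carrier_vec k \<and> v \<noteq> 0\<^sub>v k \<and> ?A *\<^sub>v v = 0\<^sub>v k)"
    unfolding mdet_def by (rule det_0_iff_vec_prod_zero) auto
  also have "\<dots> \<longleftrightarrow> (\<exists>v. (\<exists>a<k. v a \<noteq> 0) \<and> (\<forall>a<k. mapply k A v a = 0))" (is "?L = ?R")
  proof
    assume ?L then show ?R using app nz by metis
  next
    assume ?R
    then obtain v where v: "\<exists>a<k. v a \<noteq> 0" "\<forall>a<k. mapply k A v a = 0" by blast
    let ?v = "Matrix.vec k v"
    have "mapply k A (vec_index ?v) = mapply k A v" by (rule mapply_cong) simp
    then have "?A *\<^sub>v ?v = 0\<^sub>v k"
      using app [of ?v] v(2) by simp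
    moreover have "?v \<noteq> 0\<^sub>v k"
      using v(1) nz [of ?v] by (metis index_vec vec_carrier)
    ultimately show ?L
      by (intro exI [of _ ?v]) simp
  qed
  finally show ?thesis .
qed

lemma mdet_hom:
  assumes "comm_ring_hom h"
  shows "mdet k (\<lambda>a b. h (A a b)) = h (mdet k A)"
proof -
  interpret comm_ring_hom h by fact
  have "Matrix.mat k k (\<lambda>(a, b). h (A a b)) = map_mat h (Matrix.mat k k (\<lambda>(a, b). A a b))"
    by (intro eq_matI) auto
  then show ?thesis by (simp add: mdet_def hom_det)
qed

lemma ex_adjugate:
  obtains B where "\<And>a b. a < k \<Longrightarrow> b < k \<Longrightarrow> mmul k B A a b = mscalar (mdet k A) a b"
    "\<And>a b. a < k \<Longrightarrow> b < k \<Longrightarrow> mmul k A B a b = mscalar (mdet k A) a b"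
proof -
  let ?A = "Matrix.mat k k (\<lambda>(a, b). A a b)"
  define B where "B a b = adj_mat ?A $$ (a, b)" for a b
  have carr: "?A \<in> carrier_mat k k" by simp
  note adj = adj_mat [OF carr]
  have B: "Matrix.mat k k (\<lambda>(a, b). B a b) = adj_mat ?A"
    using adj(1) by (intro eq_matI) (auto simp: B_def)
  show thesis
  proof (rule that [of B])
    fix a b assume ab: "a < k" "b < k"
    have "mmul k B A a b = Matrix.mat k k (\<lambda>(a, b). mmul k B A a b) $$ (a, b)" using ab by simp
    also have "\<dots> = mscalar (mdet k A) a b"
      unfolding mmul_eq_times B adj(3) using ab by (simp add: mdet_def mscalar_def)
    finally show "mmul k B A a b = mscalar (mdet k A) a b" .
    have "mmul k A B a b = Matrix.mat k k (\<lambda>(a, b). mmul k A B a b) $$ (a, b)" using ab by simp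
    also have "\<dots> = mscalar (mdet k A) a b"
      unfolding mmul_eq_times B adj(2) using ab by (simp add: mdet_def mscalar_def)
    finally show "mmul k A B a b = mscalar (mdet k A) a b" .
  qed
qed

lemma comm_ring_hom_poly: "comm_ring_hom (\<lambda>p. poly p x)"
  by unfold_locales auto

lemma comm_ring_hom_fps_of_poly: "comm_ring_hom (fps_of_poly :: 'a::comm_ring_1 poly \<Rightarrow> _)"
  by unfold_locales (auto simp: fps_of_poly_mult fps_of_poly_add)

lemma mmul_hom:
  assumes "comm_ring_hom h"
  shows "mmul k (\<lambda>a b. h (A a b)) (\<lambda>a b. h (B a b)) = (\<lambda>a b. h (mmul k A B a b))"
proof -
  interpret comm_ring_hom h by fact
  show ?thesis by (simp add: mmul_def hom_sum hom_mult)
qed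

text \<open>A nonzero polynomial \<open>det (A + f B)\<close> in \<open>f\<close> has only finitely many roots in an integral
  domain.\<close>
lemma mdet_pencil:
  fixes A B :: "nat \<Rightarrow> nat \<Rightarrow> 'r::idom"
  assumes "mdet k (\<lambda>a b. A a b + f * B a b) \<noteq> 0" "infinite C"
  obtains c where "c \<in> C" "mdet k (\<lambda>a b. A a b + c * B a b) \<noteq> 0"
proof -
  define P where "P = mdet k (\<lambda>a b. [:A a b, B a b:])"
  have P: "poly P c = mdet k (\<lambda>a b. A a b + c * B a b)" for c
    unfolding P_def using mdet_hom [OF comm_ring_hom_poly [of c], of k "\<lambda>a b. [:A a b, B a b:]"]
    by simp
  have "P \<noteq> 0" using assms(1) P [of f] by auto
  then have "finite {c. poly P c = 0}" by (rule poly_roots_finite)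
  with assms(2) obtain c where "c \<in> C" "poly P c \<noteq> 0"
    by (metis (mono_tags, lifting) finite_subset mem_Collect_eq subsetI)
  with P that show thesis by metis
qed

text \<open>The coefficients \<open>f t\<close> are exchanged for elements of \<open>C\<close> one
  at a time, each exchange being an instance of \<open>mdet_pencil\<close>.\<close>

lemma mdet_combination:
  fixes B :: "'t \<Rightarrow> nat \<Rightarrow> nat \<Rightarrow> 'r::idom"
  assumes "finite T" "infinite C" "mdet k (\<lambda>a b. A a b + (\<Sum>t\<in>T. f t * B t a b)) \<noteq> 0"
  shows "\<exists>c. (\<forall>t\<in>T. c t \<in> C) \<and> mdet k (\<lambda>a b. A a b + (\<Sum>t\<in>T. c t * B t a b)) \<noteq> 0"
  using assms(1,3)
proof (induction T arbitrary: A rule: finite_induct)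
  case empty
  then show ?case by simp
next
  case (insert u T)
  \<comment> \<open>The summand of \<open>u\<close> is first absorbed into the constant matrix, so
    that the induction hypothesis treats the other coefficients.\<close>
  have "mdet k (\<lambda>a b. (A a b + f u * B u a b) + (\<Sum>t\<in>T. f t * B t a b)) \<noteq> 0"
    using insert by (simp add: add.assoc)
  from insert.IH [OF this] obtain c where c: "\<forall>t\<in>T. c t \<in> C"
    "mdet k (\<lambda>a b. (A a b + f u * B u a b) + (\<Sum>t\<in>T. c t * B t a b)) \<noteq> 0" by blast
  then have "mdet k (\<lambda>a b. (A a b + (\<Sum>t\<in>T. c t * B t a b)) + f u * B u a b) \<noteq> 0"
    by (simp add: algebra_simps)
  from mdet_pencil [OF this assms(2)] obtain d where d: "d \<in> C"
    "mdet k (\<lambda>a b. (A a b + (\<Sum>t\<in>T. c t * B t a b)) + d * B u a b) \<noteq> 0" by blast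
  have "(\<Sum>t\<in>T. (c(u := d)) t * B t a b) = (\<Sum>t\<in>T. c t * B t a b)" for a b
    using insert.hyps by (intro sum.cong) auto
  with c d insert.hyps show ?case
    by (intro exI [of _ "c(u := d)"]) (auto simp: algebra_simps)
qed

section \<open>Matrix polynomials on the unit circle\<close>

lemma mmul_cong:
  "(\<And>c. c < k \<Longrightarrow> A a c = A' a c) \<Longrightarrow> (\<And>c. c < k \<Longrightarrow> B c b = B' c b) \<Longrightarrow>
    mmul k A B a b = mmul k A' B' a b"
  by (simp add: mmul_def)

lemma mmul_add_left: "mmul k (\<lambda>a b. A a b + B a b) C = (\<lambda>a b. mmul k A C a b + mmul k B C a b)"
  and mmul_add_right: "mmul k C (\<lambda>a b. A a b + B a b) = (\<lambda>a b. mmul k C A a b + mmul k C B a b)"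
  and mmul_scale_left: "mmul k (\<lambda>a b. c * A a b) C = (\<lambda>a b. c * mmul k A C a b)"
  and mmul_scale_right: "mmul k C (\<lambda>a b. c * A a b) = (\<lambda>a b. c * mmul k C A a b)"
  by (simp_all add: mmul_def sum.distrib algebra_simps sum_distrib_left)

lemma mmul_zero: "mmul k (\<lambda>a b. 0) C = (\<lambda>a b. 0)" "mmul k C (\<lambda>a b. 0) = (\<lambda>a b. 0)"
  by (simp_all add: mmul_def)

lemma mmul_mscalar_left: "a < k \<Longrightarrow> mmul k (mscalar q) A a b = q * A a b"
  by (simp add: mmul_def mscalar_def if_distrib [of "\<lambda>x. x * _"] cong: if_cong)

lemma mmul_mscalar_right: "b < k \<Longrightarrow> mmul k A (mscalar q) a b = q * A a b"
  by (simp add: mmul_def mscalar_def if_distrib [of "\<lambda>x. _ * x"] mult.commute cong: if_cong)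

lemma mapply_mat_add: "mapply k (\<lambda>a b. A a b + B a b) v = (\<lambda>a. mapply k A v a + mapply k B v a)"
  and mapply_mat_scale: "mapply k (\<lambda>a b. c * A a b) v = (\<lambda>a. c * mapply k A v a)"
  by (simp_all add: mapply_def sum.distrib algebra_simps sum_distrib_left)

lemma mapply_eq_0: "(\<And>b. b < k \<Longrightarrow> v b = 0) \<Longrightarrow> mapply k A v = (\<lambda>a. 0)"
  by (simp add: mapply_def)

lemma mapply_unit: "b < k \<Longrightarrow> mapply k A (\<lambda>c. if c = b then 1 else 0) a = A a b"
  by (simp add: mapply_def if_distrib [of "\<lambda>x. _ * x"] cong: if_cong)

lemma mdet_scale: "mdet k (\<lambda>a b. q * A a b) = q ^ k * mdet k A"
proof -
  have "mdet k (\<lambda>a b. q * A a b) = mdet k (mmul k (mscalar q) A)"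
    by (intro mdet_cong) (simp add: mmul_mscalar_left)
  then show ?thesis by (simp add: mdet_mmul mdet_mscalar)
qed

definition mcommute :: "nat \<Rightarrow> (nat \<Rightarrow> nat \<Rightarrow> 'r::comm_ring_1) \<Rightarrow> (nat \<Rightarrow> nat \<Rightarrow> 'r) \<Rightarrow> bool" where
  "mcommute k A B \<longleftrightarrow> (\<forall>a<k. \<forall>b<k. mmul k A B a b = mmul k B A a b)"

lemma mcommuteD: "mcommute k A B \<Longrightarrow> a < k \<Longrightarrow> b < k \<Longrightarrow> mmul k A B a b = mmul k B A a b"
  by (simp add: mcommute_def)

lemma mcommute_mscalar: "mcommute k (mscalar q) B"
  by (simp add: mcommute_def mmul_mscalar_left mmul_mscalar_right)

lemma mcommute_zero: "mcommute k (\<lambda>a b. 0) B"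
  by (simp add: mcommute_def mmul_zero)

lemma mcommute_add: "mcommute k A C \<Longrightarrow> mcommute k B C \<Longrightarrow> mcommute k (\<lambda>a b. A a b + B a b) C"
  by (simp add: mcommute_def mmul_add_left mmul_add_right)

lemma mcommute_scale: "mcommute k A C \<Longrightarrow> mcommute k (\<lambda>a b. q * A a b) C"
  by (simp add: mcommute_def mmul_scale_left mmul_scale_right)

lemma mcommute_mmul:
  assumes "mcommute k A C" "mcommute k B C"
  shows "mcommute k (mmul k A B) C"
  unfolding mcommute_def
proof (intro allI impI)
  fix a b assume ab: "a < k" "b < k"
  have "mmul k (mmul k A B) C a b = mmul k A (mmul k C B) a b"
    unfolding mmul_assoc by (rule mmul_cong) (use assms(2) ab in \<open>auto dest: mcommuteD\<close>)
  also have "\<dots> = mmul k (mmul k C A) B a b"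
    unfolding mmul_assoc [symmetric] by (rule mmul_cong) (use assms(1) ab in \<open>auto dest: mcommuteD\<close>)
  finally show "mmul k (mmul k A B) C a b = mmul k C (mmul k A B) a b"
    by (simp add: mmul_assoc)
qed

definition mev :: "(nat \<Rightarrow> nat \<Rightarrow> complex poly) \<Rightarrow> complex \<Rightarrow> nat \<Rightarrow> nat \<Rightarrow> complex" where
  "mev A z = (\<lambda>a b. poly (A a b) z)"

lemma mev_mmul: "mev (mmul k A B) z = mmul k (mev A z) (mev B z)"
  unfolding mev_def by (rule mmul_hom [OF comm_ring_hom_poly, symmetric])

lemma mev_add: "mev (\<lambda>a b. A a b + B a b) z = (\<lambda>a b. mev A z a b + mev B z a b)"
  and mev_scale: "mev (\<lambda>a b. c * A a b) z = (\<lambda>a b. poly c z * mev A z a b)"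
  and mev_zero: "mev (\<lambda>a b. 0) z = (\<lambda>a b. 0)"
  and mev_mscalar: "mev (mscalar q) z = mscalar (poly q z)"
  by (auto simp: mev_def mscalar_def fun_eq_iff)

lemma poly_mdet: "poly (mdet k A) z = mdet k (mev A z)"
  unfolding mev_def by (rule mdet_hom [OF comm_ring_hom_poly, symmetric])

section \<open>The Hermitian form on k-dimensional complex space\<close>

definition hip :: "nat \<Rightarrow> (nat \<Rightarrow> complex) \<Rightarrow> (nat \<Rightarrow> complex) \<Rightarrow> complex" where
  "hip k v w = (\<Sum>a<k. v a * cnj (w a))"

lemma hip_cong: "(\<And>a. a < k \<Longrightarrow> v a = v' a) \<Longrightarrow> (\<And>a. a < k \<Longrightarrow> w a = w' a) \<Longrightarrow> hip k v w = hip k v' w'"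
  by (simp add: hip_def)

lemma hip_add: "hip k (\<lambda>a. v a + v' a) w = hip k v w + hip k v' w"
  "hip k v (\<lambda>a. w a + w' a) = hip k v w + hip k v w'"
  and hip_scale: "hip k (\<lambda>a. c * v a) w = c * hip k v w" "hip k v (\<lambda>a. c * w a) = cnj c * hip k v w"
  and hip_zero: "hip k (\<lambda>a. 0) w = 0" "hip k v (\<lambda>a. 0) = 0"
  by (simp_all add: hip_def sum.distrib algebra_simps sum_distrib_left)

lemma hip_self: "hip k v v = complex_of_real (\<Sum>a<k. (cmod (v a))\<^sup>2)"
  by (simp add: hip_def complex_norm_square [symmetric])

lemma hip_eq_0: "hip k v v = 0 \<longleftrightarrow> (\<forall>a<k. v a = 0)"
  unfolding hip_self of_real_eq_0_iff by (subst sum_nonneg_eq_0_iff) auto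

text \<open>Counted with multiplicity; this is the quantity that decreases when a root on the circle
  is removed.\<close>

definition circle_roots :: "complex poly \<Rightarrow> nat" where
  "circle_roots p = size (filter_mset (\<lambda>z. cmod z = 1) (proots p))"

lemma circle_roots_mult: "p \<noteq> 0 \<Longrightarrow> q \<noteq> 0 \<Longrightarrow> circle_roots (p * q) = circle_roots p + circle_roots q"
  by (simp add: circle_roots_def proots_mult)

lemma circle_roots_linear_power:
  assumes "cmod z = 1"
  shows "circle_roots ([:-z, 1:] ^ n) = n"
proof (induction n)
  case 0
  then show ?case by (simp add: circle_roots_def)
next
  case (Suc n)
  have "circle_roots [:-z, 1:] = 1" using assms by (simp add: circle_roots_def)
  then show ?case
    using Suc by (simp only: power_Suc, subst circle_roots_mult) auto
qed

lemma circle_roots_single: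
  assumes "p \<noteq> 0" "cmod \<zeta> = 1" "\<And>z. cmod z = 1 \<Longrightarrow> z \<noteq> \<zeta> \<Longrightarrow> poly p z \<noteq> 0"
  shows "circle_roots p = order \<zeta> p"
proof -
  have "filter_mset (\<lambda>z. cmod z = 1) (proots p) = replicate_mset (order \<zeta> p) \<zeta>"
    using assms by (intro multiset_eqI) (auto simp: order_root)
  then show ?thesis by (simp add: circle_roots_def)
qed

text \<open>\<open>hpoly k d B [c\<^sub>0, \<dots>, c\<^sub>m]\<close> is \<open>\<Sum>\<^sub>j c\<^sub>j z\<^bsup>d(m-j)\<^esup> B\<^sup>j\<close>. When \<open>B = z\<^sup>d A\<close> this is \<open>z\<^bsup>dm\<^esup>\<close> times the
  polynomial \<open>\<Sum>\<^sub>j c\<^sub>j A\<^sup>j\<close> in \<open>A\<close>, but it has no poles.\<close>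
primrec hpoly :: "nat \<Rightarrow> nat \<Rightarrow> (nat \<Rightarrow> nat \<Rightarrow> complex poly) \<Rightarrow> real list \<Rightarrow> nat \<Rightarrow> nat \<Rightarrow> complex poly" where
  "hpoly k d B [] = (\<lambda>a b. 0)"
| "hpoly k d B (c # cs) =
    (\<lambda>a b. mscalar (monom (of_real c) (d * length cs)) a b + mmul k B (hpoly k d B cs) a b)"

text \<open>With \<open>h\<close> the identity this concerns matrices of polynomials; with
  \<open>h = fps_of_poly\<close> it gives commutation with matrices of power series.\<close>

lemma hpoly_commute:
  assumes "comm_ring_hom h" "mcommute k (\<lambda>a b. h (B a b)) C"
  shows "mcommute k (\<lambda>a b. h (hpoly k d B cs a b)) C"
proof (induction cs)
  interpret comm_ring_hom h by fact
  case Nil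
  then show ?case by (simp add: mcommute_zero)
next
  interpret comm_ring_hom h by fact
  case (Cons c cs)
  have "(\<lambda>a b. h (hpoly k d B (c # cs) a b)) =
    (\<lambda>a b. mscalar (h (monom (of_real c) (d * length cs))) a b +
      mmul k (\<lambda>a b. h (B a b)) (\<lambda>a b. h (hpoly k d B cs a b)) a b)"
    unfolding mmul_hom [OF assms(1)] by (auto simp: hom_add mscalar_def fun_eq_iff)
  then show ?case
    by (simp add: mcommute_add mcommute_mscalar mcommute_mmul assms(2) Cons)
qed

lemma mev_hpoly_Cons:
  "mev (hpoly k d B (c # cs)) z =
    (\<lambda>a b. mscalar (of_real c * z ^ (d * length cs)) a b + mmul k (mev B z) (mev (hpoly k d B cs) z) a b)"
  by (simp add: mev_add mev_mmul mev_mscalar poly_monom)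

text \<open>Unfolding the Horner recursion shows that the coefficients enter linearly, so vanishing
  at a point is a linear system for them.\<close>

lemma mev_hpoly:
  "mev (hpoly k d B cs) z a b =
    (\<Sum>j<length cs. of_real (cs ! j) * z ^ (d * (length cs - 1 - j)) * ((mmul k (mev B z) ^^ j) (mscalar 1)) a b)"
proof (induction cs arbitrary: a b)
  case Nil
  then show ?case by (simp add: mev_zero)
next
  case (Cons c cs)
  have "mmul k (mev B z) (mev (hpoly k d B cs) z) a b =
    (\<Sum>j<length cs. of_real (cs ! j) * z ^ (d * (length cs - 1 - j)) * ((mmul k (mev B z) ^^ Suc j) (mscalar 1)) a b)"
    unfolding mmul_def [of k "mev B z" "mev (hpoly k d B cs) z"] Cons.IH
    by (simp add: sum_distrib_left mmul_def [of k "mev B z"] ac_simps) (rule sum.swap)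
  then show ?case
    unfolding mev_hpoly_Cons by (simp add: sum.lessThan_Suc_shift mscalar_def del: sum.lessThan_Suc)
qed

section \<open>Reflected matrices and Hermitian matrix functions on the circle\<close>

lemma hip_cnj: "hip k v w = cnj (hip k w v)"
  by (simp add: hip_def mult.commute)

lemma power_cnj_cancel: "cmod z = 1 \<Longrightarrow> z ^ n * cnj z ^ n = 1"
  by (simp add: power_mult_distrib [symmetric] complex_norm_square [symmetric])

lemma mev_commute:
  assumes "mcommute k A C" "a < k"
  shows "mapply k (mev A z) (mapply k (mev C z) v) a = mapply k (mev C z) (mapply k (mev A z) v) a"
proof -
  have "mev (mmul k A C) z a b = mev (mmul k C A) z a b" if "b < k" for b
    using assms that by (simp add: mev_def mcommute_def)
  then have "mapply k (mev (mmul k A C) z) v a = mapply k (mev (mmul k C A) z) v a"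
    by (simp add: mapply_def)
  then show ?thesis by (simp add: mev_mmul mapply_mmul)
qed

lemma mev_eq_0_of_mapply:
  assumes "\<And>v a. a < k \<Longrightarrow> mapply k (mev A \<zeta>) (mapply k (mev C \<zeta>) v) a = 0" "a < k" "b < k"
  shows "[:-\<zeta>, 1:] dvd mmul k A C a b"
proof -
  have "mev (mmul k A C) \<zeta> a b = 0"
    using assms mapply_unit [of b k "mev (mmul k A C) \<zeta>" a]
    by (simp add: mev_mmul mapply_mmul)
  then show ?thesis by (simp add: mev_def poly_eq_0_iff_dvd)
qed

text \<open>On the circle \<open>\<Psi>\<close> is \<open>z^d\<close> times the adjoint of
  \<open>\<Phi>\<close>; the power of \<open>z\<close> makes room for a polynomial in place of the
  adjoint. Then \<open>mmul k \<Psi> \<Phi>\<close> is \<open>z^d A\<close> with A the positive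
  semidefinite Gram matrix.\<close>

definition reflected ::
    "nat \<Rightarrow> nat \<Rightarrow> (nat \<Rightarrow> nat \<Rightarrow> complex poly) \<Rightarrow> (nat \<Rightarrow> nat \<Rightarrow> complex poly) \<Rightarrow> bool" where
  "reflected k d \<Phi> \<Psi> \<longleftrightarrow>
    (\<forall>z. cmod z = 1 \<longrightarrow> (\<forall>a<k. \<forall>b<k. poly (\<Psi> a b) z = z ^ d * cnj (poly (\<Phi> b a) z)))"

context
  fixes k d :: nat and \<Phi> \<Psi> :: "nat \<Rightarrow> nat \<Rightarrow> complex poly"
  assumes reflect: "reflected k d \<Phi> \<Psi>"
begin

abbreviation "gram \<equiv> mmul k \<Psi> \<Phi>"

lemma hip_reflect:
  assumes "cmod z = 1"
  shows "hip k (mapply k (mev \<Psi> z) u) w = z ^ d * hip k u (mapply k (mev \<Phi> z) w)"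
proof -
  have "hip k (mapply k (mev \<Psi> z) u) w = (\<Sum>a<k. \<Sum>c<k. z ^ d * (u c * (cnj (poly (\<Phi> c a) z) * cnj (w a))))"
    unfolding hip_def mapply_def mev_def sum_distrib_right
    by (intro sum.cong refl) (use reflect assms in \<open>simp add: reflected_def ac_simps\<close>)
  also have "\<dots> = (\<Sum>c<k. \<Sum>a<k. z ^ d * (u c * (cnj (poly (\<Phi> c a) z) * cnj (w a))))"
    by (rule sum.swap)
  also have "\<dots> = z ^ d * hip k u (mapply k (mev \<Phi> z) w)"
    by (simp add: hip_def mapply_def mev_def sum_distrib_left)
  finally show ?thesis .
qed

lemma hip_gram:
  assumes "cmod z = 1"
  shows "hip k (mapply k (mev gram z) v) w = z ^ d * hip k (mapply k (mev \<Phi> z) v) (mapply k (mev \<Phi> z) w)"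
  by (simp add: mev_mmul mapply_mmul hip_reflect [OF assms])

text \<open>Here gram is \<open>z^d A\<close> with A Hermitian. Moving A across the form costs
  nothing, and the two powers of \<open>z\<close> combine to \<open>z^(2 * d)\<close> because the
  conjugate of \<open>z\<close> is its inverse.\<close>

lemma hip_gram_swap:
  assumes "cmod z = 1"
  shows "hip k (mapply k (mev gram z) v) w = z ^ (2 * d) * hip k v (mapply k (mev gram z) w)"
proof -
  have "hip k v (mapply k (mev gram z) w) = cnj z ^ d * hip k (mapply k (mev \<Phi> z) v) (mapply k (mev \<Phi> z) w)"
    by (subst hip_cnj, subst hip_gram [OF assms], subst (2) hip_cnj) simp
  then have "z ^ (2 * d) * hip k v (mapply k (mev gram z) w) =
    (z ^ d * cnj z ^ d) * (z ^ d * hip k (mapply k (mev \<Phi> z) v) (mapply k (mev \<Phi> z) w))"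
    by (simp add: mult_2 power_add)
  then show ?thesis by (simp add: hip_gram [OF assms] power_cnj_cancel [OF assms])
qed

lemma gram_eq_0:
  assumes "cmod z = 1" "\<forall>a<k. mapply k (mev gram z) v a = 0" "a < k"
  shows "mapply k (mev \<Phi> z) v a = 0"
proof -
  have "hip k (mapply k (mev gram z) v) v = hip k (\<lambda>a. 0) v"
    using assms(2) by (intro hip_cong) auto
  then have "hip k (mapply k (mev \<Phi> z) v) (mapply k (mev \<Phi> z) v) = 0"
    using assms(1) by (auto simp: hip_gram hip_zero)
  with assms(3) show ?thesis by (simp add: hip_eq_0)
qed

text \<open>Up to a unimodular factor the Gram matrix is Hermitian, so its square has the same
  kernel.\<close>

lemma gram_gram_eq_0:
  assumes "cmod z = 1" "\<forall>a<k. mapply k (mev gram z) (mapply k (mev gram z) v) a = 0" "a < k"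
  shows "mapply k (mev gram z) v a = 0"
proof -
  have "hip k v (mapply k (mev gram z) (mapply k (mev gram z) v)) = hip k v (\<lambda>a. 0)"
    using assms(2) by (intro hip_cong) auto
  then have "hip k (mapply k (mev gram z) v) (mapply k (mev gram z) v) = 0"
    by (simp add: hip_gram_swap [OF assms(1)] hip_zero)
  with assms(3) show ?thesis by (simp add: hip_eq_0)
qed

abbreviation "gram_poly \<equiv> hpoly k d gram"

lemma gram_poly_commute_gram: "mcommute k (gram_poly cs) gram"
proof -
  have "comm_ring_hom (\<lambda>p::complex poly. p)" by unfold_locales auto
  from hpoly_commute [OF this, of k gram gram] show ?thesis
    by (simp add: mcommute_def)
qed

text \<open>\<open>gram_poly cs\<close> is \<open>z^(d * m)\<close> times a real polynomial in the
  Hermitian matrix A, where \<open>m = length cs - 1\<close>. That polynomial is again Hermitian,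
  and only the power of \<open>z\<close> contributes.\<close>

lemma hip_gram_poly_swap:
  assumes "cmod z = 1"
  shows "hip k (mapply k (mev (gram_poly cs) z) v) w =
    z ^ (2 * (d * (length cs - 1))) * hip k v (mapply k (mev (gram_poly cs) z) w)"
proof (induction cs arbitrary: v w)
  case Nil
  then show ?case by (simp add: mev_zero hip_zero mapply_def)
next
  case (Cons c cs)
  let ?B = "mapply k (mev gram z)" and ?N = "mapply k (mev (gram_poly cs) z)"
  let ?L = "d * length cs"
  have app: "mapply k (mev (gram_poly (c # cs)) z) v a = (of_real c * z ^ ?L) * v a + ?B (?N v) a" if "a < k" for a v
    using that unfolding mev_hpoly_Cons by (simp add: mapply_mat_add mapply_mscalar mapply_mmul)
  have L: "hip k (mapply k (mev (gram_poly (c # cs)) z) v) w = of_real c * z ^ ?L * hip k v w + hip k (?B (?N v)) w"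
    by (subst hip_cong [OF app refl]) (simp_all add: hip_add hip_scale)
  have R: "hip k v (mapply k (mev (gram_poly (c # cs)) z) w) =
      of_real c * cnj z ^ ?L * hip k v w + hip k v (?B (?N w))"
    by (subst hip_cong [OF refl app]) (simp_all add: hip_add hip_scale)
  have "hip k (?B (?N v)) w = z ^ (2 * ?L) * hip k v (?B (?N w))"
  \<comment> \<open>For empty \<open>cs\<close> the truncated \<open>length cs - 1\<close> upsets
    the count of exponents, but then \<open>?N\<close> vanishes.\<close>
  proof (cases "cs = []")
    case True
    then show ?thesis by (simp add: mev_zero mapply_def hip_zero)
  next
    case False
    then have len: "length cs = Suc (length cs - 1)" by simp
    have "hip k (?B (?N v)) w = z ^ (2 * d) * (z ^ (2 * (d * (length cs - 1))) * hip k v (?N (?B w)))"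
      by (simp add: hip_gram_swap [OF assms] Cons.IH)
    also have "hip k v (?N (?B w)) = hip k v (?B (?N w))"
      by (rule hip_cong [OF refl]) (rule mev_commute [OF gram_poly_commute_gram])
    also have "z ^ (2 * d) * (z ^ (2 * (d * (length cs - 1))) * hip k v (?B (?N w))) =
        z ^ (2 * d + 2 * (d * (length cs - 1))) * hip k v (?B (?N w))"
      by (simp add: power_add)
    also have "2 * d + 2 * (d * (length cs - 1)) = 2 * ?L"
      by (subst (2) len) simp
    finally show ?thesis .
  qed
  moreover have "z ^ (2 * ?L) * cnj z ^ ?L = z ^ ?L"
    using power_cnj_cancel [OF assms, of ?L] by (simp add: mult_2 power_add)
  ultimately show ?case
    unfolding L R by (simp add: algebra_simps)
qed

text \<open>Real coefficients keep \<open>\<Sum>\<^sub>j c\<^sub>j A\<^sup>j\<close> Hermitian on the circle, so the linear dependence among the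
  powers of \<open>A(\<zeta>)\<close> is taken over the reals.\<close>
lemma ex_annihilator:
  obtains cs where "\<exists>c\<in>set cs. c \<noteq> 0" "\<And>a b. a < k \<Longrightarrow> b < k \<Longrightarrow> mev (gram_poly cs) \<zeta> a b = 0"
proof -
  \<comment> \<open>The \<open>k * k\<close> complex entries give \<open>2 * (k * k)\<close> real
    equations, one fewer than the \<open>n + 1\<close> coefficients.\<close>
  define n where "n = 2 * (k * k)"
  define I where "I = {..<k} \<times> {..<k} \<times> (UNIV :: bool set)"
  define J where "J = {..n}"
  define x where "x j a b = \<zeta> ^ (d * (n - j)) * ((mmul k (mev gram \<zeta>) ^^ j) (mscalar 1)) a b" for j a b
  define A where "A i j = (case i of (a, b, r) \<Rightarrow> if r then Re (x j a b) else Im (x j a b))" for i j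
  have "is_subring (UNIV :: real set)" by (simp add: is_subring_def)
  moreover have "finite I" "card I < card J"
    by (simp_all add: I_def J_def n_def card_cartesian_product)
  ultimately obtain v where v: "\<exists>j\<in>J. v j \<noteq> 0" "\<And>i. i \<in> I \<Longrightarrow> (\<Sum>j\<in>J. A i j * v j) = 0"
    using underdetermined_system [of I J UNIV A] by auto
  show thesis
  proof (rule that [of "map v [0..<Suc n]"])
    show "\<exists>c\<in>set (map v [0..<Suc n]). c \<noteq> 0"
      using v(1) by (auto simp: J_def image_iff less_Suc_eq_le simp del: upt_Suc)
    fix a b assume ab: "a < k" "b < k"
    have "mev (gram_poly (map v [0..<Suc n])) \<zeta> a b = (\<Sum>j<Suc n. of_real (v j) * x j a b)"
      unfolding mev_hpoly x_def by (rule sum.cong) (auto simp: mult.assoc simp del: upt_Suc)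
    also have "\<dots> = (\<Sum>j\<in>J. of_real (v j) * x j a b)"
      by (simp only: J_def lessThan_Suc_atMost)
    also have "\<dots> = 0"
    proof (rule complex_eqI)
      show "Re (\<Sum>j\<in>J. of_real (v j) * x j a b) = Re 0"
        using v(2) [of "(a, b, True)"] ab by (simp add: I_def A_def Re_sum mult.commute)
      show "Im (\<Sum>j\<in>J. of_real (v j) * x j a b) = Im 0"
        using v(2) [of "(a, b, False)"] ab by (simp add: I_def A_def Im_sum mult.commute)
    qed
    finally show "mev (gram_poly (map v [0..<Suc n])) \<zeta> a b = 0" .
  qed
qed

text \<open>Start from a real polynomial that annihilates the Gram matrix at \<zeta>. A zero
  constant term means a factor A, which can be stripped off because A and its square have the same
  kernel. Requiring only that A times the polynomial vanish lets this go on until the constant term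
  is nonzero.\<close>

lemma ex_kernel_polynomial:
  assumes "cmod \<zeta> = 1"
  shows "\<exists>c cs. c \<noteq> 0 \<and>
    (\<forall>v. \<forall>a<k. mapply k (mev gram \<zeta>) (mapply k (mev (gram_poly (c # cs)) \<zeta>) v) a = 0)"
proof -
  have "\<exists>c cs. c \<noteq> 0 \<and> (\<forall>v. \<forall>a<k. mapply k (mev gram \<zeta>) (mapply k (mev (gram_poly (c # cs)) \<zeta>) v) a = 0)"
    if "\<exists>c\<in>set cs. c \<noteq> 0"
      "\<forall>v. \<forall>a<k. mapply k (mev gram \<zeta>) (mapply k (mev (gram_poly cs) \<zeta>) v) a = 0" for cs
    using that
  proof (induction cs)
    case Nil
    then show ?case by simp
  next
    case (Cons c cs)
    show ?case
    proof (cases "c = 0")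
      case True
      \<comment> \<open>With zero head the Horner step is just multiplication by the Gram
        matrix.\<close>
      have "mapply k (mev (gram_poly (c # cs)) \<zeta>) v = mapply k (mev gram \<zeta>) (mapply k (mev (gram_poly cs) \<zeta>) v)" for v
        unfolding mev_hpoly_Cons using True by (simp add: mapply_mat_add mapply_mmul) (simp add: mapply_def mscalar_def)
      with Cons.prems(2) have "\<forall>v. \<forall>a<k. mapply k (mev gram \<zeta>) (mapply k (mev (gram_poly cs) \<zeta>) v) a = 0"
        using gram_gram_eq_0 [OF assms] by metis
      moreover have "\<exists>c\<in>set cs. c \<noteq> 0" using Cons.prems(1) True by auto
      ultimately show ?thesis by (rule Cons.IH [rotated])
    next
      case False
      with Cons.prems(2) show ?thesis by blast
    qed
  qed
  moreover from ex_annihilator obtain cs where cs: "\<exists>c\<in>set cs. c \<noteq> 0"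
    "\<And>a b. a < k \<Longrightarrow> b < k \<Longrightarrow> mev (gram_poly cs) \<zeta> a b = 0" by metis
  have "mapply k (mev (gram_poly cs) \<zeta>) v a = 0" if "a < k" for v a
    using cs(2) [OF that] by (simp add: mapply_def)
  then have "\<forall>v. \<forall>a<k. mapply k (mev gram \<zeta>) (mapply k (mev (gram_poly cs) \<zeta>) v) a = 0"
    by (simp add: mapply_eq_0)
  ultimately show ?thesis using cs(1) by blast
qed

end

text \<open>\<open>S\<close> is the correcting factor with denominators cleared. It commutes with
  everything that commutes with the Gram matrix, so \<open>\<Phi>'\<close> inherits the intertwining
  relations of \<open>\<Phi>\<close>. Dividing by \<open>z - \<zeta>\<close> removes
  \<open>k\<close> roots from the determinant, while \<open>mdet k S\<close> brings in fewer than
  \<open>k\<close>.\<close>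

lemma remove_circle_root:
  assumes reflect: "reflected k d \<Phi> \<Psi>"
    and \<zeta>: "cmod \<zeta> = 1" and root: "poly (mdet k \<Phi>) \<zeta> = 0" and nz: "mdet k \<Phi> \<noteq> 0"
  obtains S \<Phi>' where
    "\<And>a b. a < k \<Longrightarrow> b < k \<Longrightarrow> [:-\<zeta>, 1:] * \<Phi>' a b = mmul k \<Phi> S a b"
    "\<And>\<Theta>. mcommute k (\<lambda>a b. fps_of_poly (mmul k \<Psi> \<Phi> a b)) \<Theta> \<Longrightarrow>
      mcommute k (\<lambda>a b. fps_of_poly (S a b)) \<Theta>"
    "mdet k \<Phi>' \<noteq> 0" "circle_roots (mdet k \<Phi>') < circle_roots (mdet k \<Phi>)"
proof -
  define X J where "X = [:-\<zeta>, 1:]" and "J = [:\<i> * \<zeta>:]"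
  have poly_XJ: "poly X z = z - \<zeta>" "poly J z = \<i> * \<zeta>" for z
    by (simp_all add: X_def J_def)
  define G where "G = mmul k \<Psi> \<Phi>"
  obtain c cs where c: "c \<noteq> 0" and ker_all: "\<forall>v. \<forall>a<k.
      mapply k (mev G \<zeta>) (mapply k (mev (hpoly k d G (c # cs)) \<zeta>) v) a = 0"
    using ex_kernel_polynomial [OF reflect \<zeta>, folded G_def] by (elim exE conjE) (rule that)
  define E where "E = hpoly k d G (c # cs)"
  define e where "e = d * length cs"
  have ker: "mapply k (mev G \<zeta>) (mapply k (mev E \<zeta>) v) a = 0" if "a < k" for v a
    using ker_all that unfolding E_def by (elim allE impE)
  have comm: "mcommute k E G"
    unfolding E_def G_def by (rule gram_poly_commute_gram [OF reflect])
  have E_swap: "hip k (mapply k (mev E z) v) w = z ^ (2 * e) * hip k v (mapply k (mev E z) w)"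
    if "cmod z = 1" for z v w
    using hip_gram_poly_swap [OF reflect that, of "c # cs" v w] by (simp add: E_def G_def e_def)
  \<comment> \<open>On the kernel of \<open>G\<close> at \<zeta> only the constant term of the
    polynomial survives, so \<open>E\<close> acts there as a nonzero scalar.\<close>
  have mev_E: "mapply k (mev E \<zeta>) v a = of_real c * \<zeta> ^ e * v a"
    if "\<forall>b<k. mapply k (mev G \<zeta>) v b = 0" "a < k" for v a
  proof -
    have "mcommute k (hpoly k d G cs) G"
      unfolding G_def by (rule gram_poly_commute_gram [OF reflect])
    then have "mapply k (mev G \<zeta>) (mapply k (mev (hpoly k d G cs) \<zeta>) v) a =
        mapply k (mev (hpoly k d G cs) \<zeta>) (mapply k (mev G \<zeta>) v) a"
      using mev_commute [OF _ that(2)] by metis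
    also have "\<dots> = 0" using that by (simp add: mapply_eq_0)
    finally show ?thesis
      using that(2) unfolding E_def mev_hpoly_Cons
      by (simp add: mapply_mat_add mapply_mscalar mapply_mmul e_def)
  qed
  have \<Phi>E: "mapply k (mev \<Phi> \<zeta>) (mapply k (mev E \<zeta>) v) a = 0" if "a < k" for v a
    by (rule gram_eq_0 [OF reflect \<zeta> _ that]) (use ker in \<open>simp_all add: G_def\<close>)
  \<comment> \<open>The values of \<open>E\<close> at \<zeta> lie in the kernels of
    \<open>\<Phi>\<close> and \<open>G\<close> there, so both divisions by \<open>X\<close> are
    exact.\<close>
  define P where "P a b = mmul k \<Phi> E a b div X" for a b
  define Q where "Q a b = mmul k G E a b div X" for a b
  have P: "X * P a b = mmul k \<Phi> E a b" if "a < k" "b < k" for a b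
    unfolding P_def by (rule dvd_mult_div_cancel [OF mev_eq_0_of_mapply [OF \<Phi>E that, folded X_def]])
  have Q: "X * Q a b = mmul k G E a b" if "a < k" "b < k" for a b
    unfolding Q_def by (rule dvd_mult_div_cancel [OF mev_eq_0_of_mapply [OF ker that, folded X_def]])
  \<comment> \<open>Since \<open>E\<close> is \<open>z^e p(A)\<close>, this is
    \<open>z^(2 * e) * ((z - \<zeta>) + \<i> * \<zeta> * p(A)^2)\<close>.\<close>
  define S where "S a b = mscalar (monom 1 (2 * e) * X) a b + J * mmul k E E a b" for a b
  define \<Phi>' where "\<Phi>' a b = monom 1 (2 * e) * \<Phi> a b + J * mmul k P E a b" for a b
  have \<Phi>'_S: "X * \<Phi>' a b = mmul k \<Phi> S a b" if "a < k" "b < k" for a b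
  proof -
    have "X * mmul k P E a b = mmul k (\<lambda>a b. X * P a b) E a b"
      by (simp add: mmul_scale_left)
    also have "\<dots> = mmul k \<Phi> (mmul k E E) a b"
      unfolding mmul_assoc [symmetric] using P that by (intro mmul_cong) auto
    finally show ?thesis
      using that unfolding \<Phi>'_def S_def
      by (simp add: mmul_add_right mmul_scale_right mmul_mscalar_right distrib_left mult.left_commute)
  qed
  have S_comm: "mcommute k (\<lambda>a b. fps_of_poly (S a b)) \<Theta>"
    if "mcommute k (\<lambda>a b. fps_of_poly (mmul k \<Psi> \<Phi> a b)) \<Theta>" for \<Theta>
  proof -
    let ?E = "\<lambda>a b. fps_of_poly (E a b)"
    have E: "mcommute k ?E \<Theta>"
      unfolding E_def G_def by (rule hpoly_commute [OF comm_ring_hom_fps_of_poly that])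
    have "(\<lambda>a b. fps_of_poly (S a b)) = (\<lambda>a b. mscalar (fps_of_poly (monom 1 (2 * e) * X)) a b +
        fps_of_poly J * mmul k ?E ?E a b)"
      unfolding S_def mmul_hom [OF comm_ring_hom_fps_of_poly]
      by (auto simp only: fps_of_poly_add fps_of_poly_mult mscalar_def fun_eq_iff fps_of_poly_0 split: if_splits)
    then show ?thesis
      by (simp only: mcommute_add mcommute_mscalar mcommute_scale mcommute_mmul E)
  qed
  \<comment> \<open>\<open>S2\<close> is an auxiliary factor for estimating the order of
    \<open>mdet k S\<close> at \<zeta>. The product of \<open>S\<close> and \<open>S2\<close> is
    \<open>X * R\<close> with \<open>R\<close> nonsingular at \<zeta>, whereas \<open>S2\<close> is
    singular there.\<close>
  define S2 where "S2 a b = mscalar X a b + mmul k G G a b" for a b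
  define R where "R a b = mscalar (monom 1 (2 * e) * X) a b + monom 1 (2 * e) * mmul k G G a b +
    J * (mmul k E E a b + X * mmul k Q Q a b)" for a b
  have GE: "mmul k E G a b = mmul k G E a b" if "a < k" "b < k" for a b
    using comm that by (rule mcommuteD)
  have EEGG: "mmul k (mmul k E E) (mmul k G G) a b = X * (X * mmul k Q Q a b)" if "a < k" "b < k" for a b
  proof -
    have "mmul k (mmul k E E) (mmul k G G) a b = mmul k E (mmul k (mmul k E G) G) a b"
      by (simp add: mmul_assoc)
    also have "\<dots> = mmul k E (mmul k (mmul k G E) G) a b"
      by (rule mmul_cong, rule refl, rule mmul_cong, rule GE) (use that in auto)
    also have "\<dots> = mmul k (mmul k E G) (mmul k E G) a b"
      by (simp add: mmul_assoc)
    also have "\<dots> = mmul k (\<lambda>a b. X * Q a b) (\<lambda>a b. X * Q a b) a b"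
      by (rule mmul_cong) (use that GE Q in auto)
    finally show ?thesis by (simp only: mmul_scale_left mmul_scale_right)
  qed
  have SR: "mmul k S S2 a b = X * R a b" if "a < k" "b < k" for a b
  proof -
    have "mmul k S S2 a b = (monom 1 (2 * e) * X) * (mscalar X a b + mmul k G G a b) +
        J * (X * mmul k E E a b + mmul k (mmul k E E) (mmul k G G) a b)"
      unfolding S_def S2_def mmul_add_left mmul_add_right mmul_scale_left
      using that by (simp only: mmul_mscalar_left mmul_mscalar_right distrib_left)
        (simp add: mscalar_def algebra_simps)
    also have "\<dots> = X * R a b"
      unfolding EEGG [OF that] R_def by (simp add: mscalar_def algebra_simps)
    finally show ?thesis .
  qed
  have ev_S: "mapply k (mev S z) v a = z ^ (2 * e) * (z - \<zeta>) * v a +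
      \<i> * \<zeta> * mapply k (mev E z) (mapply k (mev E z) v) a" if "a < k" for z v a
    using that unfolding S_def mev_add mev_scale mev_mscalar mev_mmul
    by (simp add: mapply_mat_add mapply_mat_scale mapply_mscalar mapply_mmul poly_monom poly_XJ)
  have ev_S2: "mapply k (mev S2 z) v a = (z - \<zeta>) * v a +
      mapply k (mev G z) (mapply k (mev G z) v) a" if "a < k" for z v a
    using that unfolding S2_def mev_add mev_scale mev_mscalar mev_mmul
    by (simp add: mapply_mat_add mapply_mat_scale mapply_mscalar mapply_mmul poly_monom poly_XJ)
  have ev_R: "mapply k (mev R \<zeta>) v a = \<zeta> ^ (2 * e) * mapply k (mev G \<zeta>) (mapply k (mev G \<zeta>) v) a +
      \<i> * \<zeta> * mapply k (mev E \<zeta>) (mapply k (mev E \<zeta>) v) a" if "a < k" for v a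
    using that unfolding R_def mev_add mev_scale mev_mscalar mev_mmul
    by (simp add: mapply_mat_add mapply_mat_scale mapply_mscalar mapply_mmul poly_monom poly_XJ)
  have \<zeta>0: "\<zeta> \<noteq> 0" using \<zeta> by auto
  \<comment> \<open>At \<zeta> the matrix \<open>R\<close> is a combination of the squares of
    \<open>G\<close> and \<open>E\<close> with \<open>G E = 0\<close>. Applying \<open>G\<close> to
    a kernel vector leaves only its cube, so the vector lies in the kernel of \<open>G\<close>,
    where \<open>E\<close> is a nonzero scalar.\<close>
  have det_R: "poly (mdet k R) \<zeta> \<noteq> 0"
  proof
    assume "poly (mdet k R) \<zeta> = 0"
    then obtain v where v: "\<exists>a<k. v a \<noteq> 0" "\<forall>a<k. mapply k (mev R \<zeta>) v a = 0"
      unfolding poly_mdet mdet_eq_0_iff by blast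
    let ?G = "mapply k (mev G \<zeta>)" and ?E = "mapply k (mev E \<zeta>)"
    have "\<zeta> ^ (2 * e) * ?G (?G (?G v)) a = 0" if "a < k" for a
    proof -
      have "0 = ?G (mapply k (mev R \<zeta>) v) a" using v(2) by (simp add: mapply_eq_0)
      also have "\<dots> = ?G (\<lambda>a. \<zeta> ^ (2 * e) * ?G (?G v) a + \<i> * \<zeta> * ?E (?E v) a) a"
        by (intro fun_cong [OF mapply_cong]) (rule ev_R)
      also have "\<dots> = \<zeta> ^ (2 * e) * ?G (?G (?G v)) a + \<i> * \<zeta> * ?G (?E (?E v)) a"
        by (simp add: mapply_add mapply_scale)
      finally show ?thesis using ker [OF that] by simp
    qed
    then have "\<forall>a<k. ?G (?G (?G v)) a = 0" using \<zeta>0 by simp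
    then have "\<forall>a<k. ?G (?G v) a = 0"
      using gram_gram_eq_0 [OF reflect \<zeta>, of "?G v"] unfolding G_def by blast
    then have Gv: "\<forall>a<k. ?G v a = 0"
      using gram_gram_eq_0 [OF reflect \<zeta>, of v] unfolding G_def by blast
    have "?E (?E v) a = (of_real c * \<zeta> ^ e) * (of_real c * \<zeta> ^ e) * v a" if "a < k" for a
    proof -
      have "?E (?E v) = ?E (\<lambda>a. of_real c * \<zeta> ^ e * v a)"
        by (rule mapply_cong) (rule mev_E [OF Gv])
      then show ?thesis
        by (simp add: mapply_scale mev_E [OF Gv that])
    qed
    then have "\<i> * \<zeta> * ((of_real c * \<zeta> ^ e) * (of_real c * \<zeta> ^ e) * v a) = 0" if "a < k" for a
      using ev_R [OF that, of v] v(2) that Gv by (simp add: mapply_eq_0)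
    with \<zeta>0 c v(1) show False by auto
  qed
  have det_S2: "poly (mdet k S2) \<zeta> = 0"
  proof -
    from root obtain v where v: "\<exists>a<k. v a \<noteq> 0" "\<forall>a<k. mapply k (mev \<Phi> \<zeta>) v a = 0"
      unfolding poly_mdet mdet_eq_0_iff by blast
    have "mapply k (mev G \<zeta>) v = (\<lambda>a. 0)"
      using v(2) by (simp add: G_def mev_mmul mapply_mmul mapply_eq_0)
    then have "\<forall>a<k. mapply k (mev S2 \<zeta>) v a = 0"
      by (simp add: ev_S2 mapply_eq_0)
    with v(1) show ?thesis unfolding poly_mdet mdet_eq_0_iff by blast
  qed
  \<comment> \<open>Pairing a kernel vector \<open>v\<close> with itself and rotating by the
    conjugate of \<zeta> makes the \<open>E\<close> term purely imaginary; this is why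
    \<open>J\<close> is \<open>\<i> * \<zeta>\<close>. The real part then gives
    \<open>Re (cnj \<zeta> * z) = 1\<close>, which on the circle means
    \<open>z = \<zeta>\<close>.\<close>
  have det_S: "poly (mdet k S) z \<noteq> 0" if z: "cmod z = 1" "z \<noteq> \<zeta>" for z
  proof
    assume "poly (mdet k S) z = 0"
    then obtain v where v: "\<exists>a<k. v a \<noteq> 0" "\<forall>a<k. mapply k (mev S z) v a = 0"
      unfolding poly_mdet mdet_eq_0_iff by blast
    let ?E = "mapply k (mev E z)"
    have "0 = hip k (mapply k (mev S z) v) v"
      using v(2) hip_cong [of k "mapply k (mev S z) v" "\<lambda>a. 0" v v] by (simp add: hip_zero)
    also have "\<dots> = hip k (\<lambda>a. z ^ (2 * e) * (z - \<zeta>) * v a + \<i> * \<zeta> * ?E (?E v) a) v"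
      by (rule hip_cong [OF ev_S refl])
    also have "\<dots> = z ^ (2 * e) * ((z - \<zeta>) * hip k v v + \<i> * \<zeta> * hip k (?E v) (?E v))"
      by (simp only: hip_add hip_scale E_swap [OF z(1), of "?E v" v]) (simp add: algebra_simps)
    finally have "(z - \<zeta>) * hip k v v + \<i> * \<zeta> * hip k (?E v) (?E v) = 0"
      using z(1) by auto
    moreover have "cnj \<zeta> * ((z - \<zeta>) * p + \<i> * \<zeta> * q) =
        (cnj \<zeta> * z - cnj \<zeta> * \<zeta>) * p + \<i> * (cnj \<zeta> * \<zeta>) * q" for p q
      by (simp add: algebra_simps)
    moreover have unit: "cnj \<zeta> * \<zeta> = 1"
      using power_cnj_cancel [OF \<zeta>, of 1] by (simp add: mult.commute)
    ultimately have "(cnj \<zeta> * z - 1) * hip k v v + \<i> * hip k (?E v) (?E v) = 0"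
      by (metis mult_zero_right mult.right_neutral)
    then have "Re ((cnj \<zeta> * z - 1) * hip k v v + \<i> * hip k (?E v) (?E v)) = 0" by simp
    then have "(Re (cnj \<zeta> * z) - 1) * (\<Sum>a<k. (cmod (v a))\<^sup>2) = 0"
      unfolding hip_self by simp
    moreover have "(\<Sum>a<k. (cmod (v a))\<^sup>2) \<noteq> 0"
      using v(1) hip_eq_0 [of k v] unfolding hip_self of_real_eq_0_iff by blast
    ultimately have re: "Re (cnj \<zeta> * z) = 1" by simp
    have "cmod (cnj \<zeta> * z) = 1" using z(1) \<zeta> by (simp add: norm_mult)
    then have "(Re (cnj \<zeta> * z))\<^sup>2 + (Im (cnj \<zeta> * z))\<^sup>2 = 1"
      by (metis cmod_power2 power_one)
    with re have "Im (cnj \<zeta> * z) = 0" by simp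
    with re have "cnj \<zeta> * z = 1"
      by (intro complex_eqI) simp_all
    then have "cnj \<zeta> * z = cnj \<zeta> * \<zeta>" by (simp only: unit)
    then have "z = \<zeta>" using \<zeta>0 by simp
    with z(2) show False by simp
  qed
  have det_prod: "mdet k S * mdet k S2 = X ^ k * mdet k R"
  proof -
    have "mdet k S * mdet k S2 = mdet k (\<lambda>a b. X * R a b)"
      unfolding mdet_mmul [symmetric] by (intro mdet_cong) (rule SR)
    then show ?thesis by (simp only: mdet_scale)
  qed
  have R0: "mdet k R \<noteq> 0" using det_R by auto
  have ord_pow: "order \<zeta> (X ^ k) = k" unfolding X_def by (rule order_power_n_n)
  have prod0: "mdet k S * mdet k S2 \<noteq> 0"
    unfolding det_prod using R0 by (simp add: X_def)
  then have S0: "mdet k S \<noteq> 0" "mdet k S2 \<noteq> 0" by auto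
  \<comment> \<open>The orders of \<open>S\<close> and \<open>S2\<close> add up to \<open>k\<close>,
    and that of \<open>S2\<close> is positive.\<close>
  have "order \<zeta> (mdet k S) + order \<zeta> (mdet k S2) = order \<zeta> (X ^ k) + order \<zeta> (mdet k R)"
    using order_mult [OF prod0] order_mult [OF prod0 [unfolded det_prod]] by (simp only: det_prod)
  moreover have "order \<zeta> (mdet k R) = 0" using det_R by (rule order_0I)
  moreover have "order \<zeta> (mdet k S2) \<noteq> 0" using det_S2 S0(2) by (simp add: order_root)
  ultimately have ord_S: "order \<zeta> (mdet k S) < k" using ord_pow by linarith
  have det_\<Phi>': "X ^ k * mdet k \<Phi>' = mdet k \<Phi> * mdet k S"
  proof -
    have "mdet k \<Phi> * mdet k S = mdet k (\<lambda>a b. X * \<Phi>' a b)"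
      unfolding mdet_mmul [symmetric] by (intro mdet_cong) (rule \<Phi>'_S [symmetric])
    then show ?thesis by (simp only: mdet_scale)
  qed
  with nz S0(1) have \<Phi>'0: "mdet k \<Phi>' \<noteq> 0" by auto
  have "k + circle_roots (mdet k \<Phi>') = circle_roots (mdet k \<Phi>) + circle_roots (mdet k S)"
  proof -
    have "X ^ k \<noteq> 0" by (simp add: X_def)
    from circle_roots_mult [OF this \<Phi>'0] show ?thesis
      unfolding det_\<Phi>' circle_roots_mult [OF nz S0(1)] circle_roots_linear_power [OF \<zeta>, folded X_def] by simp
  qed
  moreover have "circle_roots (mdet k S) = order \<zeta> (mdet k S)"
    using S0(1) \<zeta> det_S by (rule circle_roots_single)
  ultimately have "circle_roots (mdet k \<Phi>') < circle_roots (mdet k \<Phi>)"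
    using ord_S by linarith
  note less = this
  show thesis
  proof (rule that)
    show "[:-\<zeta>, 1:] * \<Phi>' a b = mmul k \<Phi> S a b" if "a < k" "b < k" for a b
      using \<Phi>'_S [OF that] unfolding X_def .
    show "mcommute k (\<lambda>a b. fps_of_poly (S a b)) \<Theta>"
      if "mcommute k (\<lambda>a b. fps_of_poly (mmul k \<Psi> \<Phi> a b)) \<Theta>" for \<Theta>
      using that by (rule S_comm)
  qed (rule \<Phi>'0, rule less)
qed

section \<open>Shifts in coordinates\<close>

text \<open>The Hardy space of the disc, given by Taylor coefficients. Formal power series form an
  integral domain, so the results on linear systems and determinants apply.\<close>

definition square_summable :: "complex fps set" where
  "square_summable = {f. summable (\<lambda>m. (cmod (fps_nth f m))\<^sup>2)}"

lemma square_summable_finite: "finite {m. fps_nth f m \<noteq> 0} \<Longrightarrow> f \<in> square_summable"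
  unfolding square_summable_def by (auto intro!: summable_finite)

lemma square_summable_0 [simp]: "0 \<in> square_summable"
  and square_summable_1 [simp]: "1 \<in> square_summable"
  by (auto intro!: square_summable_finite)

lemma square_summable_add:
  assumes "f \<in> square_summable" "g \<in> square_summable"
  shows "f + g \<in> square_summable"
proof -
  have le: "(cmod (a + b))\<^sup>2 \<le> 2 * (cmod a)\<^sup>2 + 2 * (cmod b)\<^sup>2" for a b
  proof -
    have "(cmod (a + b))\<^sup>2 \<le> (cmod a + cmod b)\<^sup>2"
      by (intro power_mono norm_triangle_ineq) simp
    moreover have "0 \<le> (cmod a - cmod b)\<^sup>2" by simp
    ultimately show ?thesis by (simp add: power2_sum power2_diff)
  qed
  have "summable (\<lambda>m. 2 * (cmod (fps_nth f m))\<^sup>2 + 2 * (cmod (fps_nth g m))\<^sup>2)"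
    using assms by (intro summable_add summable_mult) (auto simp: square_summable_def)
  then show ?thesis
    unfolding square_summable_def mem_Collect_eq
    by (rule summable_comparison_test' [where N = 0]) (simp add: le)
qed

lemma square_summable_const: "f \<in> square_summable \<Longrightarrow> fps_const c * f \<in> square_summable"
  by (auto simp: square_summable_def norm_mult power_mult_distrib intro: summable_mult)

lemma square_summable_X: "f \<in> square_summable \<Longrightarrow> fps_X * f \<in> square_summable"
proof -
  assume "f \<in> square_summable"
  then have "summable (\<lambda>m. (cmod (fps_nth (fps_X * f) (Suc m)))\<^sup>2)"
    by (simp add: square_summable_def)
  then show ?thesis unfolding square_summable_def mem_Collect_eq by (rule summable_Suc_iff [THEN iffD1])
qed

lemma square_summable_shift: "f \<in> square_summable \<Longrightarrow> fps_shift (Suc 0) f \<in> square_summable"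
  by (simp add: square_summable_def summable_Suc_iff [of "\<lambda>m. (cmod (fps_nth f m))\<^sup>2"])

lemma square_summable_poly: "f \<in> square_summable \<Longrightarrow> fps_of_poly p * f \<in> square_summable"
proof (induction p)
  case 0
  then show ?case by simp
next
  case (pCons a p)
  have "fps_of_poly (pCons a p) * f = fps_const a * f + fps_X * (fps_of_poly p * f)"
    by (simp add: fps_of_poly_pCons algebra_simps)
  then show ?case using pCons by (simp add: square_summable_add square_summable_const square_summable_X)
qed

section \<open>Complex-linear maps and isometries\<close>

definition clinear_map :: "('a::complex_hilbert_space \<Rightarrow> 'b::complex_hilbert_space) \<Rightarrow> bool" where
  "clinear_map T \<longleftrightarrow> (\<forall>x y. T (x + y) = T x + T y) \<and> (\<forall>c x. T (c *\<^sub>C x) = c *\<^sub>C T x)"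

lemma clinear_mapD:
  assumes "clinear_map T"
  shows "T (x + y) = T x + T y" "T (c *\<^sub>C x) = c *\<^sub>C T x" "T 0 = 0" "T (x - y) = T x - T y"
    "T (sum f I) = (\<Sum>i\<in>I. T (f i))"
proof -
  show *: "T (x + y) = T x + T y" "T (c *\<^sub>C x) = c *\<^sub>C T x" for x y c
    using assms by (auto simp: clinear_map_def)
  show 0: "T 0 = 0" using *(1) [of 0 0] by simp
  show "T (x - y) = T x - T y" using *(1) [of "x - y" y] by (simp add: algebra_simps)
  show "T (sum f I) = (\<Sum>i\<in>I. T (f i))"
    by (induction I rule: infinite_finite_induct) (auto simp: * 0)
qed

lemma bounded_clinear_imp_clinear_map: "bounded_clinear T \<Longrightarrow> clinear_map T"
  unfolding bounded_clinear_def clinear_map_def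
  using linear_add bounded_linear.linear by blast

lemma cinner_eq_complex: "cinner x y = Complex (x \<bullet> y) (x \<bullet> (\<i> *\<^sub>C y))"
proof -
  have "cinner x (\<i> *\<^sub>C y) = - \<i> * cinner x y"
    by (subst (1 2) cinner_commute) (simp add: cinner_scaleC_left)
  then show ?thesis by (simp add: inner_eq_Re_cinner complex_eq_iff)
qed

text \<open>Polarization preserves the real inner product, and \<open>cinner_eq_complex\<close>
  recovers the imaginary part from it.\<close>

lemma isometry_cinner:
  assumes "isometry V"
  shows "cinner (V x) (V y) = cinner x y"
proof -
  have lin: "clinear_map V" and norm: "\<And>x. norm (V x) = norm x"
    using assms by (auto simp: isometry_def bounded_clinear_imp_clinear_map)
  have "V x \<bullet> V y = x \<bullet> y" for x y
    using norm [of "x + y"] norm [of x] norm [of y]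
    by (simp add: clinear_mapD(1) [OF lin] norm_eq inner_add_left inner_add_right inner_commute)
  then show ?thesis
    by (simp add: cinner_eq_complex clinear_mapD(2) [OF lin, symmetric])
qed

section \<open>The coordinate model of a single shift\<close>

locale shift_model =
  fixes k :: nat and V :: "'a::complex_hilbert_space \<Rightarrow> 'a" and U :: "'a \<Rightarrow> nat \<Rightarrow> nat \<Rightarrow> complex"
  assumes unitary: "unitary_onto_ell2_tensor k U"
    and U_V: "U (V x) = unilateral_shift (U x)"
    and isometry: "isometry V"
begin

lemma V_clinear: "clinear_map V"
  using isometry by (simp add: isometry_def bounded_clinear_imp_clinear_map)

lemma norm_V: "norm (V x) = norm x"
  using isometry by (simp add: isometry_def)

lemma U_ell2: "U x \<in> ell2_tensor k"
  using unitary by (auto simp: unitary_onto_ell2_tensor_def bij_betw_def)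

lemma U_inj: "U x = U y \<Longrightarrow> x = y"
  using unitary by (auto simp: unitary_onto_ell2_tensor_def bij_betw_def dest: injD)

lemma cinner_U: "cinner x y = (\<Sum>m. \<Sum>j<k. U x m j * cnj (U y m j))"
  using unitary by (simp add: unitary_onto_ell2_tensor_def ell2_inner_def)

definition crd :: "'a \<Rightarrow> nat \<Rightarrow> complex fps" where
  "crd x = (\<lambda>a. Abs_fps (\<lambda>m. U x m a))"

lemma crd_nth [simp]: "fps_nth (crd x a) m = U x m a"
  by (simp add: crd_def)

lemma crd_inj: "crd x = crd y \<Longrightarrow> x = y"
  by (rule U_inj) (metis crd_nth ext)

lemma crd_add: "crd (x + y) = (\<lambda>a. crd x a + crd y a)"
  and crd_scaleC: "crd (c *\<^sub>C x) = (\<lambda>a. fps_const c * crd x a)"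
  using unitary by (auto simp: unitary_onto_ell2_tensor_def fun_eq_iff fps_eq_iff)

lemma crd_V: "crd (V x) = (\<lambda>a. fps_X * crd x a)"
  by (auto simp: U_V unilateral_shift_def fps_eq_iff fun_eq_iff)

lemma crd_zero: "crd 0 = (\<lambda>a. 0)"
  using crd_add [of 0 0] by (auto simp: fun_eq_iff)

lemma crd_sum: "crd (sum f I) = (\<lambda>a. \<Sum>i\<in>I. crd (f i) a)"
  by (induction I rule: infinite_finite_induct) (auto simp: crd_zero crd_add)

lemma crd_diff: "crd (x - y) = (\<lambda>a. crd x a - crd y a)"
  using crd_add [of "x - y" y] by (auto simp: fun_eq_iff)

lemma crd_funpow: "crd ((V ^^ n) x) = (\<lambda>a. fps_X ^ n * crd x a)"
  by (induction n) (auto simp: crd_V fun_eq_iff ac_simps)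

lemma crd_outside: "a \<ge> k \<Longrightarrow> crd x a = 0"
  using U_ell2 [of x] by (auto simp: ell2_tensor_def fps_eq_iff)

lemma crd_square_summable: "crd x a \<in> square_summable"
proof (cases "a < k")
  case True
  have "summable (\<lambda>m. \<Sum>j<k. (cmod (U x m j))\<^sup>2)"
    using U_ell2 [of x] by (auto simp: ell2_tensor_def)
  moreover have "norm ((cmod (U x m a))\<^sup>2) \<le> (\<Sum>j<k. (cmod (U x m j))\<^sup>2)" for m
    using True member_le_sum [of a "{..<k}" "\<lambda>j. (cmod (U x m j))\<^sup>2"] by simp
  ultimately show ?thesis
    unfolding square_summable_def by (auto intro: summable_comparison_test')
next
  case False
  then show ?thesis by (simp add: crd_outside)
qed

lemma ex_crd:
  assumes "\<And>a. a < k \<Longrightarrow> f a \<in> square_summable" "\<And>a. a \<ge> k \<Longrightarrow> f a = 0"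
  shows "\<exists>x. crd x = f"
proof -
  let ?g = "\<lambda>m a. fps_nth (f a) m"
  have "?g \<in> ell2_tensor k"
    using assms by (auto simp: ell2_tensor_def square_summable_def intro!: summable_sum)
  moreover have "range U = ell2_tensor k"
    using unitary by (simp add: unitary_onto_ell2_tensor_def bij_betw_def)
  ultimately have "?g \<in> range U" by simp
  then obtain x where "U x = ?g" by (metis rangeE)
  then have "crd x = f" by (simp add: crd_def fps_nth_inverse)
  then show ?thesis ..
qed

lemma ex_crd_poly: "\<exists>y. crd y = (\<lambda>a. fps_of_poly p * crd x a)"
  by (rule ex_crd) (auto simp: square_summable_poly crd_square_summable crd_outside)

text \<open>The elementary tensor of \<open>f\<close> and the \<open>b\<close>-th basis vector. It
  is zero for \<open>b \<ge> k\<close>; for smaller \<open>b\<close> it is meaningful only for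
  square-summable \<open>f\<close>.\<close>

definition single :: "nat \<Rightarrow> complex fps \<Rightarrow> 'a" where
  "single b f = (SOME x. crd x = (\<lambda>a. if a = b \<and> b < k then f else 0))"

lemma crd_single: "f \<in> square_summable \<Longrightarrow> crd (single b f) = (\<lambda>a. if a = b \<and> b < k then f else 0)"
  unfolding single_def by (rule someI_ex, rule ex_crd) auto

abbreviation "e b \<equiv> single b 1"

lemma crd_e: "crd (e b) = (\<lambda>a. if a = b \<and> b < k then 1 else 0)"
  by (simp add: crd_single)

text \<open>The first step of the Wold decomposition: the constant terms give the component in the
  wandering subspace, and the remaining series is divisible by \<open>fps_X\<close>.\<close>

lemma decompose: "\<exists>y. x = (\<Sum>b<k. U x 0 b *\<^sub>C e b) + V y \<and>
  (\<forall>a. crd x a = fps_const (U x 0 a) + fps_X * crd y a)"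
proof -
  obtain y where y: "crd y = (\<lambda>a. fps_shift (Suc 0) (crd x a))"
    using ex_crd [of "\<lambda>a. fps_shift (Suc 0) (crd x a)"]
    by (auto simp: square_summable_shift [OF crd_square_summable] crd_outside)
  have sum: "(\<Sum>b<k. fps_const (U x 0 b) * crd (e b) a) = fps_const (U x 0 a)" for a
  proof (cases "a < k")
    case True
    have "(\<Sum>b<k. fps_const (U x 0 b) * crd (e b) a) = (\<Sum>b<k. if b = a then fps_const (U x 0 b) else 0)"
      by (rule sum.cong) (auto simp: crd_e)
    then show ?thesis using True by simp
  next
    case False
    then have "crd x a = 0" by (simp add: crd_outside)
    then have "U x 0 a = 0" using crd_nth [of x a 0] by simp
    moreover have "(\<Sum>b<k. fps_const (U x 0 b) * crd (e b) a) = 0"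
      using False by (intro sum.neutral) (auto simp: crd_e)
    ultimately show ?thesis by simp
  qed
  have step: "crd x a = fps_const (U x 0 a) + fps_X * crd y a" for a
  proof -
    have "crd x a = fps_const (fps_nth (crd x a) 0) + fps_X * fps_shift (Suc 0) (crd x a)"
      by (rule fps_ext) (auto simp: fps_X_mult_nth simp del: crd_nth)
    then show ?thesis by (simp add: y)
  qed
  then have "crd x = crd ((\<Sum>b<k. U x 0 b *\<^sub>C e b) + V y)"
    by (simp add: fun_eq_iff crd_add crd_sum crd_scaleC crd_V sum)
  then have "x = (\<Sum>b<k. U x 0 b *\<^sub>C e b) + V y" by (rule crd_inj)
  with step show ?thesis by blast
qed

lemma range_V_iff: "x \<in> range V \<longleftrightarrow> (\<forall>b<k. U x 0 b = 0)"
proof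
  assume "x \<in> range V"
  then show "\<forall>b<k. U x 0 b = 0" by (auto simp: U_V unilateral_shift_def)
next
  assume "\<forall>b<k. U x 0 b = 0"
  then have "(\<Sum>b<k. U x 0 b *\<^sub>C e b) = 0" by simp
  with decompose [of x] show "x \<in> range V" by (metis add_0 rangeI)
qed

lemma cinner_monomial:
  assumes "a < k"
  shows "cinner x ((V ^^ m) (e a)) = U x m a"
proof -
  have "U ((V ^^ m) (e a)) n j = (if j = a \<and> n = m then 1 else 0)" for n j
  proof -
    have "U ((V ^^ m) (e a)) n j = fps_nth (crd ((V ^^ m) (e a)) j) n" by simp
    then show ?thesis using assms by (simp add: crd_funpow crd_e del: crd_nth)
  qed
  then have "cinner x ((V ^^ m) (e a)) = (\<Sum>n. if n = m then U x n a else 0)"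
    unfolding cinner_U using assms
    by (intro arg_cong [where f = suminf] ext)
      (auto simp: if_distrib [of "\<lambda>x. _ * x"] if_distrib [of cnj] cong: if_cong conj_cong)
  also have "\<dots> = U x m a"
    by (subst suminf_finite [of "{m}"]) auto
  finally show ?thesis .
qed

end

section \<open>Intertwiners as matrices of power series\<close>

text \<open>\<open>A\<close> has nonzero determinant since \<open>A B = q\<close>, and
  \<open>A (B A - q) = 0\<close>; a nonsingular \<open>A\<close> can be cancelled.\<close>

lemma mmul_scalar_commute:
  fixes A B :: "nat \<Rightarrow> nat \<Rightarrow> 'r::idom"
  assumes AB: "\<And>a b. a < k \<Longrightarrow> b < k \<Longrightarrow> mmul k A B a b = mscalar q a b" and "q \<noteq> 0"
    and ab: "a < k" "b < k"
  shows "mmul k B A a b = mscalar q a b"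
proof (rule ccontr)
  assume neq: "\<not> ?thesis"
  have "mdet k A * mdet k B = mdet k (mscalar q)"
    unfolding mdet_mmul [symmetric] by (intro mdet_cong AB)
  then have det: "mdet k A \<noteq> 0" using \<open>q \<noteq> 0\<close> by (auto simp: mdet_mscalar)
  let ?v = "\<lambda>a. mmul k B A a b - mscalar q a b"
  have "mapply k A ?v c = 0" if "c < k" for c
  proof -
    have "mmul k A (mmul k B A) c b = mmul k (mscalar q) A c b"
      unfolding mmul_assoc [symmetric] by (rule mmul_cong) (use AB that in auto)
    also have "\<dots> = mmul k A (mscalar q) c b"
      using that ab by (simp add: mmul_mscalar_left mmul_mscalar_right)
    finally show ?thesis
      by (simp add: mapply_def mmul_def right_diff_distrib sum_subtractf)
  qed
  with neq ab(1) have "mdet k A = 0"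
    unfolding mdet_eq_0_iff by (intro exI [of _ ?v]) auto
  with det show False ..
qed

locale shift_pair = dom: shift_model k V U + cod: shift_model l W U'
  for k V and U :: "'a::complex_hilbert_space \<Rightarrow> nat \<Rightarrow> nat \<Rightarrow> complex"
    and l W and U' :: "'b::complex_hilbert_space \<Rightarrow> nat \<Rightarrow> nat \<Rightarrow> complex"
begin

definition represents :: "(nat \<Rightarrow> nat \<Rightarrow> complex fps) \<Rightarrow> ('a \<Rightarrow> 'b) \<Rightarrow> bool" where
  "represents \<Theta> T \<longleftrightarrow> (\<forall>x. cod.crd (T x) = mapply k \<Theta> (dom.crd x))"

lemma representsD: "represents \<Theta> T \<Longrightarrow> cod.crd (T x) = mapply k \<Theta> (dom.crd x)"
  by (simp add: represents_def)

lemma mapply_e: "b < k \<Longrightarrow> mapply k A (dom.crd (dom.e b)) a = A a b"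
  using mapply_unit [of b k A a] by (simp add: dom.crd_e)

text \<open>The defect \<open>D x\<close> is linear, vanishes on the wandering subspace and commutes with the shifts, so
  \<open>D x = z D y\<close> if \<open>V y\<close> is the part of \<open>x\<close> in the range of \<open>V\<close>. Hence all its coefficients vanish.\<close>
lemma ex_represents:
  assumes T: "clinear_map T" and TV: "\<And>x. T (V x) = W (T x)"
  shows "\<exists>\<Theta>. represents \<Theta> T"
proof -
  \<comment> \<open>The columns are the images of the basis of the wandering subspace.\<close>
  define \<Theta> where "\<Theta> a b = cod.crd (T (dom.e b)) a" for a b
  define D where "D x a = cod.crd (T x) a - mapply k \<Theta> (dom.crd x) a" for x a
  have "fps_nth (D x a) n = 0" for x a n
  proof (induction n arbitrary: x rule: less_induct)
    case step: (less n)
    obtain y where y: "x = (\<Sum>b<k. U x 0 b *\<^sub>C dom.e b) + V y"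
      "\<And>a. dom.crd x a = fps_const (U x 0 a) + fps_X * dom.crd y a"
      using dom.decompose by blast
    have "cod.crd (T x) a = cod.crd (T ((\<Sum>b<k. U x 0 b *\<^sub>C dom.e b) + V y)) a"
      using y(1) by simp
    also have "\<dots> = (\<Sum>b<k. fps_const (U x 0 b) * \<Theta> a b) + fps_X * cod.crd (T y) a"
      by (simp add: clinear_mapD [OF T] TV cod.crd_add cod.crd_sum cod.crd_scaleC cod.crd_V \<Theta>_def)
    finally have "D x a = fps_X * D y a"
      unfolding D_def mapply_def y(2)
      by (simp add: algebra_simps sum.distrib sum_distrib_left)
    then show ?case
      using step [of "n - 1" y] by (simp add: fps_X_mult_nth)
  qed
  then have "D x a = 0" for x a by (simp add: fps_eq_iff)
  then show ?thesis by (intro exI [of _ \<Theta>]) (auto simp: represents_def D_def fun_eq_iff)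
qed

text \<open>A nonzero vector in the kernel of the matrix need not be square summable. But the entries of
  the matrix are multipliers of \<^term>\<open>square_summable\<close>, so there is also one with multipliers as entries.\<close>
lemma multiplier_kernel:
  assumes "represents \<Phi> X" "clinear_map X" "inj X"
  defines "M \<equiv> {f. \<forall>g\<in>square_summable. f * g \<in> square_summable}"
  assumes v: "\<And>b. b < k \<Longrightarrow> v b \<in> M" "\<And>a. a < l \<Longrightarrow> (\<Sum>b\<in>{..<k}. \<Phi> a b * v b) = 0" "b < k"
  shows "v b = 0"
proof -
  \<comment> \<open>A multiplier is square summable because its product with 1 is.\<close>
  have "v b \<in> square_summable" if "b < k" for b
    using v(1) [OF that] square_summable_1 unfolding M_def by fastforce
  then obtain x where x: "dom.crd x = (\<lambda>b. if b < k then v b else 0)"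
    using dom.ex_crd [of "\<lambda>b. if b < k then v b else 0"] by auto
  have "cod.crd (X x) a = 0" for a
  proof (cases "a < l")
    case True
    have "cod.crd (X x) a = mapply k \<Phi> (dom.crd x) a"
      using assms(1) by (simp add: representsD)
    also have "\<dots> = 0" using v(2) [OF True] by (simp add: mapply_def x)
    finally show ?thesis .
  next
    case False
    then show ?thesis by (simp add: cod.crd_outside)
  qed
  then have "cod.crd (X x) = cod.crd 0" by (auto simp: cod.crd_zero)
  then have "X x = X 0" by (simp add: cod.crd_inj clinear_mapD(3) [OF assms(2)])
  then have "x = 0" using assms(3) by (simp add: inj_eq)
  then have "dom.crd x b = 0" by (simp add: dom.crd_zero)
  with x v(3) show ?thesis by simp
qed

text \<open>Applying \<open>X\<close> to a vector whose only nonzero coordinate is \<open>g\<close>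
  at \<open>b\<close> yields the coordinates \<open>\<Phi> a b * g\<close>, which must be square
  summable again.\<close>

lemma multipliers:
  defines "M \<equiv> {f. \<forall>g\<in>square_summable. f * g \<in> square_summable}"
  shows "is_subring M" "represents \<Phi> X \<Longrightarrow> b < k \<Longrightarrow> \<Phi> a b \<in> M"
proof -
  have "f - g \<in> square_summable" if "f \<in> square_summable" "g \<in> square_summable" for f g
  proof -
    have "f - g = f + fps_const (- 1) * g" by (simp add: fps_eq_iff)
    with that show ?thesis by (simp only: square_summable_add square_summable_const)
  qed
  then show "is_subring M"
    unfolding is_subring_def M_def by (auto simp: left_diff_distrib mult.assoc)
  assume X: "represents \<Phi> X" and b: "b < k"
  show "\<Phi> a b \<in> M"
    unfolding M_def
  proof (intro CollectI ballI)
    fix g assume g: "g \<in> square_summable"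
    have "cod.crd (X (dom.single b g)) a = (\<Sum>c<k. \<Phi> a c * (if c = b then g else 0))"
      using b by (simp add: representsD [OF X] mapply_def dom.crd_single [OF g])
    also have "\<dots> = \<Phi> a b * g"
      using b by (simp add: if_distrib [of "\<lambda>x. _ * x"] cong: if_cong)
    finally show "\<Phi> a b * g \<in> square_summable" by (metis cod.crd_square_summable)
  qed
qed

text \<open>If there were more columns than rows, or a singular square matrix, the linear-system
  corollaries would give a nonzero kernel vector with multipliers as entries, contradicting
  \<open>multiplier_kernel\<close>.\<close>

lemma injective_intertwiner:
  assumes X: "represents \<Phi> X" "clinear_map X" "inj X"
  shows "k \<le> l" "k = l \<Longrightarrow> mdet k \<Phi> \<noteq> 0"
proof -
  note M = multipliers(1) and ent = multipliers(2) [OF X(1)]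
  show "k \<le> l"
  proof (rule ccontr)
    assume "\<not> k \<le> l"
    then have card: "card {..<l} < card {..<k}" by simp
    show False
      by (rule underdetermined_system [OF _ card M, of \<Phi>])
        (use multiplier_kernel [OF X] ent in auto)
  qed
  show "mdet k \<Phi> \<noteq> 0" if "k = l"
  proof
    assume "mdet k \<Phi> = 0"
    then obtain w where w: "\<exists>a<k. w a \<noteq> 0" "\<forall>a<k. mapply k \<Phi> w a = 0"
      unfolding mdet_eq_0_iff by blast
    show False
      by (rule singular_system_in_subring [of "{..<l}" "{..<k}", OF _ _ M, of \<Phi> w])
        (use multiplier_kernel [OF X] ent w that in \<open>auto simp: mapply_def\<close>)
  qed
qed

end

section \<open>Torsion of the cokernel and polynomial quotient matrices\<close>

context shift_model
begin

sublocale self: shift_pair k V U k V U ..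

text \<open>The range of \<open>S\<close> has codimension \<open>l\<close> and is invariant under
  polynomials in \<open>V\<close>. For each of the \<open>l\<close> wandering vectors of
  \<open>S\<close> some nonzero polynomial in \<open>V\<close> sends it into this range; the product
  of these polynomials works for all vectors.\<close>

lemma ex_torsion_poly:
  assumes "shift_model l S U2" and comm: "\<And>x. S (V x) = V (S x)"
  shows "\<exists>q. q \<noteq> 0 \<and> (\<forall>x. \<exists>y. crd (S y) = (\<lambda>a. fps_of_poly q * crd x a))"
proof -
  interpret S: shift_model l S U2 by fact
  obtain \<Theta> where \<Theta>: "self.represents \<Theta> S"
    using self.ex_represents [OF S.V_clinear comm] by blast
  define R where "R = {f. \<exists>y. crd (S y) = f}"
  have R_crd: "crd (S y) \<in> R" for y by (auto simp: R_def)
  have R_add: "(\<lambda>a. f a + g a) \<in> R" if "f \<in> R" "g \<in> R" for f g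
  proof -
    from that obtain y z where "f = crd (S y)" "g = crd (S z)" by (auto simp: R_def)
    then have "(\<lambda>a. f a + g a) = crd (S (y + z))"
      by (simp add: clinear_mapD(1) [OF S.V_clinear] crd_add)
    then show ?thesis using R_crd by simp
  qed
  have R_poly: "(\<lambda>a. fps_of_poly p * f a) \<in> R" if "f \<in> R" for p f
  proof -
    from that obtain y where y: "f = crd (S y)" by (auto simp: R_def)
    obtain y' where "crd y' = (\<lambda>a. fps_of_poly p * crd y a)" using ex_crd_poly by blast
    then have "crd (S y') = (\<lambda>a. fps_of_poly p * f a)"
      by (simp add: y self.representsD [OF \<Theta>] mapply_scale)
    then show ?thesis by (metis R_crd)
  qed
  have R_0: "(\<lambda>a. 0) \<in> R"
    using R_crd [of 0] by (simp add: clinear_mapD(3) [OF S.V_clinear] crd_zero)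
  have R_sum: "(\<lambda>a. \<Sum>i\<in>I. f i a) \<in> R" if "\<And>i. i \<in> I \<Longrightarrow> f i \<in> R" for I and f :: "nat \<Rightarrow> nat \<Rightarrow> complex fps"
    using that by (induction I rule: infinite_finite_induct) (auto simp: R_0 R_add)
  have "\<exists>p. p \<noteq> 0 \<and> (\<lambda>a. fps_of_poly p * crd (S.e j) a) \<in> R" for j
  proof -
    \<comment> \<open>The \<open>l + 1\<close> vectors \<open>(V ^^ m) (S.e j)\<close> are dependent
      modulo the range of \<open>S\<close>: there are \<open>l\<close> conditions on
      \<open>l + 1\<close> coefficients.\<close>
    have "is_subring (UNIV :: complex set)" by (simp add: is_subring_def)
    then obtain v where v: "\<exists>m\<in>{..l}. v m \<noteq> 0"
      "\<And>i. i \<in> {..<l} \<Longrightarrow> (\<Sum>m\<in>{..l}. U2 ((V ^^ m) (S.e j)) 0 i * v m) = 0"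
      using underdetermined_system [of "{..<l}" "{..l}" UNIV "\<lambda>i m. U2 ((V ^^ m) (S.e j)) 0 i"] by auto
    define z where "z = (\<Sum>m\<in>{..l}. v m *\<^sub>C (V ^^ m) (S.e j))"
    define p where "p = (\<Sum>m\<in>{..l}. monom (v m) m)"
    have "U2 z 0 i = (\<Sum>m\<in>{..l}. U2 ((V ^^ m) (S.e j)) 0 i * v m)" for i
    proof -
      have "U2 z 0 i = fps_nth (S.crd z i) 0" by simp
      then show ?thesis
        unfolding z_def S.crd_sum S.crd_scaleC by (simp add: fps_sum_nth mult.commute)
    qed
    then have "z \<in> range S" using v(2) by (simp add: S.range_V_iff)
    moreover have "crd z = (\<lambda>a. fps_of_poly p * crd (S.e j) a)"
      by (simp add: z_def p_def crd_sum crd_scaleC crd_funpow fps_of_poly_sum fps_of_poly_monom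
          sum_distrib_right mult.assoc)
    moreover have "p \<noteq> 0"
    proof -
      from v(1) obtain m where "m \<le> l" "v m \<noteq> 0" by auto
      then have "coeff p m \<noteq> 0" by (simp add: p_def coeff_sum)
      then show ?thesis by auto
    qed
    ultimately show ?thesis by (metis R_crd rangeE)
  qed
  then obtain p where p: "\<And>j. p j \<noteq> 0" "\<And>j. (\<lambda>a. fps_of_poly (p j) * crd (S.e j) a) \<in> R"
    by metis
  define q where "q = (\<Prod>j<l. p j)"
  have "(\<lambda>a. fps_of_poly q * crd x a) \<in> R" for x
  proof -
    obtain y where y: "x = (\<Sum>j<l. U2 x 0 j *\<^sub>C S.e j) + S y" using S.decompose by blast
    have "(\<lambda>a. fps_of_poly q * (fps_const (U2 x 0 j) * crd (S.e j) a)) \<in> R" if "j < l" for j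
    proof -
      have "q = p j * (\<Prod>i\<in>{..<l} - {j}. p i)"
        unfolding q_def using that by (intro prod.remove) auto
      then have "fps_of_poly q * (fps_const (U2 x 0 j) * crd (S.e j) a) =
          fps_of_poly ([:U2 x 0 j:] * (\<Prod>i\<in>{..<l} - {j}. p i)) * (fps_of_poly (p j) * crd (S.e j) a)" for a
        unfolding fps_of_poly_mult fps_of_poly_const by (simp add: fps_of_poly_mult ac_simps)
      then show ?thesis by (simp only: R_poly [OF p(2)])
    qed
    then have "(\<lambda>a. \<Sum>j<l. fps_of_poly q * (fps_const (U2 x 0 j) * crd (S.e j) a)) \<in> R"
      using R_sum [of "{..<l}" "\<lambda>j a. fps_of_poly q * (fps_const (U2 x 0 j) * crd (S.e j) a)"] by simp
    moreover have "(\<lambda>a. fps_of_poly q * crd (S y) a) \<in> R" by (rule R_poly [OF R_crd])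
    ultimately have "(\<lambda>a. (\<Sum>j<l. fps_of_poly q * (fps_const (U2 x 0 j) * crd (S.e j) a)) +
        fps_of_poly q * crd (S y) a) \<in> R" by (rule R_add)
    moreover have "crd x = crd ((\<Sum>j<l. U2 x 0 j *\<^sub>C S.e j) + S y)" using y by simp
    ultimately show ?thesis
      by (simp add: crd_add crd_sum crd_scaleC distrib_left sum_distrib_left)
  qed
  moreover have "q \<noteq> 0" unfolding q_def using p(1) by simp
  ultimately show ?thesis unfolding R_def by blast
qed

lemma torsion_poly_mult:
  assumes "clinear_map S" "\<And>x. S (V x) = V (S x)"
    and "\<forall>x. \<exists>y. crd (S y) = (\<lambda>a. fps_of_poly q * crd x a)"
  shows "\<forall>x. \<exists>y. crd (S y) = (\<lambda>a. fps_of_poly (q * p) * crd x a)"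
proof
  fix x
  obtain x' where x': "crd x' = (\<lambda>a. fps_of_poly p * crd x a)" using ex_crd_poly by blast
  with assms(3) obtain y where "crd (S y) = (\<lambda>a. fps_of_poly q * crd x' a)" by blast
  then have "crd (S y) = (\<lambda>a. fps_of_poly (q * p) * crd x a)"
    by (simp add: x' fps_of_poly_mult mult.assoc)
  then show "\<exists>y. crd (S y) = (\<lambda>a. fps_of_poly (q * p) * crd x a)" ..
qed

text \<open>As \<open>S\<close> is an isometry, the vectors \<open>t b\<close> with
  \<open>S (t b) = q(V) e b\<close> are the images of the \<open>e b\<close> under the adjoint of
  \<open>S\<close> times \<open>q(V)\<close>. They are polynomial of degree at most that of
  \<open>q\<close>, so they form a polynomial matrix \<open>T\<close>, formally \<open>q\<close>
  times the inverse of \<open>\<Theta>\<close>.\<close>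

lemma ex_quotient_matrix:
  assumes S: "isometry S" and comm: "\<And>x. S (V x) = V (S x)" and \<Theta>: "self.represents \<Theta> S"
    and q: "q \<noteq> 0" "\<forall>x. \<exists>y. crd (S y) = (\<lambda>a. fps_of_poly q * crd x a)"
  shows "\<exists>T. \<forall>a<k. \<forall>b<k. mmul k \<Theta> (\<lambda>a b. fps_of_poly (T a b)) a b = mscalar (fps_of_poly q) a b \<and>
    mmul k (\<lambda>a b. fps_of_poly (T a b)) \<Theta> a b = mscalar (fps_of_poly q) a b"
proof -
  from q(2) have "\<forall>b. \<exists>y. crd (S y) = (\<lambda>a. fps_of_poly q * crd (e b) a)" by blast
  then obtain t where t: "\<And>b. crd (S (t b)) = (\<lambda>a. fps_of_poly q * crd (e b) a)" by metis
  define T where "T a b = (\<Sum>m\<le>degree q. monom (U (t b) m a) m)" for a b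
  \<comment> \<open>Applying the isometry \<open>S\<close> to both arguments compares
    \<open>q(V) e b\<close>, which ends at degree \<open>degree q\<close>, with a vector that starts
    at degree \<open>m\<close>; for larger \<open>m\<close> the supports are disjoint.\<close>
  have zero: "U (t b) m a = 0" if "a < k" "m > degree q" for a b m
  proof -
    have comm': "S ((V ^^ m) x) = (V ^^ m) (S x)" for x
      by (induction m) (simp_all add: comm)
    have "U (t b) m a = cinner (t b) ((V ^^ m) (e a))"
      by (simp add: cinner_monomial [OF that(1)])
    also have "\<dots> = cinner (S (t b)) ((V ^^ m) (S (e a)))"
      using isometry_cinner [OF S, of "t b" "(V ^^ m) (e a)"] by (simp add: comm')
    also have "\<dots> = (\<Sum>n. \<Sum>j<k. U (S (t b)) n j * cnj (U ((V ^^ m) (S (e a))) n j))"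
      by (rule cinner_U)
    also have "\<dots> = (\<Sum>n. 0)"
    proof (intro arg_cong [where f = suminf] ext sum.neutral ballI)
      fix n j
      have "U (S (t b)) n j = fps_nth (fps_of_poly q * crd (e b) j) n"
        using crd_nth [of "S (t b)" j n] unfolding t by simp
      moreover have "fps_nth (fps_of_poly q * crd (e b) j) n = 0" if "n > degree q"
        using that by (simp add: crd_e coeff_eq_0)
      moreover have "U ((V ^^ m) (S (e a))) n j = fps_nth (fps_X ^ m * crd (S (e a)) j) n"
        using crd_nth [of "(V ^^ m) (S (e a))" j n] unfolding crd_funpow by simp
      moreover have "fps_nth (fps_X ^ m * crd (S (e a)) j) n = 0" if "n < m"
        using that by (simp add: fps_X_power_mult_nth del: crd_nth)
      ultimately show "U (S (t b)) n j * cnj (U ((V ^^ m) (S (e a))) n j) = 0"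
        using that(2) by (cases "n < m") auto
    qed
    finally show ?thesis by simp
  qed
  have T: "fps_of_poly (T a b) = crd (t b) a" if "a < k" for a b
    using zero [OF that] by (intro fps_ext) (auto simp: T_def coeff_sum)
  have "mmul k \<Theta> (\<lambda>a b. fps_of_poly (T a b)) a b = mscalar (fps_of_poly q) a b" if "a < k" "b < k" for a b
  proof -
    have "mmul k \<Theta> (\<lambda>a b. fps_of_poly (T a b)) a b = mapply k \<Theta> (crd (t b)) a"
      by (simp add: mmul_def mapply_def T)
    also have "\<dots> = fps_of_poly q * crd (e b) a"
      by (simp flip: self.representsD [OF \<Theta>] add: t)
    finally show ?thesis using that by (simp add: crd_e mscalar_def)
  qed
  moreover from this have "mmul k (\<lambda>a b. fps_of_poly (T a b)) \<Theta> a b = mscalar (fps_of_poly q) a b"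
    if "a < k" "b < k" for a b
    by (rule mmul_scalar_commute) (use q(1) that in auto)
  ultimately show ?thesis by blast
qed

end

section \<open>Operators of matrix polynomials\<close>

lemma is_subring_fps_of_poly: "is_subring (range (fps_of_poly :: 'a::comm_ring_1 poly \<Rightarrow> _))"
  unfolding is_subring_def
  by (auto simp flip: fps_of_poly_mult fps_of_poly_diff)

text \<open>The intertwining relations are linear equations with polynomial coefficients for the
  entries. Up to the factor \<open>q\<close>, the given \<open>\<Phi>\<close> is a combination of
  polynomial solutions with power series as coefficients; \<open>mdet_combination\<close> exchanges
  these coefficients for constants while the determinant stays nonzero.\<close>

lemma ex_polynomial_intertwiner:
  fixes \<Phi> :: "nat \<Rightarrow> nat \<Rightarrow> complex fps" and T R :: "'i \<Rightarrow> nat \<Rightarrow> nat \<Rightarrow> complex poly"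
  defines "P \<equiv> \<lambda>A a b. fps_of_poly (A a b)"
  assumes "finite I"
    and \<Phi>: "\<And>i a b. i \<in> I \<Longrightarrow> a < k \<Longrightarrow> b < k \<Longrightarrow> mmul k \<Phi> (P (T i)) a b = mmul k (P (R i)) \<Phi> a b"
    and det: "mdet k \<Phi> \<noteq> 0"
  shows "\<exists>\<Phi>'. mdet k \<Phi>' \<noteq> 0 \<and>
    (\<forall>i\<in>I. \<forall>a<k. \<forall>b<k. mmul k (P \<Phi>') (P (T i)) a b = mmul k (P (R i)) (P \<Phi>') a b)"
proof -
  define Eq where "Eq = I \<times> {..<k} \<times> {..<k}"
  define J where "J = {..<k} \<times> {..<k}"
  \<comment> \<open>Coefficient of the unknown entry \<open>(c, d)\<close> in the equation at
    position \<open>(a, b)\<close> of the relation for \<open>i\<close>.\<close>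
  define A where "A u p = (case u of (i, a, b) \<Rightarrow> case p of (c, d) \<Rightarrow>
    (if c = a then P (T i) d b else 0) - (if d = b then P (R i) a c else 0))" for u p
  have A: "(\<Sum>p\<in>J. A (i, a, b) p * v p) =
      mmul k (\<lambda>c d. v (c, d)) (P (T i)) a b - mmul k (P (R i)) (\<lambda>c d. v (c, d)) a b"
    if "a < k" "b < k" for i a b v
  proof -
    have "(\<Sum>p\<in>J. A (i, a, b) p * v p) = (\<Sum>c<k. \<Sum>d<k. A (i, a, b) (c, d) * v (c, d))"
      by (simp add: J_def sum.cartesian_product)
    also have "\<dots> = (\<Sum>c<k. \<Sum>d<k. if c = a then P (T i) d b * v (c, d) else 0) -
        (\<Sum>c<k. \<Sum>d<k. if d = b then P (R i) a c * v (c, d) else 0)"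
      unfolding sum_subtractf [symmetric]
      by (intro sum.cong refl) (auto simp: A_def left_diff_distrib)
    also have "(\<Sum>c<k. \<Sum>d<k. if c = a then P (T i) d b * v (c, d) else 0) =
        (\<Sum>c<k. if c = a then \<Sum>d<k. P (T i) d b * v (c, d) else 0)"
      by (intro sum.cong refl) auto
    finally show ?thesis
      using that by (simp add: mmul_def mult.commute)
  qed
  have M: "is_subring (range (fps_of_poly :: complex poly \<Rightarrow> _))" by (rule is_subring_fps_of_poly)
  have A_M: "\<forall>u\<in>Eq. \<forall>p\<in>J. A u p \<in> range fps_of_poly"
    using subring_0 [OF M] subring_diff [OF M]
    unfolding A_def P_def by (auto split: prod.splits intro!: subring_diff [OF M])
  have "finite Eq" "finite J" using \<open>finite I\<close> by (auto simp: Eq_def J_def)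
  from linear_system_solutions [OF this M A_M]
  obtain q S s where "q \<noteq> 0" and S: "S \<subseteq> J"
    and s: "\<forall>t\<in>S. s t t \<noteq> 0 \<and> (\<forall>p\<in>J. s t p \<in> range fps_of_poly) \<and>
      (\<forall>u\<in>Eq. (\<Sum>p\<in>J. A u p * s t p) = 0)"
    and gen: "\<forall>v. (\<forall>u\<in>Eq. (\<Sum>p\<in>J. A u p * v p) = 0) \<longrightarrow>
      (\<exists>f. \<forall>p\<in>J. q * v p = (\<Sum>t\<in>S. f t * s t p))"
    by (elim exE conjE) (rule that)
  have "\<forall>u\<in>Eq. (\<Sum>p\<in>J. A u p * (case p of (c, d) \<Rightarrow> \<Phi> c d)) = 0"
    using \<Phi> by (auto simp: Eq_def A)
  then obtain f where f: "\<forall>p\<in>J. q * (case p of (c, d) \<Rightarrow> \<Phi> c d) = (\<Sum>t\<in>S. f t * s t p)"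
    using gen [rule_format, of "\<lambda>p. case p of (c, d) \<Rightarrow> \<Phi> c d"] by blast
  have "finite S" using S \<open>finite J\<close> by (rule finite_subset)
  \<comment> \<open>Constants are polynomials and there are infinitely many of them, as the
    determinant argument requires.\<close>
  moreover have "infinite (range (fps_const :: complex \<Rightarrow> _))"
    by (simp add: finite_image_iff inj_on_def infinite_UNIV_char_0)
  moreover have "mdet k (\<lambda>a b. 0 + (\<Sum>t\<in>S. f t * s t (a, b))) \<noteq> 0"
  proof -
    have "mdet k (\<lambda>a b. 0 + (\<Sum>t\<in>S. f t * s t (a, b))) = mdet k (\<lambda>a b. q * \<Phi> a b)"
      using f by (intro mdet_cong) (auto simp: J_def)
    then show ?thesis using det \<open>q \<noteq> 0\<close> by (simp add: mdet_scale)
  qed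
  ultimately obtain c where c: "\<forall>t\<in>S. c t \<in> range fps_const"
    and det_c: "mdet k (\<lambda>a b. 0 + (\<Sum>t\<in>S. c t * s t (a, b))) \<noteq> 0"
    using mdet_combination [of S "range (fps_const :: complex \<Rightarrow> _)" k "\<lambda>a b. 0" f "\<lambda>t a b. s t (a, b)"]
    by blast
  define B where "B p = (\<Sum>t\<in>S. c t * s t p)" for p
  have "B p \<in> range fps_of_poly" if "p \<in> J" for p
    unfolding B_def
  proof (intro subring_sum [OF M] subring_mult [OF M])
    fix t assume "t \<in> S"
    then show "c t \<in> range fps_of_poly" "s t p \<in> range fps_of_poly"
      using c s that by (auto simp flip: fps_of_poly_const)
  qed
  then have "\<forall>p\<in>J. \<exists>r. B p = fps_of_poly r" by blast
  then obtain r where r: "\<And>p. p \<in> J \<Longrightarrow> B p = fps_of_poly (r p)" by metis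
  define \<Phi>' where "\<Phi>' a b = r (a, b)" for a b
  have P\<Phi>': "P \<Phi>' a b = B (a, b)" if "a < k" "b < k" for a b
    using that r by (simp add: P_def \<Phi>'_def J_def)
  have "fps_of_poly (mdet k \<Phi>') = mdet k (P \<Phi>')"
    unfolding P_def by (rule mdet_hom [OF comm_ring_hom_fps_of_poly, symmetric])
  also have "\<dots> = mdet k (\<lambda>a b. 0 + (\<Sum>t\<in>S. c t * s t (a, b)))"
    by (rule mdet_cong) (simp add: P\<Phi>' B_def)
  finally have "mdet k \<Phi>' \<noteq> 0" using det_c by auto
  moreover have "mmul k (P \<Phi>') (P (T i)) a b = mmul k (P (R i)) (P \<Phi>') a b"
    if "i \<in> I" "a < k" "b < k" for i a b
  proof -
    have "(\<Sum>p\<in>J. A (i, a, b) p * B p) = (\<Sum>t\<in>S. c t * (\<Sum>p\<in>J. A (i, a, b) p * s t p))"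
      unfolding B_def sum_distrib_left by (subst sum.swap) (simp add: ac_simps)
    also have "\<dots> = 0" using s that by (intro sum.neutral) (auto simp: Eq_def)
    finally have "mmul k (\<lambda>c d. B (c, d)) (P (T i)) a b = mmul k (P (R i)) (\<lambda>c d. B (c, d)) a b"
      using that by (simp add: A)
    moreover have "mmul k (P \<Phi>') (P (T i)) a b = mmul k (\<lambda>c d. B (c, d)) (P (T i)) a b"
      "mmul k (P (R i)) (P \<Phi>') a b = mmul k (P (R i)) (\<lambda>c d. B (c, d)) a b"
      using that P\<Phi>' by (auto intro: mmul_cong)
    ultimately show ?thesis by simp
  qed
  ultimately show ?thesis by blast
qed

section \<open>The complex inner product and its norm\<close>

lemma cinner_add_right: "cinner x (y + z) = cinner x y + cinner x z"
  by (subst (1 2 3) cinner_commute) (simp add: cinner_add_left)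

lemma cinner_scaleC_right: "cinner x (c *\<^sub>C y) = cnj c * cinner x y"
  by (subst (1 2) cinner_commute) (simp add: cinner_scaleC_left)

lemma cinner_zero_left: "cinner 0 y = 0"
  using cinner_add_left [of 0 0 y] by simp

lemma cinner_zero_right: "cinner y 0 = 0"
  using cinner_add_right [of y 0 0] by simp

lemma cinner_diff_left: "cinner (x - y) z = cinner x z - cinner y z"
  using cinner_add_left [of "x - y" y z] by simp

lemma cinner_sum_left: "cinner (sum f I) y = (\<Sum>i\<in>I. cinner (f i) y)"
  by (induction I rule: infinite_finite_induct) (auto simp: cinner_zero_left cinner_add_left)

lemma cinner_sum_right: "cinner y (sum f I) = (\<Sum>i\<in>I. cinner y (f i))"
  by (induction I rule: infinite_finite_induct) (auto simp: cinner_zero_right cinner_add_right)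

lemma cinner_self: "cinner x x = complex_of_real ((norm x)\<^sup>2)"
proof -
  have "cinner x x = cnj (cinner x x)" by (rule cinner_commute)
  then have "Im (cinner x x) = 0" by (metis Reals_cnj_iff complex_is_Real_iff)
  then show ?thesis
    by (simp add: complex_eq_iff power2_norm_eq_inner inner_eq_Re_cinner del: of_real_power)
qed

lemma norm_scaleC: "norm (c *\<^sub>C x) = cmod c * norm x"
proof -
  have "complex_of_real ((norm (c *\<^sub>C x))\<^sup>2) = complex_of_real ((cmod c * norm x)\<^sup>2)"
    unfolding cinner_self [symmetric] power_mult_distrib of_real_mult
    by (simp only: cinner_scaleC_left cinner_scaleC_right mult.assoc [symmetric] complex_norm_square)
      (simp add: cinner_self)
  then have "(norm (c *\<^sub>C x))\<^sup>2 = (cmod c * norm x)\<^sup>2" by (simp only: of_real_eq_iff)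
  then show ?thesis by (rule power2_eq_imp_eq) auto
qed

context shift_model
begin

lemma U_single: "f \<in> square_summable \<Longrightarrow> U (single b f) m j = (if j = b \<and> b < k then fps_nth f m else 0)"
  using crd_nth [of "single b f" j m] by (auto simp: crd_single simp del: crd_nth split: if_splits)

lemma norm_funpow: "norm ((V ^^ n) x) = norm x"
  by (induction n) (auto simp: norm_V)

lemma cinner_funpow: "cinner ((V ^^ n) x) ((V ^^ n) y) = cinner x y"
  by (induction n) (auto simp: isometry_cinner [OF isometry])

lemma single_funpow:
  "f \<in> square_summable \<Longrightarrow> (V ^^ n) (single b f) = single b (fps_X ^ n * f)"
proof (rule crd_inj)
  assume f: "f \<in> square_summable"
  then have "fps_X ^ n * f \<in> square_summable"
    by (induction n) (auto simp: mult.assoc square_summable_X)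
  then show "crd ((V ^^ n) (single b f)) = crd (single b (fps_X ^ n * f))"
    by (auto simp: crd_funpow crd_single f fun_eq_iff)
qed

end

section \<open>Bounded operators built from matrix units and powers of the shift\<close>

context shift_pair
begin

definition unit_op :: "nat \<Rightarrow> nat \<Rightarrow> 'a \<Rightarrow> 'b" where
  "unit_op a b x = cod.single a (dom.crd x b)"

lemma crd_unit_op: "cod.crd (unit_op a b x) = (\<lambda>c. if c = a \<and> a < l then dom.crd x b else 0)"
  by (simp add: unit_op_def cod.crd_single dom.crd_square_summable)

lemma U_unit_op: "U' (unit_op a b x) m j = (if j = a \<and> a < l then U x m b else 0)"
  by (simp add: unit_op_def cod.U_single dom.crd_square_summable)

lemma cinner_unit_op:
  assumes "a < l" "b < k"
  shows "cinner y (unit_op a b x) = (\<Sum>m. U' y m a * cnj (U x m b))"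
  unfolding cod.cinner_U U_unit_op using assms
  by (simp add: if_distrib [of cnj] if_distrib [of "\<lambda>x. _ * x"] cong: if_cong)

lemma norm_unit_op:
  assumes "a < l" "b < k"
  shows "norm (unit_op a b x) \<le> norm x"
proof -
  have sum: "summable (\<lambda>m. (cmod (U x m b))\<^sup>2)"
    using dom.crd_square_summable [of x b] by (simp add: square_summable_def)
  have ell: "summable (\<lambda>m. \<Sum>j<k. (cmod (U x m j))\<^sup>2)"
    using dom.U_ell2 [of x] by (auto simp: ell2_tensor_def)
  have "complex_of_real ((norm (unit_op a b x))\<^sup>2) = (\<Sum>m. complex_of_real ((cmod (U x m b))\<^sup>2))"
    unfolding cinner_self [symmetric] cinner_unit_op [OF assms] U_unit_op
    using assms by (simp only: complex_norm_square) simp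
  also have "\<dots> = complex_of_real (\<Sum>m. (cmod (U x m b))\<^sup>2)"
    by (rule suminf_of_real [symmetric]) (rule sum)
  finally have 1: "(norm (unit_op a b x))\<^sup>2 = (\<Sum>m. (cmod (U x m b))\<^sup>2)"
    by (simp only: of_real_eq_iff)
  have "complex_of_real ((norm x)\<^sup>2) = (\<Sum>m. complex_of_real (\<Sum>j<k. (cmod (U x m j))\<^sup>2))"
    unfolding cinner_self [symmetric] dom.cinner_U of_real_sum by (simp only: complex_norm_square)
  also have "\<dots> = complex_of_real (\<Sum>m. \<Sum>j<k. (cmod (U x m j))\<^sup>2)"
    by (rule suminf_of_real [symmetric]) (rule ell)
  finally have 2: "(norm x)\<^sup>2 = (\<Sum>m. \<Sum>j<k. (cmod (U x m j))\<^sup>2)"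
    by (simp only: of_real_eq_iff)
  have "(\<Sum>m. (cmod (U x m b))\<^sup>2) \<le> (\<Sum>m. \<Sum>j<k. (cmod (U x m j))\<^sup>2)"
    using assms by (intro suminf_le sum ell) (auto intro!: member_le_sum)
  then show ?thesis using 1 2 by (auto intro: power2_le_imp_le)
qed

text \<open>The operator of multiplication by \<open>\<Phi>\<close>, provided \<open>d\<close>
  bounds the degrees; coefficients beyond \<open>d\<close> are cut off. As a finite combination of
  contractions it is bounded.\<close>

definition poly_op :: "nat \<Rightarrow> (nat \<Rightarrow> nat \<Rightarrow> complex poly) \<Rightarrow> 'a \<Rightarrow> 'b" where
  "poly_op d \<Phi> x = (\<Sum>a<l. \<Sum>b<k. \<Sum>m\<le>d. coeff (\<Phi> a b) m *\<^sub>C (W ^^ m) (unit_op a b x))"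

text \<open>Rows from \<open>l\<close> on are set to zero because \<open>\<Phi>\<close> is arbitrary
  there, while coordinates in the target space vanish.\<close>

lemma represents_poly_op:
  assumes "\<And>a b. a < l \<Longrightarrow> b < k \<Longrightarrow> degree (\<Phi> a b) \<le> d"
  shows "represents (\<lambda>a b. if a < l then fps_of_poly (\<Phi> a b) else 0) (poly_op d \<Phi>)"
  unfolding represents_def
proof (intro allI ext)
  fix x c
  have poly: "fps_of_poly (\<Phi> a b) = (\<Sum>m\<le>d. fps_const (coeff (\<Phi> a b) m) * fps_X ^ m)"
    if "a < l" "b < k" for a b
    unfolding fps_of_poly_monom [symmetric] fps_of_poly_sum [symmetric]
    by (rule arg_cong [where f = fps_of_poly], rule poly_as_sum_of_monoms' [symmetric]) (use assms that in auto)
  have "cod.crd (poly_op d \<Phi> x) c = (\<Sum>a<l. \<Sum>b<k. \<Sum>m\<le>d.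
      fps_const (coeff (\<Phi> a b) m) * (fps_X ^ m * (if c = a then dom.crd x b else 0)))"
    unfolding poly_op_def cod.crd_sum cod.crd_scaleC cod.crd_funpow crd_unit_op
    by (intro sum.cong refl) auto
  also have "\<dots> = (\<Sum>a<l. if c = a then \<Sum>b<k. fps_of_poly (\<Phi> a b) * dom.crd x b else 0)"
    by (intro sum.cong refl) (auto simp: poly sum_distrib_right mult.assoc)
  also have "\<dots> = mapply k (\<lambda>a b. if a < l then fps_of_poly (\<Phi> a b) else 0) (dom.crd x) c"
    by (simp add: mapply_def)
  finally show "cod.crd (poly_op d \<Phi> x) c = mapply k (\<lambda>a b. if a < l then fps_of_poly (\<Phi> a b) else 0) (dom.crd x) c" .
qed

lemma represents_clinear_map:
  assumes "represents \<Theta> T"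
  shows "clinear_map T" "T (V x) = W (T x)"
proof -
  have "cod.crd (T (x + y)) = cod.crd (T x + T y)" "cod.crd (T (c *\<^sub>C x)) = cod.crd (c *\<^sub>C T x)"
    "cod.crd (T (V x)) = cod.crd (W (T x))" for x y c
    by (simp_all add: representsD [OF assms] dom.crd_add dom.crd_scaleC dom.crd_V cod.crd_add
        cod.crd_scaleC cod.crd_V mapply_add mapply_scale)
  then show "clinear_map T" "T (V x) = W (T x)"
    using cod.crd_inj by (auto simp: clinear_map_def)
qed

lemma bounded_clinear_poly_op:
  assumes "\<And>a b. a < l \<Longrightarrow> b < k \<Longrightarrow> degree (\<Phi> a b) \<le> d"
  shows "bounded_clinear (poly_op d \<Phi>)"
proof -
  note lin = represents_clinear_map(1) [OF represents_poly_op [OF assms]]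
  have "norm (poly_op d \<Phi> x) \<le> norm x * (\<Sum>a<l. \<Sum>b<k. \<Sum>m\<le>d. cmod (coeff (\<Phi> a b) m))" for x
    unfolding poly_op_def sum_distrib_left
    by (intro sum_norm_le) (auto simp: norm_scaleC cod.norm_funpow mult.commute [of "norm x"] intro!: mult_left_mono norm_unit_op)
  moreover have "poly_op d \<Phi> (r *\<^sub>R x) = r *\<^sub>R poly_op d \<Phi> x" for r x
    by (simp add: scaleR_scaleC clinear_mapD(2) [OF lin])
  ultimately have "bounded_linear (poly_op d \<Phi>)"
    by (intro bounded_linear_intro) (auto simp: clinear_mapD(1) [OF lin])
  then show ?thesis by (simp add: bounded_clinear_def clinear_mapD(2) [OF lin])
qed

end

text \<open>For degrees at most \<open>d\<close> this is \<open>z^d\<close> times the adjoint of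
  \<open>\<Phi> (1 / cnj z)\<close>: transpose, conjugate and reverse the coefficients.\<close>

definition reflect_mat :: "nat \<Rightarrow> (nat \<Rightarrow> nat \<Rightarrow> complex poly) \<Rightarrow> nat \<Rightarrow> nat \<Rightarrow> complex poly" where
  "reflect_mat d \<Phi> a b = (\<Sum>m\<le>d. monom (cnj (coeff (\<Phi> b a) (d - m))) m)"

lemma coeff_reflect_mat: "coeff (reflect_mat d \<Phi> a b) m = (if m \<le> d then cnj (coeff (\<Phi> b a) (d - m)) else 0)"
  by (auto simp: reflect_mat_def coeff_sum)

lemma degree_reflect_mat: "degree (reflect_mat d \<Phi> a b) \<le> d"
  by (rule degree_le) (simp add: coeff_reflect_mat)

lemma reflected_reflect_mat:
  assumes "\<And>a b. a < k \<Longrightarrow> b < k \<Longrightarrow> degree (\<Phi> a b) \<le> d"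
  shows "reflected k d \<Phi> (reflect_mat d \<Phi>)"
  unfolding reflected_def
proof (intro allI impI)
  fix z :: complex and a b assume z: "cmod z = 1" and ab: "a < k" "b < k"
  have "poly (reflect_mat d \<Phi> a b) z = (\<Sum>m\<le>d. cnj (coeff (\<Phi> b a) (d - m)) * z ^ m)"
    by (simp add: reflect_mat_def poly_sum poly_monom)
  also have "\<dots> = (\<Sum>m\<le>d. cnj (coeff (\<Phi> b a) m) * z ^ (d - m))"
    by (rule sum.reindex_bij_witness [of _ "\<lambda>m. d - m" "\<lambda>m. d - m"]) auto
  also have "\<dots> = (\<Sum>m\<le>d. z ^ d * cnj (coeff (\<Phi> b a) m * z ^ m))"
  proof (rule sum.cong)
    fix m assume "m \<in> {..d}"
    then have "z ^ d = z ^ (d - m) * z ^ m" by (simp flip: power_add)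
    then have "z ^ d * cnj z ^ m = z ^ (d - m) * (z ^ m * cnj z ^ m)" by simp
    then show "cnj (coeff (\<Phi> b a) m) * z ^ (d - m) = z ^ d * cnj (coeff (\<Phi> b a) m * z ^ m)"
      by (simp add: power_cnj_cancel [OF z])
  qed simp
  also have "\<dots> = z ^ d * cnj (poly (\<Phi> b a) z)"
  proof -
    have "poly (\<Phi> b a) z = (\<Sum>m\<le>d. coeff (\<Phi> b a) m * z ^ m)"
      by (subst poly_as_sum_of_monoms' [OF assms [OF ab(2,1)], symmetric]) (simp add: poly_sum poly_monom)
    then show ?thesis by (simp add: sum_distrib_left)
  qed
  finally show "poly (reflect_mat d \<Phi> a b) z = z ^ d * cnj (poly (\<Phi> b a) z)" .
qed

section \<open>Intertwining relations and adjoints of polynomial operators\<close>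

context shift_pair
begin

lemma unit_op_funpow: "(W ^^ n) (unit_op a b x) = unit_op a b ((V ^^ n) x)"
  by (simp add: unit_op_def cod.single_funpow dom.crd_square_summable dom.crd_funpow)

text \<open>Evaluation at the wandering vectors \<open>e b\<close> reads off the columns of both
  products; conversely the coordinates outside the block vanish.\<close>

lemma represents_commute_iff:
  assumes "dom.self.represents \<Theta> S" "represents \<Phi> X" "cod.self.represents \<Omega> Z"
  shows "(\<forall>x. X (S x) = Z (X x)) \<longleftrightarrow> (\<forall>a<l. \<forall>b<k. mmul k \<Phi> \<Theta> a b = mmul l \<Omega> \<Phi> a b)"
proof -
  have XS: "cod.crd (X (S x)) = mapply k (mmul k \<Phi> \<Theta>) (dom.crd x)" for x
    by (simp add: representsD [OF assms(2)] dom.self.representsD [OF assms(1)] mapply_mmul)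
  have ZX: "cod.crd (Z (X x)) = mapply k (mmul l \<Omega> \<Phi>) (dom.crd x)" for x
    by (simp add: representsD [OF assms(2)] cod.self.representsD [OF assms(3)] mapply_mmul)
  show ?thesis
  proof (intro iffI allI impI)
    fix a b assume "\<forall>x. X (S x) = Z (X x)" "b < k"
    then show "mmul k \<Phi> \<Theta> a b = mmul l \<Omega> \<Phi> a b"
      using XS [of "dom.e b"] ZX [of "dom.e b"] by (metis mapply_e)
  next
    fix x assume eq: "\<forall>a<l. \<forall>b<k. mmul k \<Phi> \<Theta> a b = mmul l \<Omega> \<Phi> a b"
    have "cod.crd (X (S x)) a = cod.crd (Z (X x)) a" for a
    proof (cases "a < l")
      case True
      then show ?thesis unfolding XS ZX using eq by (simp add: mapply_def)
    next
      case False
      then show ?thesis by (simp add: cod.crd_outside)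
    qed
    then show "X (S x) = Z (X x)" by (intro cod.crd_inj) auto
  qed
qed

end

text \<open>On the circle the reflected matrix is \<open>z\<^sup>d \<Phi>\<^sup>*\<close>, so its operator is \<open>X\<^sup>* W\<^sup>d\<close>, where \<open>X\<close> is the
  operator of \<open>\<Phi>\<close>.\<close>
lemma cinner_poly_op_reflect_mat:
  assumes "shift_pair k V U l W U'"
  shows "cinner (shift_pair.poly_op l U' k V U d (reflect_mat d \<Phi>) y) x =
    cinner ((W ^^ d) y) (shift_pair.poly_op k U l W U' d \<Phi> x)"
proof -
  interpret shift_pair k V U l W U' by fact
  interpret swap: shift_pair l W U' k V U ..
  have adj: "cinner (swap.unit_op a b y) x = cinner y (unit_op b a x)" if "a < k" "b < l" for a b y
  proof -
    have "cinner (swap.unit_op a b y) x = (\<Sum>m. U' y m b * cnj (U x m a))"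
      unfolding dom.cinner_U swap.U_unit_op using that
      by (simp add: if_distrib [of "\<lambda>x. x * _"] cong: if_cong)
    then show ?thesis by (simp add: cinner_unit_op that)
  qed
  \<comment> \<open>The isometry \<open>W\<close> allows \<open>m\<close> of the \<open>d\<close>
    powers to be cancelled against those on the right.\<close>
  have shift: "cinner ((V ^^ (d - m)) (swap.unit_op a b y)) x = cinner ((W ^^ d) y) ((W ^^ m) (unit_op b a x))"
    if "a < k" "b < l" "m \<le> d" for a b m
  proof -
    have "(W ^^ d) y = (W ^^ m) ((W ^^ (d - m)) y)"
      using that(3) by (metis funpow_add comp_apply le_add_diff_inverse)
    then show ?thesis
      by (simp add: cod.cinner_funpow swap.unit_op_funpow adj that)
  qed
  have "cinner (swap.poly_op d (reflect_mat d \<Phi>) y) x = (\<Sum>a<k. \<Sum>b<l. \<Sum>m\<le>d.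
      cnj (coeff (\<Phi> b a) (d - m)) * cinner ((V ^^ m) (swap.unit_op a b y)) x)"
    unfolding swap.poly_op_def cinner_sum_left cinner_scaleC_left
    by (intro sum.cong refl) (simp add: coeff_reflect_mat)
  also have "\<dots> = (\<Sum>a<k. \<Sum>b<l. \<Sum>m\<le>d.
      cnj (coeff (\<Phi> b a) m) * cinner ((V ^^ (d - m)) (swap.unit_op a b y)) x)"
    by (rule sum.cong [OF refl], rule sum.cong [OF refl], rule sum.reindex_bij_witness [of _ "\<lambda>m. d - m" "\<lambda>m. d - m"]) auto
  also have "\<dots> = (\<Sum>a<k. \<Sum>b<l. \<Sum>m\<le>d.
      cnj (coeff (\<Phi> b a) m) * cinner ((W ^^ d) y) ((W ^^ m) (unit_op b a x)))"
    by (intro sum.cong refl) (simp add: shift)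
  also have "\<dots> = (\<Sum>b<l. \<Sum>a<k. \<Sum>m\<le>d.
      cnj (coeff (\<Phi> b a) m) * cinner ((W ^^ d) y) ((W ^^ m) (unit_op b a x)))"
    by (rule sum.swap)
  also have "\<dots> = cinner ((W ^^ d) y) (poly_op d \<Phi> x)"
    unfolding poly_op_def cinner_sum_right cinner_scaleC_right ..
  finally show ?thesis .
qed

text \<open>The range of \<open>Y Z - S Y\<close> is orthogonal to the range of \<open>S\<close>, because \<open>Y = X\<^sup>* W\<^sup>d\<close>. Multiplication by
  \<open>q\<close> moves it into the range of \<open>S\<close>.\<close>
lemma adjoint_intertwines:
  assumes "shift_pair k V U l W U'"
    and Y: "clinear_map Y" "\<And>y. Y (W y) = V (Y y)"
    and adj: "\<And>x y. cinner (Y y) x = cinner ((W ^^ d) y) (X x)"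
    and S: "isometry S" "\<And>x. S (V x) = V (S x)" and Z: "isometry Z" "\<And>y. Z (W y) = W (Z y)"
    and XS: "\<And>x. X (S x) = Z (X x)"
    and q: "q \<noteq> 0" "\<forall>x. \<exists>y. shift_model.crd U (S y) = (\<lambda>a. fps_of_poly q * shift_model.crd U x a)"
  shows "Y (Z y) = S (Y y)"
proof -
  interpret shift_pair k V U l W U' by fact
  interpret swap: shift_pair l W U' k V U ..
  have lin: "clinear_map S" "clinear_map Z"
    using S(1) Z(1) by (auto simp: isometry_def bounded_clinear_imp_clinear_map)
  define w where "w y = Y (Z y) - S (Y y)" for y
  have "clinear_map w"
    by (auto simp: clinear_map_def w_def clinear_mapD [OF Y(1)] clinear_mapD [OF lin(1)]
        clinear_mapD [OF lin(2)] cvec.scale_right_diff_distrib)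
  moreover have "w (W y) = V (w y)" for y
    by (simp add: w_def Z(2) S(2) Y(2) clinear_mapD(4) [OF dom.V_clinear])
  \<comment> \<open>The defect \<open>w\<close> commutes with the shifts, so it has a matrix and
    multiplication by \<open>q\<close> passes through it.\<close>
  ultimately obtain \<Omega> where \<Omega>: "swap.represents \<Omega> w" using swap.ex_represents by blast
  have orth: "cinner (w y) (S x) = 0" for x y
  proof -
    have ZW: "(W ^^ d) (Z y) = Z ((W ^^ d) y)" by (induction d) (simp_all add: Z(2))
    have "cinner (Y (Z y)) (S x) = cinner (Z ((W ^^ d) y)) (Z (X x))"
      by (simp add: adj XS ZW)
    also have "\<dots> = cinner (Y y) x" by (simp add: isometry_cinner [OF Z(1)] adj)
    also have "\<dots> = cinner (S (Y y)) (S x)" by (simp add: isometry_cinner [OF S(1)])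
    finally show ?thesis by (simp add: w_def cinner_diff_left)
  qed
  obtain y' where y': "cod.crd y' = (\<lambda>a. fps_of_poly q * cod.crd y a)"
    using cod.ex_crd_poly by blast
  have wy': "dom.crd (w y') = (\<lambda>a. fps_of_poly q * dom.crd (w y) a)"
    by (simp add: swap.representsD [OF \<Omega>] y' mapply_scale)
  \<comment> \<open>Now \<open>w y'\<close> lies in the range of \<open>S\<close> and is orthogonal
    to it, so it is zero; cancelling \<open>q\<close> gives \<open>w y = 0\<close>.\<close>
  obtain u where "dom.crd (S u) = (\<lambda>a. fps_of_poly q * dom.crd (w y) a)" using q(2) by blast
  then have "S u = w y'" using wy' by (intro dom.crd_inj) simp
  then have "w y' = 0" using orth [of y' u] by (simp add: cinner_self)
  then have "fps_of_poly q * dom.crd (w y) a = 0" for a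
    using fun_cong [OF wy', of a] by (simp add: dom.crd_zero)
  then have "dom.crd (w y) = dom.crd 0"
    using q(1) by (auto simp: dom.crd_zero)
  then have "w y = 0" by (rule dom.crd_inj)
  then show ?thesis by (simp add: w_def)
qed

text \<open>Split off one root at a time. As \<open>V\<close> is an isometry, \<open>V - z\<close>
  is bounded below by the distance of \<open>cmod z\<close> from 1, which is positive off the
  circle.\<close>

lemma (in shift_model) poly_mult_bounded_below:
  assumes "p \<noteq> 0" "\<And>z. cmod z = 1 \<Longrightarrow> poly p z \<noteq> 0"
  shows "\<exists>c>0. \<forall>x y. crd y = (\<lambda>a. fps_of_poly p * crd x a) \<longrightarrow> c * norm x \<le> norm y"
  using assms
proof (induction "degree p" arbitrary: p rule: less_induct)
  case less
  show ?case
  proof (cases "degree p = 0")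
    case True
    then obtain c where c: "p = [:c:]" by (rule degree_eq_zeroE)
    have "norm y = cmod c * norm x" if "crd y = (\<lambda>a. fps_of_poly p * crd x a)" for x y
    proof -
      have "y = c *\<^sub>C x"
        using that by (intro crd_inj) (simp add: c crd_scaleC fps_of_poly_const)
      then show ?thesis by (simp add: norm_scaleC)
    qed
    moreover have "cmod c > 0" using less.prems(1) c by auto
    ultimately show ?thesis by (intro exI [of _ "cmod c"]) simp
  next
    case False
    then obtain z where z: "poly p z = 0"
      using fundamental_theorem_of_algebra [of p] by (auto simp: constant_degree)
    then obtain r where r: "p = [:-z, 1:] * r" by (auto simp: poly_eq_0_iff_dvd)
    then have r0: "r \<noteq> 0" using less.prems(1) by auto
    have "degree r < degree p" using r0 by (simp add: r degree_mult_eq del: mult_pCons_left)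
    moreover have "poly r w \<noteq> 0" if "cmod w = 1" for w
      using less.prems(2) [OF that] by (simp add: r)
    ultimately obtain c where c: "c > 0"
      "\<And>x y. crd y = (\<lambda>a. fps_of_poly r * crd x a) \<Longrightarrow> c * norm x \<le> norm y"
      using less.hyps r0 by blast
    have "\<bar>1 - cmod z\<bar> > 0" using less.prems(2) [of z] z by auto
    moreover have "(\<bar>1 - cmod z\<bar> * c) * norm x \<le> norm y"
      if y: "crd y = (\<lambda>a. fps_of_poly p * crd x a)" for x y
    proof -
      obtain u where u: "crd u = (\<lambda>a. fps_of_poly r * crd x a)" using ex_crd_poly by blast
      have lin: "fps_of_poly [:-z, 1:] = fps_X - fps_const z"
        by (simp add: fps_of_poly_linear)
      have "crd y = crd (V u - z *\<^sub>C u)"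
        unfolding y r fps_of_poly_mult lin crd_diff crd_V crd_scaleC u
        by (simp only: mult.assoc left_diff_distrib)
      then have "y = V u - z *\<^sub>C u" by (rule crd_inj)
      then have "norm y \<ge> \<bar>norm (V u) - norm (z *\<^sub>C u)\<bar>"
        by (simp add: norm_triangle_ineq3)
      also have "norm (V u) - norm (z *\<^sub>C u) = (1 - cmod z) * norm u"
        by (simp add: norm_V norm_scaleC left_diff_distrib)
      also have "\<bar>(1 - cmod z) * norm u\<bar> = \<bar>1 - cmod z\<bar> * norm u"
        by (simp add: abs_mult)
      finally have "\<bar>1 - cmod z\<bar> * norm u \<le> norm y" .
      moreover have "\<bar>1 - cmod z\<bar> * (c * norm x) \<le> \<bar>1 - cmod z\<bar> * norm u"
        using c(2) [OF u] by (intro mult_left_mono) auto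
      ultimately show ?thesis by (simp add: mult.assoc)
    qed
    ultimately show ?thesis using c(1) by (intro exI [of _ "\<bar>1 - cmod z\<bar> * c"]) auto
  qed
qed

text \<open>More independent vectors than functionals would have a nontrivial combination on which
  all functionals vanish.\<close>

lemma finite_cdim_separated:
  fixes F :: "'a::complex_hilbert_space set" and \<phi> :: "'i \<Rightarrow> 'a \<Rightarrow> complex"
  assumes F: "cvec.subspace F" and "finite I"
    and lin: "\<And>i x y. \<phi> i (x + y) = \<phi> i x + \<phi> i y" "\<And>i c x. \<phi> i (c *\<^sub>C x) = c * \<phi> i x"
    and sep: "\<And>x. x \<in> F \<Longrightarrow> (\<And>i. i \<in> I \<Longrightarrow> \<phi> i x = 0) \<Longrightarrow> x = 0"
  shows "finite_cdim F"
proof -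
  obtain B where B: "B \<subseteq> F" "cvec.independent B" "F \<subseteq> cvec.span B"
    using cvec.maximal_independent_subset by blast
  have "cvec.span B \<subseteq> F" using B(1) F by (rule cvec.span_minimal)
  moreover have "finite B"
  proof (rule ccontr)
    assume "infinite B"
    then obtain C where C: "finite C" "card C = Suc (card I)" "C \<subseteq> B"
      using infinite_arbitrarily_large by blast
    have "is_subring (UNIV :: complex set)" by (simp add: is_subring_def)
    then obtain v where v: "\<exists>b\<in>C. v b \<noteq> 0" "\<And>i. i \<in> I \<Longrightarrow> (\<Sum>b\<in>C. \<phi> i b * v b) = 0"
      using underdetermined_system [of I C UNIV \<phi>] \<open>finite I\<close> C(2) by auto
    let ?s = "\<Sum>b\<in>C. v b *\<^sub>C b"
    have zero: "\<phi> i 0 = 0" for i using lin(1) [of i 0 0] by simp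
    have "\<phi> i (\<Sum>b\<in>D. v b *\<^sub>C b) = (\<Sum>b\<in>D. \<phi> i b * v b)" for D i
      by (induction D rule: infinite_finite_induct) (auto simp: zero lin mult.commute)
    then have "\<phi> i ?s = 0" if "i \<in> I" for i using v(2) that by simp
    moreover have "?s \<in> F"
      using B(1) C(3) by (intro cvec.subspace_sum [OF F] cvec.subspace_scale [OF F]) auto
    ultimately have "?s = 0" by (intro sep) auto
    then show False using cvec.independentD [OF B(2) C(1,3)] v(1) by blast
  qed
  ultimately show ?thesis using B(3) unfolding finite_cdim_def by blast
qed

lemma ex_degree_bound: "\<exists>d. \<forall>a<(k::nat). \<forall>b<(l::nat). degree (\<Phi> a b) \<le> (d::nat)"
proof (intro exI allI impI)
  fix a b assume "a < k" "b < l"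
  then have "degree (\<Phi> a b) \<le> (\<Sum>b<l. degree (\<Phi> a b))" by (intro member_le_sum) auto
  also have "\<dots> \<le> (\<Sum>a<k. \<Sum>b<l. degree (\<Phi> a b))"
    using \<open>a < k\<close> by (intro member_le_sum [of a "{..<k}" "\<lambda>a. \<Sum>b<l. degree (\<Phi> a b)"]) auto
  finally show "degree (\<Phi> a b) \<le> (\<Sum>a<k. \<Sum>b<l. degree (\<Phi> a b))" .
qed

lemma mapply_adjugate:
  assumes "\<And>a b. a < k \<Longrightarrow> b < k \<Longrightarrow> mmul k A B a b = mscalar q a b" "a < k"
  shows "mapply k (\<lambda>a b. if a < k then fps_of_poly (A a b) else 0)
    (mapply k (\<lambda>a b. if a < k then fps_of_poly (B a b) else 0) v) a = fps_of_poly q * v a"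
proof -
  let ?h = "\<lambda>A a b. fps_of_poly (A a b)"
  have "mapply k (\<lambda>a b. if a < k then ?h A a b else 0) (mapply k (\<lambda>a b. if a < k then ?h B a b else 0) v) a =
      mapply k (?h A) (mapply k (?h B) v) a"
    using assms(2) by (simp add: mapply_def)
  also have "\<dots> = mapply k (\<lambda>a b. fps_of_poly (mmul k A B a b)) v a"
    by (simp only: mapply_mmul [symmetric] mmul_hom [OF comm_ring_hom_fps_of_poly])
  also have "\<dots> = mapply k (mscalar (fps_of_poly q)) v a"
    using assms unfolding mapply_def by (intro sum.cong refl) (auto simp: mscalar_def)
  finally show ?thesis using assms(2) by (simp add: mapply_mscalar)
qed

locale shift_pair_eq = shift_pair k V U k W U'
  for k V and U :: "'a::complex_hilbert_space \<Rightarrow> nat \<Rightarrow> nat \<Rightarrow> complex"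
    and W and U' :: "'b::complex_hilbert_space \<Rightarrow> nat \<Rightarrow> nat \<Rightarrow> complex"
begin

text \<open>Composition with the operator of the adjugate, in either order, is multiplication by the
  determinant. One order gives the lower bound. The other puts all multiples of the determinant into
  the range, so the orthogonal complement consists of solutions of a linear recurrence.\<close>

lemma poly_op_fredholm:
  assumes det: "mdet k \<Phi> \<noteq> 0" and circ: "\<And>z. cmod z = 1 \<Longrightarrow> poly (mdet k \<Phi>) z \<noteq> 0"
    and d: "\<And>a b. a < k \<Longrightarrow> b < k \<Longrightarrow> degree (\<Phi> a b) \<le> d"
  shows "\<exists>c>0. \<forall>x. c * norm x \<le> norm (poly_op d \<Phi> x)"
    and "finite_cdim (orth_compl (range (poly_op d \<Phi>)))"
proof -
  interpret swap: shift_pair k W U' k V U ..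
  let ?\<delta> = "mdet k \<Phi>" and ?X = "poly_op d \<Phi>"
  obtain B where B: "\<And>a b. a < k \<Longrightarrow> b < k \<Longrightarrow> mmul k B \<Phi> a b = mscalar ?\<delta> a b"
    "\<And>a b. a < k \<Longrightarrow> b < k \<Longrightarrow> mmul k \<Phi> B a b = mscalar ?\<delta> a b"
    using ex_adjugate [of k \<Phi>] by metis
  obtain d' where d': "\<And>a b. a < k \<Longrightarrow> b < k \<Longrightarrow> degree (B a b) \<le> d'"
    using ex_degree_bound [of k k B] by blast
  let ?Z = "swap.poly_op d' B"
  have X: "represents (\<lambda>a b. if a < k then fps_of_poly (\<Phi> a b) else 0) ?X"
    by (rule represents_poly_op) (rule d)
  have Z: "swap.represents (\<lambda>a b. if a < k then fps_of_poly (B a b) else 0) ?Z"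
    by (rule swap.represents_poly_op) (rule d')
  have ZX: "dom.crd (?Z (?X x)) = (\<lambda>a. fps_of_poly ?\<delta> * dom.crd x a)" for x
  proof
    fix a show "dom.crd (?Z (?X x)) a = fps_of_poly ?\<delta> * dom.crd x a"
      unfolding swap.representsD [OF Z] representsD [OF X]
      using mapply_adjugate [OF B(1)] by (cases "a < k") (auto simp: dom.crd_outside mapply_def)
  qed
  have XZ: "cod.crd (?X (?Z y)) = (\<lambda>a. fps_of_poly ?\<delta> * cod.crd y a)" for y
  proof
    fix a show "cod.crd (?X (?Z y)) a = fps_of_poly ?\<delta> * cod.crd y a"
      unfolding swap.representsD [OF Z] representsD [OF X]
      using mapply_adjugate [OF B(2)] by (cases "a < k") (auto simp: cod.crd_outside mapply_def)
  qed
  have "bounded_linear ?Z"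
    using swap.bounded_clinear_poly_op [of B d'] d' by (simp add: bounded_clinear_def)
  then obtain K where K: "K > 0" "\<And>y. norm (?Z y) \<le> norm y * K"
    using bounded_linear.pos_bounded by blast
  obtain c where c: "c > 0" "\<And>x y. dom.crd y = (\<lambda>a. fps_of_poly ?\<delta> * dom.crd x a) \<Longrightarrow> c * norm x \<le> norm y"
    using dom.poly_mult_bounded_below [of ?\<delta>] det circ by blast
  have "c / K * norm x \<le> norm (?X x)" for x
    using order_trans [OF c(2) [OF ZX] K(2)] K(1) by (simp add: field_simps)
  then show "\<exists>c>0. \<forall>x. c * norm x \<le> norm (?X x)"
    using c(1) K(1) by (intro exI [of _ "c / K"]) simp
  define F where "F = orth_compl (range ?X)"
  let ?n = "degree ?\<delta>"
  \<comment> \<open>Pair \<open>y\<close> with the determinant times a monomial vector, which lies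
    in the range of \<open>?X\<close>.\<close>
  have rec: "(\<Sum>j\<le>?n. coeff ?\<delta> j * cnj (U' y (m + j) a)) = 0" if y: "y \<in> F" and a: "a < k" for y m a
  proof -
    have "cod.crd (\<Sum>j\<le>?n. coeff ?\<delta> j *\<^sub>C (W ^^ (m + j)) (cod.e a)) = cod.crd (?X (?Z ((W ^^ m) (cod.e a))))"
    proof -
      have "fps_of_poly ?\<delta> = (\<Sum>j\<le>?n. fps_const (coeff ?\<delta> j) * fps_X ^ j)"
        unfolding fps_of_poly_monom [symmetric] fps_of_poly_sum [symmetric]
        by (simp add: poly_as_sum_of_monoms)
      then show ?thesis
        unfolding XZ cod.crd_sum cod.crd_scaleC cod.crd_funpow
        by (simp add: sum_distrib_left power_add ac_simps)
    qed
    from cod.crd_inj [OF this]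
    have "(\<Sum>j\<le>?n. coeff ?\<delta> j *\<^sub>C (W ^^ (m + j)) (cod.e a)) \<in> range ?X"
      by simp
    then have "cinner (\<Sum>j\<le>?n. coeff ?\<delta> j *\<^sub>C (W ^^ (m + j)) (cod.e a)) y = 0"
      using y by (auto simp: F_def orth_compl_def)
    moreover have "cinner ((W ^^ (m + j)) (cod.e a)) y = cnj (U' y (m + j) a)" for j
      by (subst cinner_commute) (simp add: cod.cinner_monomial [OF a])
    ultimately show ?thesis by (simp add: cinner_sum_left cinner_scaleC_left)
  qed
  have "y = 0" if y: "y \<in> F" and init: "\<And>m a. m < ?n \<Longrightarrow> a < k \<Longrightarrow> U' y m a = 0" for y
  proof -
    have "U' y m a = 0" if a: "a < k" for m a
    proof (induction m rule: less_induct)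
      case (less m)
      show ?case
      proof (cases "m < ?n")
        case True
        then show ?thesis using init a by blast
      next
        case False
        \<comment> \<open>The leading coefficient is nonzero, so the recurrence started at
          \<open>m - ?n\<close> determines the coordinate \<open>m\<close> from the preceding
          ones.\<close>
        have "(\<Sum>j\<in>{..?n} - {?n}. coeff ?\<delta> j * cnj (U' y (m - ?n + j) a)) = 0"
        proof (intro sum.neutral ballI)
          fix j assume "j \<in> {..?n} - {?n}"
          then have "m - ?n + j < m" using False by auto
          then show "coeff ?\<delta> j * cnj (U' y (m - ?n + j) a) = 0" by (simp add: less)
        qed
        then have "(\<Sum>j\<le>?n. coeff ?\<delta> j * cnj (U' y (m - ?n + j) a)) = coeff ?\<delta> ?n * cnj (U' y m a)"
          using False by (subst sum.remove [of _ ?n]) auto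
        with rec [OF y a, of "m - ?n"] det show ?thesis by simp
      qed
    qed
    then have "fps_nth (cod.crd y a) m = fps_nth (cod.crd 0 a) m" for m a
      by (cases "a < k") (auto simp: cod.crd_zero cod.crd_outside simp del: cod.crd_nth, simp)
    then have "cod.crd y = cod.crd 0" by (simp add: fps_eq_iff fun_eq_iff del: cod.crd_nth)
    then show ?thesis by (rule cod.crd_inj)
  qed
  moreover have "cvec.subspace F"
    unfolding cvec.subspace_def F_def orth_compl_def
    by (auto simp: cinner_zero_right cinner_add_right cinner_scaleC_right)
  moreover have "U' (x + y) m a = U' x m a + U' y m a" "U' (c *\<^sub>C x) m a = c * U' x m a" for x y c m a
    using cod.crd_nth [of "x + y" a m] cod.crd_nth [of "c *\<^sub>C x" a m]
    by (simp_all add: cod.crd_add cod.crd_scaleC)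
  ultimately have "finite_cdim F"
    by (intro finite_cdim_separated [of F "{..<?n} \<times> {..<k}" "\<lambda>(m, a) y. U' y m a"]) auto
  then show "finite_cdim (orth_compl (range ?X))" by (simp add: F_def)
qed

end

section \<open>Fredholm intertwiners\<close>

text \<open>Formally \<open>T\<close> and \<open>R\<close> are \<open>q\<close> times the inverses
  of \<Theta> and \<Omega>, and inverting both sides preserves an intertwining relation. It serves
  to pass from the operator matrices to the polynomial ones and back.\<close>

lemma intertwine_quotient:
  fixes \<Phi> :: "nat \<Rightarrow> nat \<Rightarrow> 'r::idom"
  assumes "q \<noteq> 0"
    and T\<Theta>: "\<And>a b. a < k \<Longrightarrow> b < k \<Longrightarrow> mmul k T \<Theta> a b = mscalar q a b"
    and \<Omega>R: "\<And>a b. a < k \<Longrightarrow> b < k \<Longrightarrow> mmul k \<Omega> R a b = mscalar q a b"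
    and \<Phi>T: "\<And>a b. a < k \<Longrightarrow> b < k \<Longrightarrow> mmul k \<Phi> T a b = mmul k R \<Phi> a b"
    and ab: "a < k" "b < k"
  shows "mmul k \<Phi> \<Theta> a b = mmul k \<Omega> \<Phi> a b"
proof -
  have "q * mmul k \<Omega> \<Phi> a b = mmul k (mmul k \<Omega> \<Phi>) (mscalar q) a b"
    by (simp add: mmul_mscalar_right ab)
  also have "\<dots> = mmul k (mmul k \<Omega> \<Phi>) (mmul k T \<Theta>) a b"
    by (rule mmul_cong [OF refl]) (simp add: T\<Theta> ab)
  also have "\<dots> = mmul k \<Omega> (mmul k (mmul k \<Phi> T) \<Theta>) a b"
    by (simp add: mmul_assoc)
  also have "\<dots> = mmul k \<Omega> (mmul k (mmul k R \<Phi>) \<Theta>) a b"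
    by (rule mmul_cong [OF refl], rule mmul_cong) (simp_all add: \<Phi>T)
  also have "\<dots> = mmul k (mmul k \<Omega> R) (mmul k \<Phi> \<Theta>) a b"
    by (simp add: mmul_assoc)
  also have "\<dots> = mmul k (mscalar q) (mmul k \<Phi> \<Theta>) a b"
    by (rule mmul_cong) (simp_all add: \<Omega>R ab)
  also have "\<dots> = q * mmul k \<Phi> \<Theta> a b"
    by (simp add: mmul_mscalar_left ab)
  finally show ?thesis using \<open>q \<noteq> 0\<close> by simp
qed

lemma (in shift_pair) multiplicity_le:
  assumes "clinear_map X" "inj X" "\<And>x. X (V x) = W (X x)"
  shows "k \<le> l"
  using ex_represents [OF assms(1,3)] injective_intertwiner(1) [OF _ assms(1,2)] by blast

context shift_pair_eq
begin

text \<open>Among polynomial intertwiners with nonzero determinant choose one with the fewest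
  determinant roots on the circle. A remaining root could be removed, so there is none.\<close>

lemma ex_fredholm_intertwiner:
  fixes I :: "'i set"
  assumes "finite I"
    and Vs: "\<And>i. i \<in> I \<Longrightarrow> isometry (Vs i)" "\<And>i x. i \<in> I \<Longrightarrow> Vs i (V x) = V (Vs i x)"
    and Ws: "\<And>i. i \<in> I \<Longrightarrow> isometry (Ws i)" "\<And>i y. i \<in> I \<Longrightarrow> Ws i (W y) = W (Ws i y)"
    and q: "q \<noteq> 0"
      "\<And>i. i \<in> I \<Longrightarrow> \<forall>x. \<exists>y. dom.crd (Vs i y) = (\<lambda>a. fps_of_poly q * dom.crd x a)"
      "\<And>i. i \<in> I \<Longrightarrow> \<forall>x. \<exists>y. cod.crd (Ws i y) = (\<lambda>a. fps_of_poly q * cod.crd x a)"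
    and X: "clinear_map X" "inj X" "\<And>x. X (V x) = W (X x)" "\<And>i x. i \<in> I \<Longrightarrow> X (Vs i x) = Ws i (X x)"
  shows "\<exists>d \<Phi>. (\<forall>a<k. \<forall>b<k. degree (\<Phi> a b) \<le> d) \<and> mdet k \<Phi> \<noteq> 0 \<and>
    (\<forall>z. cmod z = 1 \<longrightarrow> poly (mdet k \<Phi>) z \<noteq> 0) \<and>
    (\<forall>i\<in>I. \<forall>x. poly_op d \<Phi> (Vs i x) = Ws i (poly_op d \<Phi> x))"
proof -
  interpret swap: shift_pair k W U' k V U ..
  define P where "P \<Phi> = (\<lambda>a b. fps_of_poly (\<Phi> a b))" for \<Phi> :: "nat \<Rightarrow> nat \<Rightarrow> complex poly"
  let ?q = "fps_of_poly q"
  have q0: "?q \<noteq> 0" using q(1) by simp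
  have "\<forall>i\<in>I. \<exists>\<Theta>. dom.self.represents \<Theta> (Vs i)" "\<forall>i\<in>I. \<exists>\<Omega>. cod.self.represents \<Omega> (Ws i)"
    using dom.self.ex_represents cod.self.ex_represents Vs Ws
    by (auto simp: isometry_def bounded_clinear_imp_clinear_map)
  then obtain \<Theta> \<Omega> where \<Theta>: "\<And>i. i \<in> I \<Longrightarrow> dom.self.represents (\<Theta> i) (Vs i)"
    and \<Omega>: "\<And>i. i \<in> I \<Longrightarrow> cod.self.represents (\<Omega> i) (Ws i)"
    by metis
  \<comment> \<open>The entries of \<Theta> and \<Omega> are only power series; the quotients by
    \<open>q\<close> express the same relations with polynomial coefficients.\<close>
  have "\<exists>T. \<forall>a<k. \<forall>b<k. mmul k (\<Theta> i) (P T) a b = mscalar ?q a b \<and> mmul k (P T) (\<Theta> i) a b = mscalar ?q a b"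
    if "i \<in> I" for i
    unfolding P_def by (rule dom.ex_quotient_matrix [OF Vs(1) Vs(2) \<Theta> q(1) q(2)]) (use that in auto)
  then obtain T where T: "\<And>i a b. i \<in> I \<Longrightarrow> a < k \<Longrightarrow> b < k \<Longrightarrow> mmul k (\<Theta> i) (P (T i)) a b = mscalar ?q a b"
    "\<And>i a b. i \<in> I \<Longrightarrow> a < k \<Longrightarrow> b < k \<Longrightarrow> mmul k (P (T i)) (\<Theta> i) a b = mscalar ?q a b"
    by metis
  have "\<exists>R. \<forall>a<k. \<forall>b<k. mmul k (\<Omega> i) (P R) a b = mscalar ?q a b \<and> mmul k (P R) (\<Omega> i) a b = mscalar ?q a b"
    if "i \<in> I" for i
    unfolding P_def by (rule cod.ex_quotient_matrix [OF Ws(1) Ws(2) \<Omega> q(1) q(3)]) (use that in auto)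
  then obtain R where R: "\<And>i a b. i \<in> I \<Longrightarrow> a < k \<Longrightarrow> b < k \<Longrightarrow> mmul k (\<Omega> i) (P (R i)) a b = mscalar ?q a b"
    "\<And>i a b. i \<in> I \<Longrightarrow> a < k \<Longrightarrow> b < k \<Longrightarrow> mmul k (P (R i)) (\<Omega> i) a b = mscalar ?q a b"
    by metis
  obtain \<Xi> where \<Xi>: "represents \<Xi> X" using ex_represents [OF X(1,3)] by blast
  have \<Xi>_int: "mmul k \<Xi> (\<Theta> i) a b = mmul k (\<Omega> i) \<Xi> a b" if "i \<in> I" "a < k" "b < k" for i a b
    using represents_commute_iff [OF \<Theta> \<Xi> \<Omega>] X(4) that by blast
  have \<Xi>_TR: "mmul k \<Xi> (P (T i)) a b = mmul k (P (R i)) \<Xi> a b" if "i \<in> I" "a < k" "b < k" for i a b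
    by (rule intertwine_quotient [OF q0, where T = "\<Theta> i" and R = "\<Omega> i"]) (use that T(1) R(2) \<Xi>_int in auto)
  have \<Xi>_det: "mdet k \<Xi> \<noteq> 0" using injective_intertwiner(2) [OF \<Xi> X(1,2)] by simp
  define good where "good \<Phi> \<longleftrightarrow> mdet k \<Phi> \<noteq> 0 \<and>
    (\<forall>i\<in>I. \<forall>a<k. \<forall>b<k. mmul k (P \<Phi>) (\<Theta> i) a b = mmul k (\<Omega> i) (P \<Phi>) a b)" for \<Phi>
  have good_ex: "\<exists>\<Phi>. good \<Phi>"
  proof -
    obtain \<Phi> where \<Phi>: "mdet k \<Phi> \<noteq> 0"
      "\<forall>i\<in>I. \<forall>a<k. \<forall>b<k. mmul k (P \<Phi>) (P (T i)) a b = mmul k (P (R i)) (P \<Phi>) a b"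
      using ex_polynomial_intertwiner [of I k \<Xi> T R] \<open>finite I\<close> \<Xi>_TR \<Xi>_det unfolding P_def by blast
    have "mmul k (P \<Phi>) (\<Theta> i) a b = mmul k (\<Omega> i) (P \<Phi>) a b" if "i \<in> I" "a < k" "b < k" for i a b
      by (rule intertwine_quotient [OF q0, where T = "P (T i)" and R = "P (R i)"]) (use that T(2) R(1) \<Phi>(2) in auto)
    with \<Phi>(1) show ?thesis unfolding good_def by blast
  qed
  have good_op: "poly_op d \<Phi> (Vs i x) = Ws i (poly_op d \<Phi> x)"
    if \<Phi>: "good \<Phi>" and d: "\<forall>a<k. \<forall>b<k. degree (\<Phi> a b) \<le> d" and i: "i \<in> I" for \<Phi> d i x
  proof -
    let ?\<Phi> = "\<lambda>a b. if a < k then fps_of_poly (\<Phi> a b) else 0"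
    have rep: "represents ?\<Phi> (poly_op d \<Phi>)" by (rule represents_poly_op) (use d in blast)
    have "mmul k ?\<Phi> (\<Theta> i) a b = mmul k (\<Omega> i) ?\<Phi> a b" if "a < k" "b < k" for a b
    proof -
      have "mmul k ?\<Phi> (\<Theta> i) a b = mmul k (P \<Phi>) (\<Theta> i) a b" "mmul k (\<Omega> i) ?\<Phi> a b = mmul k (\<Omega> i) (P \<Phi>) a b"
        using that by (auto simp: mmul_def P_def)
      with \<Phi> i that show ?thesis by (simp add: good_def)
    qed
    then show ?thesis using represents_commute_iff [OF \<Theta> [OF i] rep \<Omega> [OF i]] by blast
  qed
  have descent: "\<exists>\<Phi>'. good \<Phi>' \<and> circle_roots (mdet k \<Phi>') < circle_roots (mdet k \<Phi>)"
    if \<Phi>: "good \<Phi>" and \<zeta>: "cmod \<zeta> = 1" "poly (mdet k \<Phi>) \<zeta> = 0" for \<Phi> \<zeta>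
  proof -
    obtain d where d: "\<forall>a<k. \<forall>b<k. degree (\<Phi> a b) \<le> d"
      using ex_degree_bound [of k k \<Phi>] by blast
    let ?\<Psi> = "reflect_mat d \<Phi>"
    let ?Y = "swap.poly_op d ?\<Psi>" and ?\<Psi>' = "\<lambda>a b. if a < k then fps_of_poly (?\<Psi> a b) else 0"
    have Y: "swap.represents ?\<Psi>' ?Y"
      by (rule swap.represents_poly_op) (rule degree_reflect_mat)
    have adj: "cinner (?Y y) x = cinner ((W ^^ d) y) (poly_op d \<Phi> x)" for x y
      by (rule cinner_poly_op_reflect_mat) (rule shift_pair_axioms)
    \<comment> \<open>The reflected operator intertwines in the opposite direction, so the product
      of the two matrices commutes with each \<open>\<Theta> i\<close>.\<close>
    have "?Y (Ws i y) = Vs i (?Y y)" if i: "i \<in> I" for i y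
    proof (rule adjoint_intertwines [where k = k and V = V and U = U and l = k and W = W and U' = U'
          and X = "poly_op d \<Phi>" and d = d and q = q and S = "Vs i" and Z = "Ws i"])
      show "shift_pair k V U k W U'" by (rule shift_pair_axioms)
      show "clinear_map ?Y" "?Y (W y) = V (?Y y)" for y
        by (rule swap.represents_clinear_map [OF Y])+
      show "poly_op d \<Phi> (Vs i x) = Ws i (poly_op d \<Phi> x)" for x
        by (rule good_op [OF \<Phi> d i])
    qed (use adj Vs Ws q i in blast)+
    then have \<Psi>'_int: "mmul k ?\<Psi>' (\<Omega> i) a b = mmul k (\<Theta> i) ?\<Psi>' a b" if "i \<in> I" "a < k" "b < k" for i a b
      using swap.represents_commute_iff [OF \<Omega> Y \<Theta>] that by blast
    have \<Psi>_int: "mmul k (P ?\<Psi>) (\<Omega> i) a b = mmul k (\<Theta> i) (P ?\<Psi>) a b" if "i \<in> I" "a < k" "b < k" for i a b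
      using \<Psi>'_int [OF that] that by (simp add: mmul_def P_def)
    have comm: "mcommute k (\<lambda>a b. fps_of_poly (mmul k ?\<Psi> \<Phi> a b)) (\<Theta> i)" if i: "i \<in> I" for i
      unfolding mcommute_def mmul_hom [OF comm_ring_hom_fps_of_poly, symmetric] P_def [symmetric]
    proof (intro allI impI)
      fix a b assume ab: "a < k" "b < k"
      have "mmul k (mmul k (P ?\<Psi>) (P \<Phi>)) (\<Theta> i) a b = mmul k (P ?\<Psi>) (mmul k (\<Omega> i) (P \<Phi>)) a b"
        unfolding mmul_assoc by (rule mmul_cong [OF refl]) (use \<Phi> i ab in \<open>auto simp: good_def\<close>)
      also have "\<dots> = mmul k (mmul k (\<Theta> i) (P ?\<Psi>)) (P \<Phi>) a b"
        unfolding mmul_assoc [symmetric] by (rule mmul_cong) (use \<Psi>_int i ab in auto)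
      finally show "mmul k (mmul k (P ?\<Psi>) (P \<Phi>)) (\<Theta> i) a b = mmul k (\<Theta> i) (mmul k (P ?\<Psi>) (P \<Phi>)) a b"
        by (simp add: mmul_assoc)
    qed
    have refl': "reflected k d \<Phi> ?\<Psi>" by (rule reflected_reflect_mat) (use d in blast)
    have "mdet k \<Phi> \<noteq> 0" using \<Phi> by (simp add: good_def)
    from remove_circle_root [OF refl' \<zeta> this] obtain S \<Phi>' where
      S: "\<And>a b. a < k \<Longrightarrow> b < k \<Longrightarrow> [:-\<zeta>, 1:] * \<Phi>' a b = mmul k \<Phi> S a b"
      "\<And>i. i \<in> I \<Longrightarrow> mcommute k (P S) (\<Theta> i)"
      "mdet k \<Phi>' \<noteq> 0" "circle_roots (mdet k \<Phi>') < circle_roots (mdet k \<Phi>)"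
      using comm unfolding P_def by metis
    let ?x = "fps_of_poly [:-\<zeta>, 1:]"
    have x\<Phi>': "?x * P \<Phi>' a b = mmul k (P \<Phi>) (P S) a b" if "a < k" "b < k" for a b
      unfolding P_def mmul_hom [OF comm_ring_hom_fps_of_poly] S(1) [OF that, symmetric] fps_of_poly_mult ..
    \<comment> \<open>The relation is checked after multiplication by \<open>z - \<zeta>\<close>,
      where \<open>\<Phi>'\<close> becomes the product of \<open>\<Phi>\<close> and
      \<open>S\<close>; this factor cancels among power series.\<close>
    have "mmul k (P \<Phi>') (\<Theta> i) a b = mmul k (\<Omega> i) (P \<Phi>') a b" if i: "i \<in> I" and ab: "a < k" "b < k" for i a b
    proof -
      have "?x * mmul k (P \<Phi>') (\<Theta> i) a b = mmul k (mmul k (P \<Phi>) (P S)) (\<Theta> i) a b"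
        unfolding fun_cong [OF fun_cong [OF mmul_scale_left], symmetric]
        by (rule mmul_cong) (use x\<Phi>' ab in auto)
      also have "\<dots> = mmul k (P \<Phi>) (mmul k (\<Theta> i) (P S)) a b"
        unfolding mmul_assoc by (rule mmul_cong [OF refl]) (use mcommuteD [OF S(2) [OF i]] ab in auto)
      also have "\<dots> = mmul k (mmul k (\<Omega> i) (P \<Phi>)) (P S) a b"
        unfolding mmul_assoc [symmetric] by (rule mmul_cong) (use \<Phi> i ab in \<open>auto simp: good_def\<close>)
      also have "\<dots> = ?x * mmul k (\<Omega> i) (P \<Phi>') a b"
        unfolding fun_cong [OF fun_cong [OF mmul_scale_right], symmetric] mmul_assoc
        by (rule mmul_cong [OF refl]) (use x\<Phi>' ab in auto)
      finally show ?thesis by simp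
    qed
    with S(3,4) show ?thesis unfolding good_def by blast
  qed
  define N where "N = (LEAST m. \<exists>\<Phi>. good \<Phi> \<and> circle_roots (mdet k \<Phi>) = m)"
  have "\<exists>m \<Phi>. good \<Phi> \<and> circle_roots (mdet k \<Phi>) = m" using good_ex by blast
  then have "\<exists>\<Phi>. good \<Phi> \<and> circle_roots (mdet k \<Phi>) = N" unfolding N_def by (rule LeastI_ex)
  then obtain \<Phi> where \<Phi>: "good \<Phi>" "circle_roots (mdet k \<Phi>) = N" by blast
  have "poly (mdet k \<Phi>) z \<noteq> 0" if "cmod z = 1" for z
  proof
    assume "poly (mdet k \<Phi>) z = 0"
    from descent [OF \<Phi>(1) that this] obtain \<Phi>' where
      "good \<Phi>'" "circle_roots (mdet k \<Phi>') < N" using \<Phi>(2) by blast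
    then show False using not_less_Least [of "circle_roots (mdet k \<Phi>')"] unfolding N_def by blast
  qed
  moreover obtain d where d: "\<forall>a<k. \<forall>b<k. degree (\<Phi> a b) \<le> d"
    using ex_degree_bound [of k k \<Phi>] by blast
  moreover have "\<forall>i\<in>I. \<forall>x. poly_op d \<Phi> (Vs i x) = Ws i (poly_op d \<Phi> x)"
    using good_op [OF \<Phi>(1) d] by blast
  moreover have "mdet k \<Phi> \<noteq> 0" using \<Phi>(1) by (simp add: good_def)
  ultimately show ?thesis by blast
qed

end

section \<open>From quasi-similarity to virtual embeddings\<close>

lemma ex_shift_model: "shift_of_finite_multiplicity V \<Longrightarrow> \<exists>k U. shift_model k V U"
  unfolding shift_of_finite_multiplicity_def shift_of_multiplicity_def shift_model_def by blast

lemma (in shift_model) ex_common_torsion_poly: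
  assumes "finite I" "\<And>i. i \<in> I \<Longrightarrow> shift_of_finite_multiplicity (Vs i)"
    "\<And>i x. i \<in> I \<Longrightarrow> Vs i (V x) = V (Vs i x)"
  shows "\<exists>q. q \<noteq> 0 \<and> (\<forall>i\<in>I. \<forall>x. \<exists>y. crd (Vs i y) = (\<lambda>a. fps_of_poly q * crd x a))"
  using assms
proof (induction I rule: finite_induct)
  case empty
  then show ?case by (intro exI [of _ 1]) simp
next
  case (insert j I)
  then obtain q where q: "q \<noteq> 0" "\<forall>i\<in>I. \<forall>x. \<exists>y. crd (Vs i y) = (\<lambda>a. fps_of_poly q * crd x a)"
    by auto
  have lin: "clinear_map (Vs i)" if "i \<in> insert j I" for i
    using insert.prems(1) [OF that]
    by (auto simp: shift_of_finite_multiplicity_def shift_of_multiplicity_def isometry_def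
        bounded_clinear_imp_clinear_map)
  obtain l U2 where "shift_model l (Vs j) U2"
    using ex_shift_model [OF insert.prems(1)] by blast
  from ex_torsion_poly [OF this insert.prems(2)] obtain r where
    r: "r \<noteq> 0" "\<forall>x. \<exists>y. crd (Vs j y) = (\<lambda>a. fps_of_poly r * crd x a)" by auto
  have "\<forall>x. \<exists>y. crd (Vs i y) = (\<lambda>a. fps_of_poly (q * r) * crd x a)" if "i \<in> I" for i
    using torsion_poly_mult [of "Vs i" q r] lin insert.prems(2) q(2) that by blast
  moreover have "\<forall>x. \<exists>y. crd (Vs j y) = (\<lambda>a. fps_of_poly (q * r) * crd x a)"
    using torsion_poly_mult [of "Vs j" r q] lin insert.prems(2) r(2) by (simp add: mult.commute)
  ultimately show ?case using q(1) r(1) by (intro exI [of _ "q * r"]) auto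
qed

text \<open>The two injections give opposite inequalities between the multiplicities of the first
  entries. With these equal, \<open>X\<close> leads to a polynomial intertwiner that is bounded
  below with range of finite codimension; it serves as \<open>S\<close>.\<close>

lemma virtually_embeds_of_injective:
  fixes V :: "nat \<Rightarrow> 'a::complex_hilbert_space \<Rightarrow> 'a" and W :: "nat \<Rightarrow> 'b::complex_hilbert_space \<Rightarrow> 'b"
  assumes "n \<ge> 1" and V: "commuting_finite_shifts n V" and W: "commuting_finite_shifts n W"
    and X: "bounded_clinear X" "inj X" "intertwines n X V W"
    and Y: "bounded_clinear Y" "inj Y" "intertwines n Y W V"
  shows "virtually_embeds n V W"
proof -
  have 1: "1 \<in> {1..n}" using \<open>n \<ge> 1\<close> by simp
  have shV: "shift_of_finite_multiplicity (V i)" and shW: "shift_of_finite_multiplicity (W i)"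
    if "i \<in> {1..n}" for i
    using V W that by (auto simp: commuting_finite_shifts_def)
  have commV: "V i (V 1 x) = V 1 (V i x)" and commW: "W i (W 1 y) = W 1 (W i y)" if "i \<in> {1..n}" for i x y
    using V W that 1 unfolding commuting_finite_shifts_def by (metis comp_apply)+
  have intX: "X (V i x) = W i (X x)" and intY: "Y (W i y) = V i (Y y)" if "i \<in> {1..n}" for i x y
    using X(3) Y(3) that unfolding intertwines_def by (metis comp_apply)+
  have isoV: "isometry (V i)" and isoW: "isometry (W i)" if "i \<in> {1..n}" for i
    using shV [OF that] shW [OF that]
    by (auto simp: shift_of_finite_multiplicity_def shift_of_multiplicity_def)
  note lin = X(1) [THEN bounded_clinear_imp_clinear_map] Y(1) [THEN bounded_clinear_imp_clinear_map]
  obtain k U where U: "shift_model k (V 1) U"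
    using ex_shift_model [OF shV [OF 1]] by blast
  obtain l U' where U': "shift_model l (W 1) U'"
    using ex_shift_model [OF shW [OF 1]] by blast
  have "l = k"
    using shift_pair.multiplicity_le [OF shift_pair.intro [OF U U'] lin(1) X(2) intX [OF 1]]
      shift_pair.multiplicity_le [OF shift_pair.intro [OF U' U] lin(2) Y(2) intY [OF 1]] by simp
  with U' have "shift_model k (W 1) U'" by simp
  with U have pair: "shift_pair_eq k (V 1) U (W 1) U'"
    by (simp add: shift_pair_eq_def shift_pair_def)
  interpret shift_pair_eq k "V 1" U "W 1" U' by (rule pair)
  obtain q where q: "q \<noteq> 0" "\<forall>i\<in>{1..n}. \<forall>x. \<exists>y. dom.crd (V i y) = (\<lambda>a. fps_of_poly q * dom.crd x a)"
    using dom.ex_common_torsion_poly [of "{1..n}" V] shV commV by auto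
  obtain r where r: "r \<noteq> 0" "\<forall>i\<in>{1..n}. \<forall>x. \<exists>y. cod.crd (W i y) = (\<lambda>a. fps_of_poly r * cod.crd x a)"
    using cod.ex_common_torsion_poly [of "{1..n}" W] shW commW by auto
  have linV: "clinear_map (V i)" and linW: "clinear_map (W i)" if "i \<in> {1..n}" for i
    using isoV [OF that] isoW [OF that] by (auto simp: isometry_def bounded_clinear_imp_clinear_map)
  \<comment> \<open>The product is a single polynomial that works for both tuples.\<close>
  have qr: "q * r \<noteq> 0"
    "\<And>i. i \<in> {1..n} \<Longrightarrow> \<forall>x. \<exists>y. dom.crd (V i y) = (\<lambda>a. fps_of_poly (q * r) * dom.crd x a)"
    "\<And>i. i \<in> {1..n} \<Longrightarrow> \<forall>x. \<exists>y. cod.crd (W i y) = (\<lambda>a. fps_of_poly (q * r) * cod.crd x a)"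
  proof -
    show "q * r \<noteq> 0" using q(1) r(1) by simp
    fix i assume i: "i \<in> {1..n}"
    show "\<forall>x. \<exists>y. dom.crd (V i y) = (\<lambda>a. fps_of_poly (q * r) * dom.crd x a)"
      by (rule dom.torsion_poly_mult [OF linV [OF i] commV [OF i] bspec [OF q(2) i]])
    show "\<forall>x. \<exists>y. cod.crd (W i y) = (\<lambda>a. fps_of_poly (q * r) * cod.crd x a)"
      unfolding mult.commute [of q r]
      by (rule cod.torsion_poly_mult [OF linW [OF i] commW [OF i] bspec [OF r(2) i]])
  qed
  obtain d \<Phi> where d: "\<forall>a<k. \<forall>b<k. degree (\<Phi> a b) \<le> d" and det: "mdet k \<Phi> \<noteq> 0"
    and circ: "\<forall>z. cmod z = 1 \<longrightarrow> poly (mdet k \<Phi>) z \<noteq> 0"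
    and S_int: "\<forall>i\<in>{1..n}. \<forall>x. poly_op d \<Phi> (V i x) = W i (poly_op d \<Phi> x)"
    using ex_fredholm_intertwiner [of "{1..n}" V W "q * r" X]
      isoV commV isoW commW qr lin(1) X(2) intX [OF 1] intX by auto
  define S where "S = poly_op d \<Phi>"
  obtain c where c: "c > 0" "\<And>x. c * norm x \<le> norm (S x)"
    using poly_op_fredholm(1) [of \<Phi> d] det circ d unfolding S_def by blast
  have fin: "finite_cdim (orth_compl (range S))"
    using poly_op_fredholm(2) [of \<Phi> d] det circ d unfolding S_def by blast
  have bS: "bounded_clinear S"
    unfolding S_def by (rule bounded_clinear_poly_op) (use d in auto)
  note lS = bounded_clinear_imp_clinear_map [OF bS]
  have "inj S"
  proof (rule injI)
    fix x y assume "S x = S y"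
    then have "S (x - y) = 0" by (simp add: clinear_mapD(4) [OF lS])
    with c(2) [of "x - y"] have "c * norm (x - y) \<le> 0" by simp
    with c(1) show "x = y" by (simp add: mult_le_0_iff)
  qed
  \<comment> \<open>The lower bound makes the image of a complete space complete, hence
    closed.\<close>
  have "complete (S ` UNIV)"
    by (rule complete_isometric_image [OF c(1)])
      (use bS c(2) in \<open>auto simp: bounded_clinear_def complete_UNIV\<close>)
  then have "closed (range S)" by (rule complete_imp_closed)
  moreover have "cvec.subspace (range S)"
  proof (rule cvec.subspaceI)
    show "0 \<in> range S"
      using rangeI [of S 0] unfolding clinear_mapD(3) [OF lS] .
    show "x + y \<in> range S" if "x \<in> range S" "y \<in> range S" for x y
    proof -
      from that obtain u v where "x = S u" "y = S v" by blast
      then have "x + y = S (u + v)" by (simp only: clinear_mapD(1) [OF lS])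
      then show ?thesis by (rule range_eqI)
    qed
    show "c *\<^sub>C x \<in> range S" if "x \<in> range S" for c x
    proof -
      from that obtain u where "x = S u" by blast
      then have "c *\<^sub>C x = S (c *\<^sub>C u)" by (simp only: clinear_mapD(2) [OF lS])
      then show ?thesis by (rule range_eqI)
    qed
  qed
  ultimately have "closed_csubspace (range S)" unfolding closed_csubspace_def by blast
  moreover have "W i ` range S \<subseteq> range S" if "i \<in> {1..n}" for i
  proof (intro image_subsetI, elim rangeE)
    fix y x assume "y = S x"
    then have "W i y = S (V i x)" using S_int that unfolding S_def by simp
    then show "W i y \<in> range S" by (rule range_eqI)
  qed
  moreover have "bij_betw S UNIV (range S)" using \<open>inj S\<close> by (simp add: bij_betw_def)
  moreover have "\<forall>y\<in>range S. norm (inv_into UNIV S y) \<le> (1 / c) * norm y"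
    using c \<open>inj S\<close> by (auto simp: field_simps)
  moreover have "intertwines n S V W"
    using S_int by (auto simp: intertwines_def S_def)
  ultimately show ?thesis
    unfolding virtually_embeds_def using bS fin by blast
qed

theorem proposition4p15:
  fixes n :: nat
    and V :: "nat \<Rightarrow> 'a::{complex_hilbert_space, second_countable_topology} \<Rightarrow> 'a"
    and W :: "nat \<Rightarrow> 'b::{complex_hilbert_space, second_countable_topology} \<Rightarrow> 'b"
  assumes "n \<ge> 2"
    and "commuting_finite_shifts n V"
    and "commuting_finite_shifts n W"
    and "virtually_quasi_similar n V W"
  shows "virtually_similar n V W"
proof -
  obtain X Y where X: "bounded_clinear X" "inj X" "intertwines n X V W"
    and Y: "bounded_clinear Y" "inj Y" "intertwines n Y W V"
    using assms(4) unfolding virtually_quasi_similar_def by blast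
  have "n \<ge> 1" using assms(1) by simp
  then show ?thesis
    unfolding virtually_similar_def
    using virtually_embeds_of_injective [OF _ assms(2,3) X Y]
      virtually_embeds_of_injective [OF _ assms(3,2) Y X] by simp
qed

end
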